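(* Let $(R,\mathfrak m)$ be a Cohen-Macaulay local ring of dimension one and multiplicity $e$. Let $\mathcal F$ be the set of $\mathfrak m$-primary ideals of $R$. Then $$\sup_{I\in\mathcal F} r(R\ltimes I)=\begin{cases}1 & \text{if } R \text{ is a DVR},\\ r(R)+e & \text{otherwise.}\end{cases}$$
   Context: All rings are commutative. For a ring $R$ and an $R$-module $M$, the idealization $R\ltimes M$ is the ring with additive group $R\oplus M$ and multiplication $(a,x)(b,y)=(ab,ay+bx)$. If $(R,\mathfrak m)$ is a Cohen-Macaulay (Noetherian) local ring and $M$ is a finitely generated $R$-module with $\operatorname{depth}_R M=\dim R$, then $R\ltimes M$ is a Cohen-Macaulay local ring with maximal ideal $\mathfrak m\times M$ and of dimension $\dim R$. For a Cohen-Macaulay local ring $(A,\mathfrak n)$ of dimension $d$, the Cohen-Macaulay type is $r(A)=\ell_A(\operatorname{Ext}^d_A(A/\mathfrak n,A))$, where $\ell_A$ denotes length. The multiplicity $e$ of $R$ is $e=e^0_{\mathfrak m}(R)=\lim_{n\to\infty} d!\,\ell_R(R/\mathfrak m^n)/n^d$ with $d=\dim R$. *)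

theory Defs
  imports "HOL-Library.Extended_Real" "HOL-Algebra.Ring_Divisibility" "HOL-Algebra.Module" "HOL-Algebra.Ideal_Product"
begin

text \<open>
  Modules are records of type \<^typ>\<open>('a, 'b) module\<close>, which extend ring records.
  The fields \<^const>\<open>mult\<close> and \<^const>\<open>one\<close> of a module carry no meaning (the locale
  \<^locale>\<open>module\<close> does not mention them), and are left undefined below.
\<close>

subsection \<open>Dimension and length\<close>

text \<open>The supremum of the lengths \<open>n\<close> of strict chains \<open>C\<^sub>0 \<subset> \<dots> \<subset> C\<^sub>n\<close> in \<open>S\<close>.\<close>

definition chain_height :: "'a set set \<Rightarrow> enat" where
  "chain_height S =
    (SUP n \<in> {n. \<exists>C. (\<forall>i\<le>n. C i \<in> S) \<and> (\<forall>i<n. C i \<subset> C (Suc i))}. enat n)"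

definition krull_dim :: "('a, 'm) ring_scheme \<Rightarrow> enat" where
  "krull_dim R = chain_height {P. primeideal P R}"

definition module_length :: "('a, 'm) ring_scheme \<Rightarrow> ('a, 'b) module \<Rightarrow> enat" where
  "module_length R M = chain_height {N. submodule N R M}"

subsection \<open>Constructions with modules\<close>

text \<open>An ideal \<open>I\<close> of \<open>R\<close> as an \<open>R\<close>-module; the choice \<open>I = carrier R\<close> gives \<open>R\<close> itself.\<close>

definition ideal_module :: "('a, 'm) ring_scheme \<Rightarrow> 'a set \<Rightarrow> ('a, 'a) module" where
  "ideal_module R I =
    \<lparr>carrier = I, mult = undefined, one = undefined,
     zero = \<zero>\<^bsub>R\<^esub>, add = add R, smult = mult R\<rparr>"

abbreviation ring_module :: "('a, 'm) ring_scheme \<Rightarrow> ('a, 'a) module" where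
  "ring_module R \<equiv> ideal_module R (carrier R)"

definition quotient_module :: "('a, 'b) module \<Rightarrow> 'b set \<Rightarrow> ('a, 'b set) module" where
  "quotient_module M N =
    \<lparr>carrier = a_rcosets\<^bsub>M\<^esub> N, mult = undefined, one = undefined,
     zero = N, add = set_add M, smult = (\<lambda>a X. \<Union>x\<in>X. N +>\<^bsub>M\<^esub> (a \<odot>\<^bsub>M\<^esub> x))\<rparr>"

definition idealization ::
  "('a, 'm) ring_scheme \<Rightarrow> ('a, 'b) module \<Rightarrow> ('a \<times> 'b) ring" where
  "idealization R M =
    \<lparr>carrier = carrier R \<times> carrier M,
     mult = (\<lambda>(a, x) (b, y). (a \<otimes>\<^bsub>R\<^esub> b, a \<odot>\<^bsub>M\<^esub> y \<oplus>\<^bsub>M\<^esub> b \<odot>\<^bsub>M\<^esub> x)),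
     one = (\<one>\<^bsub>R\<^esub>, \<zero>\<^bsub>M\<^esub>),
     zero = (\<zero>\<^bsub>R\<^esub>, \<zero>\<^bsub>M\<^esub>),
     add = (\<lambda>(a, x) (b, y). (a \<oplus>\<^bsub>R\<^esub> b, x \<oplus>\<^bsub>M\<^esub> y))\<rparr>"

text \<open>
  Linear maps are functions restricted to the carrier of the source, so that equal maps
  are equal as HOL functions.
\<close>

definition module_homs ::
  "('a, 'm) ring_scheme \<Rightarrow> ('a, 'b) module \<Rightarrow> ('a, 'c) module \<Rightarrow> ('b \<Rightarrow> 'c) set" where
  "module_homs R M N =
    {f \<in> carrier M \<rightarrow>\<^sub>E carrier N.
      (\<forall>x\<in>carrier M. \<forall>y\<in>carrier M. f (x \<oplus>\<^bsub>M\<^esub> y) = f x \<oplus>\<^bsub>N\<^esub> f y) \<and>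
      (\<forall>a\<in>carrier R. \<forall>x\<in>carrier M. f (a \<odot>\<^bsub>M\<^esub> x) = a \<odot>\<^bsub>N\<^esub> f x)}"

definition hom_module ::
  "('a, 'm) ring_scheme \<Rightarrow> ('a, 'b) module \<Rightarrow> ('a, 'c) module \<Rightarrow> ('a, 'b \<Rightarrow> 'c) module" where
  "hom_module R M N =
    \<lparr>carrier = module_homs R M N, mult = undefined, one = undefined,
     zero = (\<lambda>x\<in>carrier M. \<zero>\<^bsub>N\<^esub>),
     add = (\<lambda>f g. \<lambda>x\<in>carrier M. f x \<oplus>\<^bsub>N\<^esub> g x),
     smult = (\<lambda>a f. \<lambda>x\<in>carrier M. a \<odot>\<^bsub>N\<^esub> f x)\<rparr>"

definition free_module :: "('a, 'm) ring_scheme \<Rightarrow> nat \<Rightarrow> ('a, nat \<Rightarrow> 'a) module" where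
  "free_module R n =
    \<lparr>carrier = {..<n} \<rightarrow>\<^sub>E carrier R, mult = undefined, one = undefined,
     zero = (\<lambda>i\<in>{..<n}. \<zero>\<^bsub>R\<^esub>),
     add = (\<lambda>x y. \<lambda>i\<in>{..<n}. x i \<oplus>\<^bsub>R\<^esub> y i),
     smult = (\<lambda>a x. \<lambda>i\<in>{..<n}. a \<otimes>\<^bsub>R\<^esub> x i)\<rparr>"

subsection \<open>Ext\<close>

text \<open>
  \<open>free_resolution R M k d \<epsilon>\<close>: the sequence
  \<open>\<dots> \<rightarrow> R\<^bsup>k 2\<^esup> \<rightarrow> R\<^bsup>k 1\<^esup> \<rightarrow> R\<^bsup>k 0\<^esup> \<rightarrow> M \<rightarrow> 0\<close> is exact, where \<open>d i\<close> maps
  \<open>R\<^bsup>k (i+1)\<^esup>\<close> to \<open>R\<^bsup>k i\<^esup>\<close> and \<open>\<epsilon>\<close> is the augmentation.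
\<close>

definition free_resolution ::
  "('a, 'm) ring_scheme \<Rightarrow> ('a, 'b) module \<Rightarrow> (nat \<Rightarrow> nat) \<Rightarrow>
    (nat \<Rightarrow> (nat \<Rightarrow> 'a) \<Rightarrow> nat \<Rightarrow> 'a) \<Rightarrow> ((nat \<Rightarrow> 'a) \<Rightarrow> 'b) \<Rightarrow> bool" where
  "free_resolution R M k d \<epsilon> \<longleftrightarrow>
    (let F = (\<lambda>i. free_module R (k i)) in
      \<epsilon> \<in> module_homs R (F 0) M \<and>
      (\<forall>i. d i \<in> module_homs R (F (Suc i)) (F i)) \<and>
      \<epsilon> ` carrier (F 0) = carrier M \<and>
      d 0 ` carrier (F 1) = {x \<in> carrier (F 0). \<epsilon> x = \<zero>\<^bsub>M\<^esub>} \<and>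
      (\<forall>i. d (Suc i) ` carrier (F (Suc (Suc i))) =
            {x \<in> carrier (F (Suc i)). d i x = \<zero>\<^bsub>F i\<^esub>}))"

text \<open>The \<open>n\<close>-th cohomology of the complex \<open>Hom(F\<^sub>\<bullet>, N)\<close>, where \<open>F\<^sub>i = R\<^bsup>k i\<^esup>\<close>.\<close>

definition hom_cocycles ::
  "('a, 'm) ring_scheme \<Rightarrow> (nat \<Rightarrow> nat) \<Rightarrow> (nat \<Rightarrow> (nat \<Rightarrow> 'a) \<Rightarrow> nat \<Rightarrow> 'a) \<Rightarrow>
    ('a, 'c) module \<Rightarrow> nat \<Rightarrow> ((nat \<Rightarrow> 'a) \<Rightarrow> 'c) set" where
  "hom_cocycles R k d N n =
    {f \<in> module_homs R (free_module R (k n)) N.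
      \<forall>x\<in>carrier (free_module R (k (Suc n))). f (d n x) = \<zero>\<^bsub>N\<^esub>}"

definition hom_coboundaries ::
  "('a, 'm) ring_scheme \<Rightarrow> (nat \<Rightarrow> nat) \<Rightarrow> (nat \<Rightarrow> (nat \<Rightarrow> 'a) \<Rightarrow> nat \<Rightarrow> 'a) \<Rightarrow>
    ('a, 'c) module \<Rightarrow> nat \<Rightarrow> ((nat \<Rightarrow> 'a) \<Rightarrow> 'c) set" where
  "hom_coboundaries R k d N n =
    (case n of
       0 \<Rightarrow> {\<zero>\<^bsub>hom_module R (free_module R (k 0)) N\<^esub>}
     | Suc j \<Rightarrow> (\<lambda>g. \<lambda>x\<in>carrier (free_module R (k n)). g (d j x)) `
                 module_homs R (free_module R (k j)) N)"

definition hom_cohomology ::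
  "('a, 'm) ring_scheme \<Rightarrow> (nat \<Rightarrow> nat) \<Rightarrow> (nat \<Rightarrow> (nat \<Rightarrow> 'a) \<Rightarrow> nat \<Rightarrow> 'a) \<Rightarrow>
    ('a, 'c) module \<Rightarrow> nat \<Rightarrow> ('a, ((nat \<Rightarrow> 'a) \<Rightarrow> 'c) set) module" where
  "hom_cohomology R k d N n =
    quotient_module
      ((hom_module R (free_module R (k n)) N)\<lparr>carrier := hom_cocycles R k d N n\<rparr>)
      (hom_coboundaries R k d N n)"

text \<open>
  \<open>Ext R n M N\<close> is \<open>Ext\<^sup>n\<^sub>R(M, N)\<close>, computed from a chosen resolution of \<open>M\<close> by free modules of
  finite rank. It is meant for finitely generated modules \<open>M\<close> over a Noetherian ring \<open>R\<close>,
  where such a resolution exists; up to isomorphism the result does not depend on the choice.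
\<close>

definition Ext ::
  "('a, 'm) ring_scheme \<Rightarrow> nat \<Rightarrow> ('a, 'b) module \<Rightarrow> ('a, 'c) module \<Rightarrow>
    ('a, ((nat \<Rightarrow> 'a) \<Rightarrow> 'c) set) module" where
  "Ext R n M N =
    (case SOME (k, d, \<epsilon>). free_resolution R M k d \<epsilon> of
      (k, d, \<epsilon>) \<Rightarrow> hom_cohomology R k d N n)"

subsection \<open>Local rings\<close>

locale local_ring = cring +
  assumes ex1_maximalideal: "\<exists>!\<mm>. maximalideal \<mm> R"

definition max_ideal :: "('a, 'm) ring_scheme \<Rightarrow> 'a set" where
  "max_ideal R = (THE \<mm>. maximalideal \<mm> R)"

definition residue_module :: "('a, 'm) ring_scheme \<Rightarrow> ('a, 'a set) module" where
  "residue_module R = quotient_module (ring_module R) (max_ideal R)"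

definition regular_sequence :: "('a, 'm) ring_scheme \<Rightarrow> 'a list \<Rightarrow> bool" where
  "regular_sequence R xs \<longleftrightarrow>
    set xs \<subseteq> carrier R \<and> genideal R (set xs) \<noteq> carrier R \<and>
    (\<forall>i<length xs. \<forall>a\<in>carrier R.
      xs ! i \<otimes>\<^bsub>R\<^esub> a \<in> genideal R (set (take i xs)) \<longrightarrow> a \<in> genideal R (set (take i xs)))"

definition depth :: "('a, 'm) ring_scheme \<Rightarrow> enat" where
  "depth R = (SUP xs \<in> {xs. regular_sequence R xs \<and> set xs \<subseteq> max_ideal R}. enat (length xs))"

locale cohen_macaulay_local_ring = local_ring + noetherian_ring +
  assumes depth_eq_dim: "depth R = krull_dim R"

definition discrete_valuation_ring :: "('a, 'm) ring_scheme \<Rightarrow> bool" where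
  "discrete_valuation_ring R \<longleftrightarrow> principal_domain R \<and> local_ring R \<and> \<not> field R"

text \<open>The Cohen-Macaulay type is \<open>\<ell>(Ext\<^sup>d(R/\<mm>, R))\<close> with \<open>d = dim R\<close>.\<close>

definition cm_type :: "('a, 'm) ring_scheme \<Rightarrow> enat" where
  "cm_type R =
    module_length R (Ext R (the_enat (krull_dim R)) (residue_module R) (ring_module R))"

text \<open>
  The multiplicity of \<open>R\<close> with respect to its maximal ideal; the power of an ideal is taken in the
  semiring of ideals of \<open>R\<close>.
\<close>

definition hs_multiplicity :: "('a, 'm) ring_scheme \<Rightarrow> ereal" where
  "hs_multiplicity R =
    (let d = the_enat (krull_dim R) in
      lim (\<lambda>n::nat. ereal (fact d) *
        ereal_of_enat (module_length R
          (quotient_module (ring_module R) (max_ideal R [^]\<^bsub>ideals_set R\<^esub> n)))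
        / ereal (real n ^ d)))"

definition ideal_radical :: "('a, 'm) ring_scheme \<Rightarrow> 'a set \<Rightarrow> 'a set" where
  "ideal_radical R I = {a \<in> carrier R. \<exists>n::nat. a [^]\<^bsub>R\<^esub> n \<in> I}"

definition primary_ideal :: "('a, 'm) ring_scheme \<Rightarrow> 'a set \<Rightarrow> bool" where
  "primary_ideal R I \<longleftrightarrow>
    ideal I R \<and> I \<noteq> carrier R \<and>
    (\<forall>a\<in>carrier R. \<forall>b\<in>carrier R. a \<otimes>\<^bsub>R\<^esub> b \<in> I \<longrightarrow> a \<in> I \<or> b \<in> ideal_radical R I)"

definition max_primary_ideals :: "('a, 'm) ring_scheme \<Rightarrow> 'a set set" where
  "max_primary_ideals R = {I. primary_ideal R I \<and> ideal_radical R I = max_ideal R}"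

end

theory Submission
  imports Defs
begin

text \<open>
  Let \<open>b \<in> \<mm>\<close> be a nonzerodivisor. For every free resolution of the residue field, the first Ext
  module with values in the ring is the socle of the ring modulo \<open>b\<close>. For the idealization of an
  ideal \<open>I\<close> this gives
  \<open>r(R \<ltimes> I) = \<ell>(((bR : \<mm>) \<inter> (bI : I)) / bR) + \<ell>((bI :\<^sub>I \<mm>) / bI)\<close>.
  The first summand is at most \<open>r(R)\<close>. The second one is at most the number \<open>\<mu>(S)\<close> of generators of
  \<open>S = (bI :\<^sub>I \<mm>)\<close>, because \<open>\<mm> S \<subseteq> bI\<close>, and \<open>\<mu>(S) \<le> e\<close>. If \<open>R\<close> is not a DVR, then
  \<open>(bR : \<mm>) \<mm> \<subseteq> b\<mm>\<close>, and both bounds are attained for \<open>I = \<mm>\<^bsup>n+1\<^esup>\<close> with \<open>n\<close> large.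

  The bound \<open>\<mu>(J) \<le> e\<close> for \<open>\<mm>\<close>-primary \<open>J\<close> is well known when the residue field is infinite, where
  \<open>\<mm>\<close> has a principal reduction. Here the generic element of \<open>\<mm>\<close> is replaced by a polynomial \<open>z\<close>
  whose coefficients generate \<open>\<mm>\<close>. By the Dedekind--Mertens lemma, \<open>z h \<in> \<mm>\<^bsup>s+1\<^esup> J[X]\<close> puts the
  coefficients of \<open>h\<close> into the Ratliff--Rush closure of \<open>\<mm>\<^sup>s J\<close>, which is \<open>\<mm>\<^sup>s J\<close> for large \<open>s\<close>
  since some power of \<open>\<mm>\<close> contains a superficial element. So \<open>z\<close> is injective modulo these ideals, and
  counting lengths in growing degree yields \<open>\<mu>(J) \<le> \<ell>(\<mm>\<^sup>s J / \<mm>\<^bsup>s+1\<^esup> J)\<close>. Taking \<open>J = \<mm>\<^sup>i\<close> shows that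
  \<open>\<ell>(\<mm>\<^sup>n / \<mm>\<^bsup>n+1\<^esup>)\<close> is eventually constant, hence equal to \<open>e\<close>, and the bound for general \<open>J\<close> follows.
\<close>

text \<open>The obstacle is a finite residue field. A superficial element \<open>a\<close> may then
  exist only in \<open>\<mm>^t\<close> with \<open>t > 1\<close>, and it bounds the number of
  generators of an \<open>\<mm>\<close>-primary ideal \<open>J\<close> only by the length of
  \<open>J/aJ\<close>, which is \<open>t e\<close>. The polynomial \<open>z\<close> has its
  coefficients in \<open>\<mm>\<close> itself and loses no factor \<open>t\<close>; the superficial
  element is left with the cancellation of a power \<open>a^N\<close>, where its degree does no
  harm. Polynomials of degree below \<open>N\<close> replace the localized polynomial ring: their
  coefficients form modules \<open>J^N\<close> of finite length modulo \<open>\<mm>^s J\<close>, and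
  \<open>z\<close> raises the degree bound by a fixed \<open>g\<close>, which disappears as
  \<open>N\<close> grows. All lengths are those of intervals \<open>B \<subseteq> C\<close> of
  ideals or submodules. The associated graded ring does not occur as a structure; a homogeneous
  ideal of it is a family of ideals \<open>F n\<close> with
  \<open>F n \<cdot> \<mm>^k \<subseteq> F (n + k)\<close>. \<open>Ext\<close> refers to a
  resolution given by a choice operator, so it has to be computed for an arbitrary one. The
  idealization is again a Noetherian local ring of dimension one, and the same computation yields
  its type.\<close>

no_notation Sum_Type.Plus (infixr \<open><+>\<close> 65)

section \<open>Chain heights and lengths\<close>

lemma chain_height_geI:
  assumes "\<And>i. i \<le> n \<Longrightarrow> C i \<in> S" "\<And>i. i < n \<Longrightarrow> C i \<subset> C (Suc i)"
  shows "enat n \<le> chain_height S"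
  unfolding chain_height_def by (rule SUP_upper) (use assms in auto)

lemma chain_height_leI:
  assumes "\<And>n C. \<lbrakk>\<And>i. i \<le> n \<Longrightarrow> C i \<in> S; \<And>i. i < n \<Longrightarrow> C i \<subset> C (Suc i)\<rbrakk> \<Longrightarrow> enat n \<le> h"
  shows "chain_height S \<le> h"
  unfolding chain_height_def by (rule SUP_least) (use assms in auto)

text \<open>The supremum need not be attained: some chain has at least \<open>n\<close> steps and is
  cut off after \<open>n\<close> of them. For \<open>n = 0\<close> the inequality holds even for the
  empty family, hence the assumption that \<open>S\<close> has a member.\<close>

lemma chain_height_geE:
  assumes "enat n \<le> chain_height S" "S \<noteq> {}"
  obtains C where "\<And>i. i \<le> n \<Longrightarrow> C i \<in> S" "\<And>i. i < n \<Longrightarrow> C i \<subset> C (Suc i)"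
proof (cases n)
  case 0
  from assms(2) obtain X where "X \<in> S" by blast
  with 0 show ?thesis using that[of "\<lambda>_. X"] by simp
next
  case (Suc n')
  have "\<exists>k C. n' < k \<and> (\<forall>i\<le>k. C i \<in> S) \<and> (\<forall>i<k. C i \<subset> C (Suc i))"
  proof (rule ccontr)
    assume neg: "\<not> ?thesis"
    have "chain_height S \<le> enat n'"
    proof (rule chain_height_leI)
      fix k C assume "\<And>i. i \<le> k \<Longrightarrow> C i \<in> S" "\<And>i. i < k \<Longrightarrow> C i \<subset> C (Suc i)"
      then have "\<not> n' < k" using neg by blast
      then show "enat k \<le> enat n'" by simp
    qed
    with assms(1) Suc have "enat (Suc n') \<le> enat n'" by (metis order_trans)
    then show False by simp
  qed
  then obtain k C where "n' < k" "\<forall>i\<le>k. C i \<in> S" "\<forall>i<k. C i \<subset> C (Suc i)" by blast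
  with Suc show ?thesis using that[of C] by simp
qed

text \<open>The main device for comparing lengths: a strictly monotone map transports chains. Most
  equalities of lengths below come from one such map in each direction.\<close>

lemma chain_height_le_map:
  assumes "\<And>X. X \<in> S \<Longrightarrow> f X \<in> T"
    and "\<And>X Y. \<lbrakk>X \<in> S; Y \<in> S; X \<subset> Y\<rbrakk> \<Longrightarrow> f X \<subset> f Y"
  shows "chain_height S \<le> chain_height T"
proof (rule chain_height_leI)
  fix n C assume "\<And>i. i \<le> n \<Longrightarrow> C i \<in> S" "\<And>i. i < n \<Longrightarrow> C i \<subset> C (Suc i)"
  then show "enat n \<le> chain_height T"
    by (intro chain_height_geI[of n "\<lambda>i. f (C i)"] assms) auto
qed

lemma chain_height_mono: "S \<subseteq> T \<Longrightarrow> chain_height S \<le> chain_height T"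
  by (rule chain_height_le_map[of _ id]) auto

lemma enat_le_of_nat_le:
  fixes a b :: enat
  assumes "\<And>n. enat n \<le> a \<Longrightarrow> enat n \<le> b"
  shows "a \<le> b"
proof (cases a)
  case (enat n) then show ?thesis using assms[of n] by simp
next
  case infinity
  have "b = \<infinity>"
  proof (rule ccontr)
    assume "b \<noteq> \<infinity>"
    then obtain m where "b = enat m" by auto
    moreover have "enat (Suc m) \<le> b" using assms infinity by simp
    ultimately show False by simp
  qed
  then show ?thesis by simp
qed

text \<open>Lengths are needed for ideals of \<open>R\<close>, for ideals of the idealization, and
  for submodules of free modules and of Hom modules; this locale serves them all. The axiom
  \<open>modular\<close> is the modular law as a cancellation rule.\<close>

locale modular_family =
  fixes P :: "'a set set" and s :: "'a set \<Rightarrow> 'a set \<Rightarrow> 'a set"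
  assumes inter: "\<lbrakk>X \<in> P; Y \<in> P\<rbrakk> \<Longrightarrow> X \<inter> Y \<in> P"
    and join: "\<lbrakk>X \<in> P; Y \<in> P\<rbrakk> \<Longrightarrow> s X Y \<in> P"
    and join_upper1: "\<lbrakk>X \<in> P; Y \<in> P\<rbrakk> \<Longrightarrow> X \<subseteq> s X Y"
    and join_upper2: "\<lbrakk>X \<in> P; Y \<in> P\<rbrakk> \<Longrightarrow> Y \<subseteq> s X Y"
    and join_least: "\<lbrakk>X \<in> P; Y \<in> P; Z \<in> P; X \<subseteq> Z; Y \<subseteq> Z\<rbrakk> \<Longrightarrow> s X Y \<subseteq> Z"
    and modular: "\<lbrakk>X \<in> P; Y \<in> P; D \<in> P; X \<subseteq> Y; X \<inter> D = Y \<inter> D; s X D = s Y D\<rbrakk> \<Longrightarrow> X = Y"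
begin

definition len :: "'a set \<Rightarrow> 'a set \<Rightarrow> enat" where
  "len B C = chain_height {X \<in> P. B \<subseteq> X \<and> X \<subseteq> C}"

lemma len_mono: "\<lbrakk>B' \<subseteq> B; C \<subseteq> C'\<rbrakk> \<Longrightarrow> len B C \<le> len B' C'"
  unfolding len_def by (rule chain_height_mono) auto

lemma len_Suc:
  assumes "B \<in> P" "Y \<in> P" "Z \<in> P" "B \<subseteq> Y" "Y \<subset> Z"
  shows "len B Y + 1 \<le> len B Z"
proof (rule enat_le_of_nat_le)
  fix n assume n: "enat n \<le> len B Y + 1"
  show "enat n \<le> len B Z"
  proof (cases n)
    case 0 then show ?thesis by (simp add: zero_enat_def[symmetric])
  next
    case (Suc m)
    with n have "eSuc (enat m) \<le> eSuc (len B Y)" by (simp add: plus_1_eSuc eSuc_enat add.commute)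
    then have "enat m \<le> len B Y" by simp
    then obtain C where C: "\<And>i. i \<le> m \<Longrightarrow> C i \<in> {X \<in> P. B \<subseteq> X \<and> X \<subseteq> Y}" "\<And>i. i < m \<Longrightarrow> C i \<subset> C (Suc i)"
      unfolding len_def by (rule chain_height_geE) (use assms in auto)
    show ?thesis unfolding len_def Suc
    proof (rule chain_height_geI[of _ "\<lambda>i. if i \<le> m then C i else Z"])
      fix i assume "i \<le> Suc m"
      then show "(if i \<le> m then C i else Z) \<in> {X \<in> P. B \<subseteq> X \<and> X \<subseteq> Z}"
        using C(1)[of i] assms by auto
    next
      fix i assume "i < Suc m"
      then show "(if i \<le> m then C i else Z) \<subset> (if Suc i \<le> m then C (Suc i) else Z)"
        using C(1)[of i] C(2)[of i] assms by (cases "i = m") auto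
    qed
  qed
qed

text \<open>Lengths may be infinite, so chains are compared directly. Upper bound: at each step of a
  chain, the intersection with \<open>D\<close> or the join with \<open>D\<close> grows strictly by
  modularity, so the sum of the lengths below and above \<open>D\<close> grows by at least one.
  Lower bound: a chain below \<open>D\<close> and a chain above \<open>D\<close> are
  concatenated.\<close>

lemma len_additive:
  assumes P: "B \<in> P" "D \<in> P" "C \<in> P" and le: "B \<subseteq> D" "D \<subseteq> C"
  shows "len B C = len B D + len D C"
proof (rule antisym)
  have step: "enat n \<le> len B (X n \<inter> D) + len D (s (X n) D)"
    if "\<And>i. i \<le> n \<Longrightarrow> X i \<in> {X \<in> P. B \<subseteq> X \<and> X \<subseteq> C}" "\<And>i. i < n \<Longrightarrow> X i \<subset> X (Suc i)" for n X
    using that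
  proof (induction n)
    case 0 then show ?case by (simp add: zero_enat_def[symmetric])
  next
    case (Suc n)
    let ?Y = "X n" and ?Z = "X (Suc n)"
    have IH: "enat n \<le> len B (?Y \<inter> D) + len D (s ?Y D)" using Suc by simp
    have YZ: "?Y \<in> P" "?Z \<in> P" "B \<subseteq> ?Y" "?Y \<subset> ?Z"
      using Suc.prems(1)[of n] Suc.prems(1)[of "Suc n"] Suc.prems(2)[of n] by auto
    have iP: "?Y \<inter> D \<in> P" "?Z \<inter> D \<in> P" and jP: "s ?Y D \<in> P" "s ?Z D \<in> P" using YZ P inter join by auto
    have jle: "s ?Y D \<subseteq> s ?Z D"
      using join_least[OF YZ(1) P(2) jP(2)] join_upper1[OF YZ(2) P(2)] join_upper2[OF YZ(2) P(2)] YZ by blast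
    have ile: "?Y \<inter> D \<subseteq> ?Z \<inter> D" using YZ by blast
    have "?Y \<inter> D \<subset> ?Z \<inter> D \<or> s ?Y D \<subset> s ?Z D"
      using modular[OF YZ(1,2) P(2)] YZ jle ile by blast
    then have "len B (?Y \<inter> D) + len D (s ?Y D) + 1 \<le> len B (?Z \<inter> D) + len D (s ?Z D)"
    proof
      assume "?Y \<inter> D \<subset> ?Z \<inter> D"
      then have "len B (?Y \<inter> D) + 1 \<le> len B (?Z \<inter> D)" using len_Suc P iP le YZ by auto
      moreover have "len D (s ?Y D) \<le> len D (s ?Z D)" using len_mono jle by auto
      ultimately have "(len B (?Y \<inter> D) + 1) + len D (s ?Y D) \<le> len B (?Z \<inter> D) + len D (s ?Z D)"
        by (rule add_mono)
      then show ?thesis by (simp only: ac_simps)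
    next
      assume "s ?Y D \<subset> s ?Z D"
      then have "len D (s ?Y D) + 1 \<le> len D (s ?Z D)" using len_Suc P jP join_upper2 YZ by auto
      moreover have "len B (?Y \<inter> D) \<le> len B (?Z \<inter> D)" using len_mono ile by auto
      ultimately have "(len D (s ?Y D) + 1) + len B (?Y \<inter> D) \<le> len D (s ?Z D) + len B (?Z \<inter> D)"
        by (rule add_mono)
      then show ?thesis by (simp only: ac_simps)
    qed
    moreover have "enat (Suc n) \<le> len B (?Y \<inter> D) + len D (s ?Y D) + 1"
      using add_right_mono[OF IH, of 1] by (simp add: one_enat_def)
    ultimately show ?case by (rule order_trans[rotated])
  qed
  show "len B C \<le> len B D + len D C"
    unfolding len_def[of B C]
  proof (rule chain_height_leI)
    fix n X assume X: "\<And>i. i \<le> n \<Longrightarrow> X i \<in> {X \<in> P. B \<subseteq> X \<and> X \<subseteq> C}" "\<And>i. i < n \<Longrightarrow> X i \<subset> X (Suc i)"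
    have "s (X n) D \<subseteq> C" using join_least[of "X n" D C] X(1)[of n] P le by auto
    then have "len B (X n \<inter> D) + len D (s (X n) D) \<le> len B D + len D C"
      by (intro add_mono len_mono) auto
    with step[where n = n and X = X, OF X] show "enat n \<le> len B D + len D C" by (metis order_trans)
  qed
next
  have conc: "enat (p + q) \<le> len B C" if "enat p \<le> len B D" "enat q \<le> len D C" for p q
  proof -
    obtain X where X: "\<And>i. i \<le> p \<Longrightarrow> X i \<in> {X \<in> P. B \<subseteq> X \<and> X \<subseteq> D}" "\<And>i. i < p \<Longrightarrow> X i \<subset> X (Suc i)"
      using \<open>enat p \<le> len B D\<close> unfolding len_def by (rule chain_height_geE) (use P le in auto)
    obtain Y where Y: "\<And>i. i \<le> q \<Longrightarrow> Y i \<in> {X \<in> P. D \<subseteq> X \<and> X \<subseteq> C}" "\<And>i. i < q \<Longrightarrow> Y i \<subset> Y (Suc i)"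
      using \<open>enat q \<le> len D C\<close> unfolding len_def by (rule chain_height_geE) (use P le in auto)
    show ?thesis unfolding len_def
    \<comment> \<open>The given chains have \<open>p + q + 2\<close> members, the new one has
      \<open>p + q + 1\<close>: \<open>X p\<close> is dropped in favour of \<open>Y 0\<close>, which
      contains it because \<open>D\<close> lies between them.\<close>
    proof (rule chain_height_geI[of _ "\<lambda>i. if i < p then X i else Y (i - p)"])
      fix i assume "i \<le> p + q"
      then show "(if i < p then X i else Y (i - p)) \<in> {X \<in> P. B \<subseteq> X \<and> X \<subseteq> C}"
        using X(1)[of i] Y(1)[of "i - p"] le by (cases "i < p") force+
    next
      fix i assume i: "i < p + q"
      consider "Suc i < p" | "Suc i = p" | "p \<le> i" by linarith
      then show "(if i < p then X i else Y (i - p)) \<subset> (if Suc i < p then X (Suc i) else Y (Suc i - p))"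
      proof cases
        case 1 then show ?thesis using X(2)[of i] by simp
      next
        case 2
        have "X i \<subset> X p" "X p \<subseteq> D" "D \<subseteq> Y 0" using X(2)[of i] X(1)[of p] Y(1)[of 0] 2 by auto
        then show ?thesis using 2 by auto
      next
        case 3
        then show ?thesis using Y(2)[of "i - p"] i by (simp add: Suc_diff_le)
      qed
    qed
  qed
  show "len B D + len D C \<le> len B C"
  proof (cases "len B D")
    case p: (enat p)
    show ?thesis
    proof (cases "len D C")
      case (enat q)
      then show ?thesis using conc[of p q] p by simp
    next
      case infinity
      then have "enat n \<le> len B C" for n using conc[of 0 n] by (simp add: zero_enat_def[symmetric])
      then show ?thesis using enat_le_of_nat_le[of "\<infinity>" "len B C"] p infinity by simp
    qed
  next
    case infinity
    then have "enat n \<le> len B C" for n using conc[of n 0] by (simp add: zero_enat_def[symmetric])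
    then show ?thesis using enat_le_of_nat_le[of "\<infinity>" "len B C"] infinity by simp
  qed
qed

lemma len_self: "len B B = 0"
proof -
  have "len B B \<le> 0" unfolding len_def
  proof (rule chain_height_leI)
    fix n X assume X: "\<And>i. i \<le> n \<Longrightarrow> X i \<in> {X \<in> P. B \<subseteq> X \<and> X \<subseteq> B}" "\<And>i. i < n \<Longrightarrow> X i \<subset> X (Suc i)"
    have "n = 0" using X(1)[of 0] X(1)[of 1] X(2)[of 0] by (cases n) auto
    then show "enat n \<le> 0" by (simp add: zero_enat_def)
  qed
  then show ?thesis by simp
qed

end

section \<open>Ideals of a commutative ring\<close>

context cring
begin

lemma idealI':
  assumes "I \<subseteq> carrier R" "\<zero> \<in> I" "\<And>x y. \<lbrakk>x \<in> I; y \<in> I\<rbrakk> \<Longrightarrow> x \<oplus> y \<in> I"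
    and "\<And>r x. \<lbrakk>r \<in> carrier R; x \<in> I\<rbrakk> \<Longrightarrow> r \<otimes> x \<in> I"
  shows "ideal I R"
proof (rule idealI[OF ring_axioms])
  have neg: "\<ominus> x \<in> I" if "x \<in> I" for x
    using assms(4)[of "\<ominus> \<one>" x] assms(1) that by (auto simp: l_minus)
  show "subgroup I (add_monoid R)"
    by (rule subgroup.intro) (use assms neg in \<open>auto simp: a_inv_def\<close>)
  fix a x assume "a \<in> I" "x \<in> carrier R"
  then show "x \<otimes> a \<in> I" using assms by auto
  then show "a \<otimes> x \<in> I" using m_comm[of x a] \<open>a \<in> I\<close> \<open>x \<in> carrier R\<close> assms(1) by auto
qed

lemma ideal_carr: "\<lbrakk>ideal I R; x \<in> I\<rbrakk> \<Longrightarrow> x \<in> carrier R"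
  by (rule ideal.Icarr)

lemma ideal_sub: "ideal I R \<Longrightarrow> I \<subseteq> carrier R"
  by (auto intro: ideal_carr)

lemma ideal_zero: "ideal I R \<Longrightarrow> \<zero> \<in> I"
  by (simp add: additive_subgroup.zero_closed ideal.axioms(1))

lemma ideal_add: "\<lbrakk>ideal I R; x \<in> I; y \<in> I\<rbrakk> \<Longrightarrow> x \<oplus> y \<in> I"
  by (simp add: additive_subgroup.a_closed ideal.axioms(1))

lemma ideal_neg: "\<lbrakk>ideal I R; x \<in> I\<rbrakk> \<Longrightarrow> \<ominus> x \<in> I"
  by (simp add: additive_subgroup.a_inv_closed ideal.axioms(1))

lemma ideal_diff: "\<lbrakk>ideal I R; x \<in> I; y \<in> I\<rbrakk> \<Longrightarrow> x \<ominus> y \<in> I"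
  by (simp add: a_minus_def ideal_add ideal_neg)

lemma ideal_mult: "\<lbrakk>ideal I R; r \<in> carrier R; x \<in> I\<rbrakk> \<Longrightarrow> r \<otimes> x \<in> I"
  by (rule ideal.I_l_closed)

lemma ideal_mult': "\<lbrakk>ideal I R; r \<in> carrier R; x \<in> I\<rbrakk> \<Longrightarrow> x \<otimes> r \<in> I"
  by (rule ideal.I_r_closed)

lemma ideal_add_cancel:
  assumes "ideal I R" "x \<in> carrier R" "y \<in> I" "x \<oplus> y \<in> I"
  shows "x \<in> I"
proof -
  have "(x \<oplus> y) \<ominus> y \<in> I" using assms by (intro ideal_diff)
  moreover have "(x \<oplus> y) \<ominus> y = x" using assms ideal_carr[OF assms(1)] by (simp add: a_minus_def a_assoc r_neg)
  ultimately show ?thesis by simp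
qed

lemma ideal_finsum:
  assumes "ideal I R" "\<And>i. i \<in> A \<Longrightarrow> f i \<in> I"
  shows "finsum R f A \<in> I"
proof (cases "finite A")
  case True
  then show ?thesis using assms(2)
  proof (induction A)
    case empty then show ?case using ideal_zero[OF assms(1)] by simp
  next
    case (insert a A)
    have "finsum R f (insert a A) = f a \<oplus> finsum R f A"
      using insert ideal_carr[OF assms(1)] by (intro finsum_insert) auto
    then show ?case using insert ideal_add[OF assms(1)] by simp
  qed
next
  case False
  then show ?thesis using ideal_zero[OF assms(1)] by (simp add: finsum_def finprod_def)
qed

lemma mem_set_add: "x \<in> I <+> J \<longleftrightarrow> (\<exists>i\<in>I. \<exists>j\<in>J. x = i \<oplus> j)"
  by (auto simp: set_add_defs)

lemma set_add_upper1:
  assumes "ideal I R" "ideal J R" shows "I \<subseteq> I <+> J"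
proof
  fix x assume "x \<in> I"
  moreover have "x = x \<oplus> \<zero>" using ideal_carr[OF assms(1) \<open>x \<in> I\<close>] by simp
  ultimately show "x \<in> I <+> J" unfolding mem_set_add using ideal_zero[OF assms(2)] by blast
qed

lemma set_add_upper2:
  assumes "ideal I R" "ideal J R" shows "J \<subseteq> I <+> J"
proof
  fix x assume "x \<in> J"
  moreover have "x = \<zero> \<oplus> x" using ideal_carr[OF assms(2) \<open>x \<in> J\<close>] by simp
  ultimately show "x \<in> I <+> J" unfolding mem_set_add using ideal_zero[OF assms(1)] by blast
qed

lemma set_add_least: "\<lbrakk>ideal K R; I \<subseteq> K; J \<subseteq> K\<rbrakk> \<Longrightarrow> I <+> J \<subseteq> K"
  unfolding set_add_defs by (auto intro: ideal_add)

lemma set_add_mono': "\<lbrakk>I \<subseteq> I'; J \<subseteq> J'\<rbrakk> \<Longrightarrow> I <+> J \<subseteq> I' <+> J'"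
  unfolding set_add_defs by auto

lemma ideal_inter: "\<lbrakk>ideal I R; ideal J R\<rbrakk> \<Longrightarrow> ideal (I \<inter> J) R"
  by (rule i_intersect)

sublocale ideals: modular_family "{I. ideal I R}" "set_add R"
proof (unfold_locales, goal_cases)
  case 1 then show ?case by (auto intro: ideal_inter)
next
  case 2 then show ?case by (auto intro: add_ideals)
next
  case 3 then show ?case using set_add_upper1 by blast
next
  case 4 then show ?case using set_add_upper2 by blast
next
  case 5 then show ?case using set_add_least by blast
next
  case (6 X Y D)
  have "Y \<subseteq> X"
  proof
    fix y assume y: "y \<in> Y"
    have "y \<in> X <+> D" using y 6 set_add_upper1[of Y D] by auto
    then obtain x d where xd: "x \<in> X" "d \<in> D" "y = x \<oplus> d" by (auto simp: mem_set_add)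
    have "d = y \<ominus> x" using xd 6 ideal_carr[of X x] ideal_carr[of D d]
      by (simp add: a_minus_def a_comm[of x d] a_assoc r_neg)
    then have "d \<in> Y" using y xd 6 ideal_diff[of Y y x] by auto
    then have "d \<in> X" using xd 6 by blast
    then show "y \<in> X" using xd 6 ideal_add by auto
  qed
  then show ?case using 6 by auto
qed

text \<open>Lengths of quotients \<open>C / B\<close> of ideals \<open>B \<subseteq> C\<close>.\<close>

abbreviation ilen :: "'a set \<Rightarrow> 'a set \<Rightarrow> enat" where "ilen \<equiv> ideals.len"

lemma ilen_add: "\<lbrakk>ideal B R; ideal D R; ideal C R; B \<subseteq> D; D \<subseteq> C\<rbrakk> \<Longrightarrow> ilen B C = ilen B D + ilen D C"
  by (rule ideals.len_additive) auto

subsection \<open>Products and powers\<close>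

lemma ideal_prod_least:
  assumes "ideal K R" "\<And>i j. \<lbrakk>i \<in> I; j \<in> J\<rbrakk> \<Longrightarrow> i \<otimes> j \<in> K"
  shows "I \<cdot> J \<subseteq> K"
proof
  fix x assume "x \<in> I \<cdot> J" then show "x \<in> K"
    by (induction rule: ideal_prod.induct) (auto intro: assms ideal_add)
qed

lemma ideal_prod_mono: "\<lbrakk>I \<subseteq> I'; J \<subseteq> J'\<rbrakk> \<Longrightarrow> I \<cdot> J \<subseteq> I' \<cdot> J'"
proof
  fix x assume *: "I \<subseteq> I'" "J \<subseteq> J'" "x \<in> I \<cdot> J"
  from *(3) show "x \<in> I' \<cdot> J'"
    by (induction rule: ideal_prod.induct) (use * in \<open>auto intro: ideal_prod.intros\<close>)
qed

lemma ideal_prod_one_left: "ideal I R \<Longrightarrow> carrier R \<cdot> I = I"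
  using ideal_prod_one ideal_prod_commute oneideal by metis

lemma ideal_prod_sub2: "\<lbrakk>ideal I R; ideal J R\<rbrakk> \<Longrightarrow> I \<cdot> J \<subseteq> J"
  using ideal_prod_inter by blast

lemma ideal_prod_sub1: "\<lbrakk>ideal I R; ideal J R\<rbrakk> \<Longrightarrow> I \<cdot> J \<subseteq> I"
  using ideal_prod_inter by blast

abbreviation ipow :: "'a set \<Rightarrow> nat \<Rightarrow> 'a set" where
  "ipow I n \<equiv> I [^]\<^bsub>ideals_set R\<^esub> n"

lemma ideals_set_simps [simp]:
  "one (ideals_set R) = carrier R" "mult (ideals_set R) = ideal_prod R"
  by (simp_all add: ideals_set_def)

lemma ipow_0: "ipow I 0 = carrier R"
  by simp

lemma ipow_Suc: "ipow I (Suc n) = ipow I n \<cdot> I"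
  by simp

lemma ipow_ideal [intro]: "ideal I R \<Longrightarrow> ideal (ipow I n) R"
  by (induction n) (auto simp: ipow_Suc oneideal ideal_prod_is_ideal)

lemma ipow_1: "ideal I R \<Longrightarrow> ipow I (Suc 0) = I"
  by (simp add: ipow_Suc ideal_prod_one_left)

lemma ipow_add: "ideal I R \<Longrightarrow> ipow I (m + n) = ipow I m \<cdot> ipow I n"
  by (induction n) (auto simp: ipow_Suc ideal_prod_assoc ideal_prod_one ipow_ideal)

lemma ipow_antimono: "\<lbrakk>ideal I R; m \<le> n\<rbrakk> \<Longrightarrow> ipow I n \<subseteq> ipow I m"
  using ipow_add[of I m "n - m"] ideal_prod_sub1[of "ipow I m" "ipow I (n - m)"] by (simp add: ipow_ideal)

lemma ipow_mono: "I \<subseteq> J \<Longrightarrow> ipow I n \<subseteq> ipow J n"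
  by (induction n) (auto simp: ipow_Suc ideal_prod_mono)

lemma ipow_mult_closed:
  assumes "ideal I R" "x \<in> ipow I m" "y \<in> ipow I n"
  shows "x \<otimes> y \<in> ipow I (m + n)"
  using ideal_prod.prod[OF assms(2,3)] by (simp add: ipow_add[OF assms(1)])

lemma ipow_pow_closed:
  assumes "ideal I R" "x \<in> ipow I m"
  shows "x [^] (k::nat) \<in> ipow I (m * k)"
proof (induction k)
  case (Suc k)
  then show ?case using ipow_mult_closed[OF assms(1) Suc assms(2)] by (simp add: add.commute)
qed (simp add: ipow_0)

lemma ipow_prod_ideal:
  "ideal I R \<Longrightarrow> ideal J R \<Longrightarrow> ideal (ipow I n \<cdot> J) R"
  by (simp add: ideal_prod_is_ideal ipow_ideal)

lemma ipow_sub: "\<lbrakk>ideal I R\<rbrakk> \<Longrightarrow> ipow I n \<subseteq> carrier R"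
  by (rule ideal_sub) (rule ipow_ideal)

text \<open>A product of \<open>a + b\<close> factors from \<open>I\<close> and \<open>J\<close> has
  at least \<open>a\<close> factors from \<open>I\<close> or at least \<open>b\<close> from
  \<open>J\<close>. The other factors are kept as a power of \<open>I <+> J\<close>, because
  \<open>ipow_Idl_subset\<close> keeps track of the total degree.\<close>

lemma ipow_sum_pigeonhole:
  assumes I: "ideal I R" and J: "ideal J R"
  shows "ipow (I <+> J) (a + b) \<subseteq> (ipow I a \<cdot> ipow (I <+> J) b) <+> (ipow J b \<cdot> ipow (I <+> J) a)"
proof (induction "a + b" arbitrary: a b)
  case 0
  then show ?case using set_add_upper1[OF oneideal oneideal] by (simp add: ideal_prod_one oneideal)
next
  case (Suc n)
  let ?S = "I <+> J"
  have S: "ideal ?S R" using add_ideals I J by auto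
  note ids = I J S ipow_ideal[OF I] ipow_ideal[OF J] ipow_ideal[OF S]
  note pid = ideal_prod_is_ideal
  show ?case
  proof (cases "a = 0 \<or> b = 0")
    case True
    then show ?thesis
    proof
      assume "a = 0"
      then show ?thesis using set_add_upper1[of "ipow ?S b" "ipow J b \<cdot> carrier R"] ids
        by (simp add: ideal_prod_one_left ideal_prod_one)
    next
      assume "b = 0"
      then show ?thesis using set_add_upper2[of "ipow I a \<cdot> carrier R" "ipow ?S a"] ids
        by (simp add: ideal_prod_one_left ideal_prod_one)
    qed
  next
    case False
    then obtain a' b' where ab: "a = Suc a'" "b = Suc b'" by (cases a; cases b) auto
    have ab1: "n = a' + b" and ab2: "n = a + b'" using Suc(2) ab by auto
    let ?T = "(ipow I a \<cdot> ipow ?S b) <+> (ipow J b \<cdot> ipow ?S a)"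
    have T: "ideal ?T R" using ids by (intro add_ideals pid) auto
    have "ipow ?S (a + b) = ipow ?S n \<cdot> ?S" using Suc(2) ipow_Suc[of ?S n] by simp
    also have "\<dots> = (ipow ?S n \<cdot> I) <+> (ipow ?S n \<cdot> J)" using ids by (intro ideal_prod_r_distr) auto
    also have "\<dots> \<subseteq> ?T"
    proof (rule set_add_least[OF T])
      have "ipow ?S n \<cdot> I \<subseteq> ((ipow I a' \<cdot> ipow ?S b) <+> (ipow J b \<cdot> ipow ?S a')) \<cdot> I"
        using Suc(1)[OF ab1] ab1 by (intro ideal_prod_mono) auto
      also have "\<dots> = (ipow I a' \<cdot> ipow ?S b) \<cdot> I <+> (ipow J b \<cdot> ipow ?S a') \<cdot> I"
        using ids by (intro ideal_prod_distr(2) pid) auto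
      also have "\<dots> \<subseteq> ?T"
      proof (rule set_add_mono')
        have "(ipow I a' \<cdot> ipow ?S b) \<cdot> I = ipow I a \<cdot> ipow ?S b"
          unfolding ab(1) ipow_Suc using ids by (metis ideal_prod_assoc ideal_prod_commute)
        then show "(ipow I a' \<cdot> ipow ?S b) \<cdot> I \<subseteq> ipow I a \<cdot> ipow ?S b" by simp
        have "(ipow J b \<cdot> ipow ?S a') \<cdot> I = ipow J b \<cdot> (ipow ?S a' \<cdot> I)" using ids
          by (intro ideal_prod_assoc) auto
        also have "\<dots> \<subseteq> ipow J b \<cdot> ipow ?S a"
          unfolding ab(1) ipow_Suc using set_add_upper1[OF I J] by (intro ideal_prod_mono) auto
        finally show "(ipow J b \<cdot> ipow ?S a') \<cdot> I \<subseteq> ipow J b \<cdot> ipow ?S a" .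
      qed
      finally show "ipow ?S n \<cdot> I \<subseteq> ?T" .
      have "ipow ?S n \<cdot> J \<subseteq> ((ipow I a \<cdot> ipow ?S b') <+> (ipow J b' \<cdot> ipow ?S a)) \<cdot> J"
        using Suc(1)[OF ab2] ab2 by (intro ideal_prod_mono) auto
      also have "\<dots> = (ipow I a \<cdot> ipow ?S b') \<cdot> J <+> (ipow J b' \<cdot> ipow ?S a) \<cdot> J"
        using ids by (intro ideal_prod_distr(2) pid) auto
      also have "\<dots> \<subseteq> ?T"
      proof (rule set_add_mono')
        have "(ipow J b' \<cdot> ipow ?S a) \<cdot> J = ipow J b \<cdot> ipow ?S a"
          unfolding ab(2) ipow_Suc using ids by (metis ideal_prod_assoc ideal_prod_commute)
        then show "(ipow J b' \<cdot> ipow ?S a) \<cdot> J \<subseteq> ipow J b \<cdot> ipow ?S a" by simp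
        have "(ipow I a \<cdot> ipow ?S b') \<cdot> J = ipow I a \<cdot> (ipow ?S b' \<cdot> J)" using ids
          by (intro ideal_prod_assoc) auto
        also have "\<dots> \<subseteq> ipow I a \<cdot> ipow ?S b"
          unfolding ab(2) ipow_Suc using set_add_upper2[OF I J] by (intro ideal_prod_mono) auto
        finally show "(ipow I a \<cdot> ipow ?S b') \<cdot> J \<subseteq> ipow I a \<cdot> ipow ?S b" .
      qed
      finally show "ipow ?S n \<cdot> J \<subseteq> ?T" .
    qed
    finally show ?thesis .
  qed
qed

end

section \<open>Noetherian local rings\<close>

lemma enat_add_finite: "\<lbrakk>a \<noteq> \<infinity>; b \<noteq> \<infinity>\<rbrakk> \<Longrightarrow> a + b \<noteq> (\<infinity> :: enat)"
  by (cases a; cases b) auto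

context cring
begin

lemma Idl_insert:
  assumes "a \<in> carrier R" "A \<subseteq> carrier R"
  shows "Idl (insert a A) = PIdl a <+> Idl A"
proof
  have ids: "ideal (PIdl a) R" "ideal (Idl A) R" using assms by (auto intro: cgenideal_ideal genideal_ideal)
  show "Idl (insert a A) \<subseteq> PIdl a <+> Idl A"
    using set_add_upper1[OF ids] set_add_upper2[OF ids] cgenideal_self[OF assms(1)] genideal_self[OF assms(2)]
    by (intro genideal_minimal add_ideals ids) auto
  have "a \<in> Idl (insert a A)" using genideal_self[of "insert a A"] assms by auto
  moreover have "Idl A \<subseteq> Idl (insert a A)" by (rule subset_Idl_subset) (use assms in auto)
  ultimately show "PIdl a <+> Idl A \<subseteq> Idl (insert a A)"
    using assms by (intro set_add_least cgenideal_minimal genideal_ideal) auto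
qed

lemma mem_PIdl: "x \<in> PIdl a \<longleftrightarrow> (\<exists>r\<in>carrier R. x = r \<otimes> a)"
  unfolding cgenideal_def by auto

lemma mem_prod_PIdl:
  assumes "ideal X R" "a \<in> carrier R" "y \<in> (PIdl a) \<cdot> X"
  shows "\<exists>x\<in>X. y = a \<otimes> x"
  using assms(3)
proof (induction rule: ideal_prod.induct)
  case (prod i j)
  then obtain r where "r \<in> carrier R" "i = r \<otimes> a" by (auto simp: mem_PIdl)
  then have "i \<otimes> j = a \<otimes> (r \<otimes> j)" using assms ideal_carr[OF assms(1) prod(2)] by (simp add: m_ac)
  then show ?case using ideal_mult[OF assms(1) \<open>r \<in> carrier R\<close> prod(2)] by blast
next
  case (sum s1 s2)
  then obtain x1 x2 where "x1 \<in> X" "x2 \<in> X" "s1 = a \<otimes> x1" "s2 = a \<otimes> x2" by blast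
  then show ?case using ideal_carr[OF assms(1)] assms(2) ideal_add[OF assms(1)]
    by (intro bexI[of _ "x1 \<oplus> x2"]) (auto simp: r_distr)
qed

section \<open>Multiples of an ideal by a nonzerodivisor\<close>

definition scale :: "'a \<Rightarrow> 'a set \<Rightarrow> 'a set" where
  "scale b X = (\<lambda>x. b \<otimes> x) ` X"

lemma scale_ideal: "\<lbrakk>b \<in> carrier R; ideal X R\<rbrakk> \<Longrightarrow> ideal (scale b X) R"
proof (rule idealI')
  assume b: "b \<in> carrier R" and X: "ideal X R"
  note c = ideal_carr[OF X]
  show "scale b X \<subseteq> carrier R" using b c by (auto simp: scale_def)
  show "\<zero> \<in> scale b X" using ideal_zero[OF X] b by (force simp: scale_def)
  fix x y assume "x \<in> scale b X" "y \<in> scale b X"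
  then obtain x' y' where "x' \<in> X" "y' \<in> X" "x = b \<otimes> x'" "y = b \<otimes> y'" by (auto simp: scale_def)
  then show "x \<oplus> y \<in> scale b X" using b c ideal_add[OF X] r_distr[of x' y' b] by (force simp: scale_def)
next
  fix r x assume b: "b \<in> carrier R" and X: "ideal X R" and r: "r \<in> carrier R" and "x \<in> scale b X"
  then obtain x' where "x' \<in> X" "x = b \<otimes> x'" by (auto simp: scale_def)
  moreover then have "r \<otimes> x = b \<otimes> (r \<otimes> x')" using b r ideal_carr[OF X] m_lcomm by auto
  ultimately show "r \<otimes> x \<in> scale b X" using r ideal_mult[OF X] by (auto simp: scale_def)
qed

lemma scale_subset: "\<lbrakk>ideal X R; b \<in> carrier R\<rbrakk> \<Longrightarrow> scale b X \<subseteq> X"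
  by (auto simp: scale_def intro: ideal_mult)

lemma scale_mono: "X \<subseteq> Y \<Longrightarrow> scale b X \<subseteq> scale b Y"
  by (auto simp: scale_def)

lemma scale_carrier: "b \<in> carrier R \<Longrightarrow> scale b (carrier R) = PIdl b"
  by (auto simp: scale_def cgenideal_def m_comm)

lemma scale_eq_prod:
  assumes "b \<in> carrier R" "ideal X R"
  shows "scale b X = (PIdl b) \<cdot> X"
proof
  show "scale b X \<subseteq> (PIdl b) \<cdot> X"
    using cgenideal_self[OF assms(1)] by (auto simp: scale_def intro: ideal_prod.prod)
  show "(PIdl b) \<cdot> X \<subseteq> scale b X"
    using mem_prod_PIdl[OF assms(2,1)] by (auto simp: scale_def)
qed

lemma scale_scale: "\<lbrakk>a \<in> carrier R; b \<in> carrier R; X \<subseteq> carrier R\<rbrakk> \<Longrightarrow> scale a (scale b X) = scale (a \<otimes> b) X"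
  unfolding scale_def image_image by (rule image_cong) (auto simp: m_assoc)

definition nonzerodivisor :: "'a \<Rightarrow> bool" where
  "nonzerodivisor b \<longleftrightarrow> b \<in> carrier R \<and> (\<forall>x\<in>carrier R. b \<otimes> x = \<zero> \<longrightarrow> x = \<zero>)"

lemma nonzerodivisor_carr: "nonzerodivisor b \<Longrightarrow> b \<in> carrier R"
  by (simp add: nonzerodivisor_def)

lemma nonzerodivisor_cancel:
  assumes "nonzerodivisor b" "x \<in> carrier R" "y \<in> carrier R" "b \<otimes> x = b \<otimes> y"
  shows "x = y"
proof -
  have "b \<in> carrier R" using assms(1) by (rule nonzerodivisor_carr)
  then have "b \<otimes> (x \<ominus> y) = \<zero>" using assms by (simp add: a_minus_def r_distr r_minus r_neg)
  then have "x \<ominus> y = \<zero>" using assms unfolding nonzerodivisor_def by blast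
  then show ?thesis using assms by simp
qed

lemma nonzerodivisor_mult: "\<lbrakk>nonzerodivisor a; nonzerodivisor b\<rbrakk> \<Longrightarrow> nonzerodivisor (a \<otimes> b)"
  unfolding nonzerodivisor_def by (metis m_assoc m_closed)

lemma nonzerodivisor_one: "nonzerodivisor \<one>"
  unfolding nonzerodivisor_def by auto

lemma nonzerodivisor_pow: "nonzerodivisor a \<Longrightarrow> nonzerodivisor (a [^] (n::nat))"
  by (induction n) (auto simp: nonzerodivisor_one nonzerodivisor_mult)

lemma nonzerodivisor_factor:
  assumes "nonzerodivisor (a \<otimes> c)" "a \<in> carrier R" "c \<in> carrier R"
  shows "nonzerodivisor a"
  unfolding nonzerodivisor_def
proof (intro conjI ballI impI)
  fix x assume x: "x \<in> carrier R" "a \<otimes> x = \<zero>"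
  then have "(a \<otimes> c) \<otimes> x = c \<otimes> (a \<otimes> x)" using assms(2,3) by (metis m_assoc m_comm x(1))
  also have "\<dots> = \<zero>" using x assms by simp
  finally show "x = \<zero>" using assms(1) x unfolding nonzerodivisor_def by blast
qed (use assms in auto)

lemma scale_mem_cancel:
  assumes "nonzerodivisor b" "X \<subseteq> carrier R" "x \<in> carrier R" "b \<otimes> x \<in> scale b X"
  shows "x \<in> X"
  using assms nonzerodivisor_cancel by (auto simp: scale_def)

lemma scale_subset_cancel:
  assumes "nonzerodivisor b" "X \<subseteq> carrier R" "Y \<subseteq> carrier R" "scale b X \<subseteq> scale b Y"
  shows "X \<subseteq> Y"
proof
  fix x assume "x \<in> X"
  then have "b \<otimes> x \<in> scale b Y" using assms(4) unfolding scale_def by blast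
  then show "x \<in> Y" using scale_mem_cancel[OF assms(1,3)] assms(2) \<open>x \<in> X\<close> by blast
qed

text \<open>Multiplication by \<open>b\<close> and the preimage under it are strictly monotone
  between the two intervals. For the preimage this holds because every element of
  \<open>scale b Y\<close> is a multiple of \<open>b\<close>.\<close>

lemma ilen_scale:
  assumes b: "nonzerodivisor b" and X: "ideal X R" and Y: "ideal Y R"
  shows "ilen (scale b X) (scale b Y) = ilen X Y"
proof (rule antisym)
  have bc: "b \<in> carrier R" using b nonzerodivisor_carr by simp
  show "ilen X Y \<le> ilen (scale b X) (scale b Y)"
    unfolding ideals.len_def
  proof (rule chain_height_le_map[where f = "scale b"])
    fix Z Z' assume "Z \<in> {Xa \<in> {I. ideal I R}. X \<subseteq> Xa \<and> Xa \<subseteq> Y}" "Z' \<in> {Xa \<in> {I. ideal I R}. X \<subseteq> Xa \<and> Xa \<subseteq> Y}" "Z \<subset> Z'"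
    then show "scale b Z \<subset> scale b Z'"
      using scale_mono[of Z Z' b] scale_subset_cancel[OF b, of Z' Z] ideal_sub by auto
  qed (use bc in \<open>auto intro: scale_ideal scale_mono[THEN subsetD]\<close>)
  show "ilen (scale b X) (scale b Y) \<le> ilen X Y"
    unfolding ideals.len_def
  proof (rule chain_height_le_map[where f = "\<lambda>Z. {x \<in> carrier R. b \<otimes> x \<in> Z}"])
    fix Z assume "Z \<in> {Xa \<in> {I. ideal I R}. scale b X \<subseteq> Xa \<and> Xa \<subseteq> scale b Y}"
    then have Z: "ideal Z R" "scale b X \<subseteq> Z" "Z \<subseteq> scale b Y" by auto
    have "ideal {x \<in> carrier R. b \<otimes> x \<in> Z} R"
    proof (rule idealI')
      fix r x assume "r \<in> carrier R" "x \<in> {x \<in> carrier R. b \<otimes> x \<in> Z}"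
      then show "r \<otimes> x \<in> {x \<in> carrier R. b \<otimes> x \<in> Z}"
        using ideal_mult[OF Z(1), of r "b \<otimes> x"] m_lcomm[of r b x] bc by (simp del: m_lcomm)
    qed (use Z bc ideal_zero ideal_add in \<open>auto simp: r_distr\<close>)
    moreover have "X \<subseteq> {x \<in> carrier R. b \<otimes> x \<in> Z}" using Z X ideal_sub by (auto simp: scale_def)
    moreover have "{x \<in> carrier R. b \<otimes> x \<in> Z} \<subseteq> Y" using Z scale_mem_cancel[OF b ideal_sub[OF Y]] by auto
    ultimately show "{x \<in> carrier R. b \<otimes> x \<in> Z} \<in> {Xa \<in> {I. ideal I R}. X \<subseteq> Xa \<and> Xa \<subseteq> Y}" by simp
  next
    fix Z Z' assume *: "Z \<in> {Xa \<in> {I. ideal I R}. scale b X \<subseteq> Xa \<and> Xa \<subseteq> scale b Y}"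
      "Z' \<in> {Xa \<in> {I. ideal I R}. scale b X \<subseteq> Xa \<and> Xa \<subseteq> scale b Y}" "Z \<subset> Z'"
    then obtain z where z: "z \<in> Z'" "z \<notin> Z" by auto
    then have "z \<in> scale b Y" using * by auto
    then obtain y where "y \<in> Y" "z = b \<otimes> y" by (auto simp: scale_def)
    then show "{x \<in> carrier R. b \<otimes> x \<in> Z} \<subset> {x \<in> carrier R. b \<otimes> x \<in> Z'}" using z * ideal_carr[OF Y] by blast
  qed
qed

lemma ilen_le_one:
  assumes "\<And>K. \<lbrakk>ideal K R; B \<subseteq> K; K \<subseteq> C\<rbrakk> \<Longrightarrow> K = B \<or> K = C"
  shows "ilen B C \<le> 1"
  unfolding ideals.len_def
proof (rule chain_height_leI)
  fix n X assume X: "\<And>i. i \<le> n \<Longrightarrow> X i \<in> {X \<in> {I. ideal I R}. B \<subseteq> X \<and> X \<subseteq> C}" "\<And>i. i < n \<Longrightarrow> X i \<subset> X (Suc i)"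
  have "n \<le> 1"
  proof (rule ccontr)
    assume "\<not> n \<le> 1"
    then have "X 0 \<subset> X 1" "X 1 \<subset> X 2" using X(2)[of 0] X(2)[of 1] by (auto simp: numeral_2_eq_2)
    moreover have "X 1 = B \<or> X 1 = C" using X(1)[of 1] assms \<open>\<not> n \<le> 1\<close> by auto
    moreover have "B \<subseteq> X 0" "X 2 \<subseteq> C" using X(1)[of 0] X(1)[of 2] \<open>\<not> n \<le> 1\<close> by auto
    ultimately show False by blast
  qed
  then show "enat n \<le> 1" by (simp add: one_enat_def)
qed

lemma ipow_PIdl:
  assumes "a \<in> carrier R" shows "ipow (PIdl a) n \<subseteq> PIdl (a [^] n)"
proof (induction n)
  case 0
  have "x \<in> PIdl \<one>" if "x \<in> carrier R" for x
    unfolding mem_PIdl using that by (intro bexI[of _ x]) auto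
  then show ?case by auto
next
  case (Suc n)
  show ?case unfolding ipow_Suc
  proof (rule ideal_prod_least)
    show "ideal (PIdl (a [^] Suc n)) R" using assms by (intro cgenideal_ideal) auto
    fix i j assume "i \<in> ipow (PIdl a) n" "j \<in> PIdl a"
    then obtain r s where "r \<in> carrier R" "s \<in> carrier R" "i = r \<otimes> a [^] n" "j = s \<otimes> a"
      using Suc by (auto simp: cgenideal_def)
    then show "i \<otimes> j \<in> PIdl (a [^] Suc n)" using assms
      by (auto simp: cgenideal_def m_ac intro!: exI[of _ "r \<otimes> s"])
  qed
qed

text \<open>A graded version of the fact that an ideal generated by nilpotents is nilpotent.\<close>

lemma ipow_Idl_subset:
  assumes M: "ideal M R" and F: "\<And>n. ideal (F n) R" "\<And>n k. F n \<cdot> ipow M k \<subseteq> F (n + k)"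
    and fin: "finite A" and AM: "A \<subseteq> M" and nil: "\<And>x. x \<in> A \<Longrightarrow> x [^] (p::nat) \<in> F p"
  shows "\<exists>u. \<forall>k. ipow (Idl A) u \<cdot> ipow M k \<subseteq> F (u + k)"
proof -
  have "\<exists>u. ipow (Idl A) u \<subseteq> F u"
    using fin AM nil
  proof (induction A)
    case empty
    have "ipow (Idl {}) 1 \<subseteq> {\<zero>}" using genideal_minimal[OF zeroideal, of "{}"] genideal_ideal[of "{}"]
      by (simp add: ipow_1 ideal_prod_one_left)
    then have "ipow (Idl {}) 1 \<subseteq> F 1" using ideal_zero[OF F(1)[of 1]] by blast
    then show ?case by blast
  next
    case (insert a A)
    then obtain u where u: "ipow (Idl A) u \<subseteq> F u" by auto
    have Ac: "A \<subseteq> carrier R" "a \<in> carrier R" using insert ideal_sub[OF M] by auto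
    have ids: "ideal (PIdl a) R" "ideal (Idl A) R" using Ac by (auto intro: cgenideal_ideal genideal_ideal)
    let ?S = "PIdl a <+> Idl A"
    have "PIdl a \<subseteq> M" "Idl A \<subseteq> M" using insert
      by (auto intro!: cgenideal_minimal[OF M] genideal_minimal[OF M] del: subsetI)
    then have S: "ideal ?S R" "?S \<subseteq> M" using ids by (auto intro!: add_ideals set_add_least[OF M] del: subsetI)
    have "ipow (PIdl a) p \<subseteq> F p"
      using ipow_PIdl[OF Ac(2), of p] cgenideal_minimal[OF F(1), of "a [^] p" p] insert by auto
    \<comment> \<open>The leftover power of \<open>?S\<close> lies in the same power of
      \<open>M\<close>, and multiplication by it raises the index of \<open>F\<close> by that
      exponent. Both summands of the pigeonhole principle therefore land in index
      \<open>p + u\<close>.\<close>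
    then have "ipow (PIdl a) p \<cdot> ipow ?S u \<subseteq> F (p + u)"
      by (rule order_trans[OF ideal_prod_mono[OF _ ipow_mono[OF S(2)]] F(2)])
    moreover have "ipow (Idl A) u \<cdot> ipow ?S p \<subseteq> F (u + p)"
      by (rule order_trans[OF ideal_prod_mono[OF u ipow_mono[OF S(2)]] F(2)])
    then have "ipow (Idl A) u \<cdot> ipow ?S p \<subseteq> F (p + u)" by (simp add: add.commute)
    ultimately have "ipow ?S (p + u) \<subseteq> F (p + u)"
      using ipow_sum_pigeonhole[OF ids, of p u] set_add_least[OF F(1)] by (meson order_trans)
    then show ?case using Idl_insert[OF Ac(2,1)] by auto
  qed
  then obtain u where u: "ipow (Idl A) u \<subseteq> F u" by blast
  have "ipow (Idl A) u \<cdot> ipow M k \<subseteq> F (u + k)" for k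
    using ideal_prod_mono[OF u order_refl] F(2) by (rule order_trans)
  then show ?thesis by blast
qed

end

context noetherian_ring
begin

lemma ideal_maximal_element:
  assumes "\<A> \<noteq> {}" "\<And>I. I \<in> \<A> \<Longrightarrow> ideal I R"
  obtains K where "K \<in> \<A>" "\<And>I. \<lbrakk>I \<in> \<A>; K \<subseteq> I\<rbrakk> \<Longrightarrow> I = K"
proof -
  have "\<exists>M\<in>\<A>. \<forall>X\<in>\<A>. M \<subseteq> X \<longrightarrow> X = M"
  proof (rule subset_Zorn_nonempty[OF assms(1)])
    fix C assume C: "C \<noteq> {}" "subset.chain \<A> C"
    then have "subset.chain {I. ideal I R} C" using assms(2) by (auto simp: subset.chain_def)
    then have "\<Union>C \<in> C" using ideal_chain_is_trivial C by blast
    then show "\<Union>C \<in> \<A>" using C by (auto simp: subset.chain_def)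
  qed
  then show ?thesis using that by blast
qed

end

locale noetherian_cring = cring R + noetherian_ring R for R (structure)
begin

text \<open>Krull's argument: an ideal that is maximal among those containing \<open>I\<close> and
  disjoint from the multiplicative set \<open>S\<close> is prime. The Noetherian condition provides
  it.\<close>

lemma prime_avoiding:
  assumes I: "ideal I R" and S: "S \<subseteq> carrier R" "\<one> \<in> S" "\<And>s t. \<lbrakk>s \<in> S; t \<in> S\<rbrakk> \<Longrightarrow> s \<otimes> t \<in> S"
    and disj: "I \<inter> S = {}"
  obtains P where "primeideal P R" "I \<subseteq> P" "P \<inter> S = {}"
proof -
  obtain K where K: "K \<in> {J. ideal J R \<and> I \<subseteq> J \<and> J \<inter> S = {}}"
    and max: "\<And>J. \<lbrakk>J \<in> {J. ideal J R \<and> I \<subseteq> J \<and> J \<inter> S = {}}; K \<subseteq> J\<rbrakk> \<Longrightarrow> J = K"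
    by (rule ideal_maximal_element[of "{J. ideal J R \<and> I \<subseteq> J \<and> J \<inter> S = {}}"]) (use I disj in auto)
  from K have Ki: "ideal K R" by simp
  have meets: "\<exists>k\<in>K. \<exists>r\<in>carrier R. k \<oplus> r \<otimes> a \<in> S" if a: "a \<in> carrier R" "a \<notin> K" for a
  proof -
    have ids: "ideal (K <+> PIdl a) R" "ideal (PIdl a) R" using Ki a
      by (auto intro: add_ideals cgenideal_ideal)
    have "K \<subseteq> K <+> PIdl a" "a \<in> K <+> PIdl a"
      using set_add_upper1[OF Ki ids(2)] set_add_upper2[OF Ki ids(2)] cgenideal_self a by auto
    then have "(K <+> PIdl a) \<inter> S \<noteq> {}" using max[of "K <+> PIdl a"] ids K a by blast
    then show ?thesis by (auto simp: mem_set_add mem_PIdl)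
  qed
  have "primeideal K R"
  proof (rule primeidealI[OF Ki is_cring])
    show "carrier R \<noteq> K" using K S by auto
    fix a b assume ab: "a \<in> carrier R" "b \<in> carrier R" "a \<otimes> b \<in> K"
    show "a \<in> K \<or> b \<in> K"
    proof (rule ccontr)
      assume "\<not> (a \<in> K \<or> b \<in> K)"
      then obtain k r k' r'
        where *: "k \<in> K" "r \<in> carrier R" "k \<oplus> r \<otimes> a \<in> S" "k' \<in> K" "r' \<in> carrier R" "k' \<oplus> r' \<otimes> b \<in> S"
        using meets ab by metis
      have c: "k \<in> carrier R" "k' \<in> carrier R" using * ideal_carr[OF Ki] by auto
      have "(k \<oplus> r \<otimes> a) \<otimes> (k' \<oplus> r' \<otimes> b) = (k \<otimes> (k' \<oplus> r' \<otimes> b)) \<oplus> ((r \<otimes> a) \<otimes> k' \<oplus> (r \<otimes> r') \<otimes> (a \<otimes> b))"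
        using * c ab by (simp add: l_distr r_distr m_ac a_ac)
      also have "\<dots> \<in> K"
        using * c ab
          by (intro ideal_add[OF Ki] ideal_mult[OF Ki _ ab(3)] ideal_mult[OF Ki _ *(4)] ideal_mult'[OF Ki _ *(1)]) auto
      finally show False using S(3)[OF *(3,6)] K by blast
    qed
  qed
  then show ?thesis using that K by blast
qed

lemma ideal_fin_gen: "ideal I R \<Longrightarrow> \<exists>A. finite A \<and> A \<subseteq> I \<and> I = Idl A"
  using finetely_gen genideal_self by metis

text \<open>The ungraded case of \<open>ipow_Idl_subset\<close>: the family \<open>F\<close> is
  constant with value \<open>I\<close>, and the sum of the exponents of finitely many generators
  serves as common exponent.\<close>

lemma ipow_subset_of_radical:
  assumes M: "ideal M R" and I: "ideal I R" and rad: "\<And>x. x \<in> M \<Longrightarrow> \<exists>n::nat. x [^] n \<in> I"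
  shows "\<exists>u. ipow M u \<subseteq> I"
proof -
  obtain A where A: "finite A" "A \<subseteq> M" "M = Idl A" using ideal_fin_gen[OF M] by auto
  have Mc: "\<And>x. x \<in> M \<Longrightarrow> x \<in> carrier R" using ideal_carr[OF M] .
  have "\<forall>x\<in>A. \<exists>n::nat. x [^] n \<in> I" using rad A by auto
  then obtain n where n: "\<And>x. x \<in> A \<Longrightarrow> x [^] (n x :: nat) \<in> I" by metis
  define p where "p = sum n A"
  have p: "x [^] p \<in> I" if "x \<in> A" for x
  proof -
    have "n x \<le> p" unfolding p_def using A(1) that by (intro member_le_sum) auto
    then have "x [^] p = x [^] (n x) \<otimes> x [^] (p - n x)" using that A Mc by (simp add: nat_pow_mult subset_iff)
    then show ?thesis using n[OF that] that A Mc ideal_mult'[OF I] by auto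
  qed
  have "\<exists>u. \<forall>k. ipow (Idl A) u \<cdot> ipow M k \<subseteq> I"
    by (rule ipow_Idl_subset[OF M, where F = "\<lambda>_. I" and p = p]) (use A p I ideal_prod_sub1 ipow_ideal[OF M] in auto)
  then obtain u where "ipow M u \<cdot> ipow M 0 \<subseteq> I" using A by metis
  then show ?thesis using M by (auto simp: ideal_prod_one ipow_ideal)
qed

end

text \<open>The maximal ideal is a parameter, and locality says that elements outside it are units.
  In this form it can be checked by a computation for the idealization, with the explicit ideal
  \<open>\<mm> \<times> I\<close>; the agreement with \<open>max_ideal R\<close> follows.\<close>

locale noetherian_local = noetherian_cring R for R (structure) +
  fixes \<mm> :: "'a set"
  assumes \<mm>_ideal: "ideal \<mm> R"
    and one_notin_\<mm>: "\<one> \<notin> \<mm>"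
    and notin_\<mm>_Units: "\<lbrakk>x \<in> carrier R; x \<notin> \<mm>\<rbrakk> \<Longrightarrow> x \<in> Units R"
begin

lemma \<mm>_carr: "x \<in> \<mm> \<Longrightarrow> x \<in> carrier R"
  by (rule ideal_carr[OF \<mm>_ideal])

lemma unit_in_ideal:
  assumes "ideal I R" "x \<in> I" "x \<in> Units R"
  shows "I = carrier R"
proof -
  have "inv x \<otimes> x \<in> I" by (rule ideal_mult[OF assms(1) _ assms(2)]) (use assms in auto)
  then have "\<one> \<in> I" using assms by simp
  then show ?thesis using ideal.one_imp_carrier assms(1) by blast
qed

lemma proper_ideal_sub: "\<lbrakk>ideal I R; I \<noteq> carrier R\<rbrakk> \<Longrightarrow> I \<subseteq> \<mm>"
  using unit_in_ideal notin_\<mm>_Units ideal_carr by blast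

lemma \<mm>_maximal: "maximalideal I R \<longleftrightarrow> I = \<mm>"
proof
  assume "maximalideal I R"
  then interpret I: maximalideal I R .
  have "I \<subseteq> \<mm>" using proper_ideal_sub[OF I.is_ideal] I.I_notcarr by auto
  then show "I = \<mm>" using I.I_maximal[OF \<mm>_ideal] one_notin_\<mm> ideal_sub[OF \<mm>_ideal] by auto
next
  have "maximalideal \<mm> R"
    by (rule maximalidealI[OF \<mm>_ideal]) (use one_notin_\<mm> proper_ideal_sub in auto)
  then show "I = \<mm> \<Longrightarrow> maximalideal I R" by simp
qed

lemma is_local_ring: "local_ring R"
  by unfold_locales (use \<mm>_maximal in auto)

lemma max_ideal_eq: "max_ideal R = \<mm>"
  unfolding max_ideal_def using \<mm>_maximal by auto

lemma one_minus_Units: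
  assumes "x \<in> \<mm>" shows "\<one> \<ominus> x \<in> Units R"
proof (rule notin_\<mm>_Units)
  show "\<one> \<ominus> x \<in> carrier R" using assms \<mm>_carr by auto
  show "\<one> \<ominus> x \<notin> \<mm>"
  proof
    assume "\<one> \<ominus> x \<in> \<mm>"
    then have "(\<one> \<ominus> x) \<oplus> x \<in> \<mm>" using assms \<mm>_ideal ideal_add by blast
    moreover have "(\<one> \<ominus> x) \<oplus> x = \<one>" using assms \<mm>_carr by (simp add: a_minus_def a_assoc l_neg)
    ultimately show False using one_notin_\<mm> by simp
  qed
qed

text \<open>Choose \<open>K\<close> maximal among the ideals strictly inside \<open>X\<close> that
  contain \<open>B \<inter> X\<close>. If \<open>m x\<close> is not in \<open>K\<close>, then
  \<open>K\<close> and \<open>m x\<close> generate \<open>X\<close>, so \<open>x = k + w x\<close>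
  with \<open>k\<close> in \<open>K\<close> and \<open>w\<close> in \<open>\<mm>\<close>; as
  \<open>1 - w\<close> is a unit, \<open>x\<close> is in \<open>K\<close> after all. Hence
  \<open>\<mm> X\<close> lies in \<open>K\<close>, and the hypothesis pushes all of \<open>X\<close>
  into \<open>K\<close>.\<close>

lemma nakayama:
  assumes B: "ideal B R" and X: "ideal X R" and le: "X \<subseteq> B <+> (\<mm> \<cdot> X)"
  shows "X \<subseteq> B"
proof (rule ccontr)
  assume neg: "\<not> X \<subseteq> B"
  let ?A = "{J. ideal J R \<and> B \<inter> X \<subseteq> J \<and> J \<subset> X}"
  obtain K where K: "K \<in> ?A" and max: "\<And>J. \<lbrakk>J \<in> ?A; K \<subseteq> J\<rbrakk> \<Longrightarrow> J = K"
    by (rule ideal_maximal_element[of ?A]) (use ideal_inter[OF B X] neg in auto)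
  have Ki: "ideal K R" and KX: "K \<subset> X" using K by auto
  have mX: "\<mm> \<cdot> X \<subseteq> K"
  proof (rule ideal_prod_least[OF Ki])
    fix m x assume m: "m \<in> \<mm>" and x: "x \<in> X"
    show "m \<otimes> x \<in> K"
    proof (rule ccontr)
      assume nK: "m \<otimes> x \<notin> K"
      have c: "m \<in> carrier R" "x \<in> carrier R" using m x \<mm>_carr ideal_carr[OF X] by auto
      have P: "ideal (PIdl (m \<otimes> x)) R" "PIdl (m \<otimes> x) \<subseteq> X" using c x ideal_mult[OF X]
        by (auto intro!: cgenideal_ideal cgenideal_minimal[OF X] del: subsetI)
      let ?J = "K <+> PIdl (m \<otimes> x)"
      have J: "ideal ?J R" "K \<subseteq> ?J" "?J \<subseteq> X" "m \<otimes> x \<in> ?J"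
        using add_ideals[OF Ki P(1)] set_add_upper1[OF Ki P(1)] set_add_upper2[OF Ki P(1)] set_add_least[OF X _ P(2), of K] KX cgenideal_self[of "m \<otimes> x"] c
          by auto
      then have "?J = X" using max[of ?J] K nK by auto
      then obtain k r where k: "k \<in> K" "r \<in> carrier R" "x = k \<oplus> r \<otimes> (m \<otimes> x)" using x
        by (auto simp: mem_set_add mem_PIdl)
      have kc: "k \<in> carrier R" using k ideal_carr[OF Ki] by simp
      define w where "w = r \<otimes> m"
      have w: "w \<in> \<mm>" "w \<in> carrier R" using k m c ideal_mult[OF \<mm>_ideal] by (auto simp: w_def)
      have xw: "x = k \<oplus> w \<otimes> x" using k c by (simp add: w_def m_assoc)
      have "(\<one> \<ominus> w) \<otimes> x = x \<oplus> \<ominus> (w \<otimes> x)" using w c by (simp add: a_minus_def l_distr l_minus)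
      also have "\<dots> = (k \<oplus> w \<otimes> x) \<oplus> \<ominus> (w \<otimes> x)" using xw by simp
      also have "\<dots> = k" using kc w c by (simp add: a_assoc r_neg)
      finally have "(\<one> \<ominus> w) \<otimes> x \<in> K" using k by simp
      then have "inv (\<one> \<ominus> w) \<otimes> ((\<one> \<ominus> w) \<otimes> x) \<in> K" using one_minus_Units[OF w(1)] ideal_mult[OF Ki] by auto
      moreover have "inv (\<one> \<ominus> w) \<otimes> ((\<one> \<ominus> w) \<otimes> x) = x"
        using one_minus_Units[OF w(1)] c by (metis Units_closed Units_inv_closed Units_l_inv l_one m_assoc)
      ultimately have "x \<in> K" by simp
      then show False using nK c ideal_mult[OF Ki] by auto
    qed
  qed
  have "X \<subseteq> K"
  proof
    fix x assume x: "x \<in> X"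
    then have "x \<in> B <+> (\<mm> \<cdot> X)" using le by blast
    then obtain b y where bY: "b \<in> B" "y \<in> \<mm> \<cdot> X" "x = b \<oplus> y" by (auto simp: mem_set_add)
    have yX: "y \<in> X" using bY mX KX by auto
    have "b \<in> X" using ideal_add_cancel[OF X, of b y] bY yX x ideal_carr[OF B] by auto
    then show "x \<in> K" using bY K mX ideal_add[OF Ki] by auto
  qed
  then show False using KX by auto
qed

text \<open>The quotient is cyclic and killed by \<open>\<mm>\<close>: it is zero or the residue
  field. Iterated in \<open>ilen_gens\<close>, this bounds lengths by numbers of generators.\<close>

lemma ilen_principal_step:
  assumes Y: "ideal Y R" and x: "x \<in> carrier R" and k: "\<And>m. m \<in> \<mm> \<Longrightarrow> m \<otimes> x \<in> Y"
  shows "ilen Y (PIdl x <+> Y) \<le> 1"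
proof (rule ilen_le_one)
  fix K assume K: "ideal K R" "Y \<subseteq> K" "K \<subseteq> PIdl x <+> Y"
  show "K = Y \<or> K = PIdl x <+> Y"
  proof (rule disjCI)
    assume "K \<noteq> PIdl x <+> Y"
    moreover have "PIdl x <+> Y \<subseteq> K" if "x \<in> K"
      using that K cgenideal_minimal by (intro set_add_least) auto
    ultimately have xK: "x \<notin> K" using K by auto
    show "K = Y"
    proof (rule ccontr)
      assume "K \<noteq> Y"
      then obtain z where z: "z \<in> K" "z \<notin> Y" using K by auto
      then have "z \<in> PIdl x <+> Y" using K by auto
      then obtain r y where ry: "r \<in> carrier R" "y \<in> Y" "z = r \<otimes> x \<oplus> y" unfolding mem_set_add
        by (auto simp: mem_PIdl)
      have "r \<notin> \<mm>" using k[of r] ry z ideal_add[OF Y] by auto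
      then have u: "r \<in> Units R" using notin_\<mm>_Units ry by auto
      have "r \<otimes> x \<in> K" using ideal_add_cancel[OF K(1), of "r \<otimes> x" y] ry z K x by auto
      then have "inv r \<otimes> (r \<otimes> x) \<in> K" using u ideal_mult[OF K(1)] by auto
      then have "x \<in> K" using u x ry by (metis Units_inv_closed Units_l_inv l_one m_assoc)
      then show False using xK by simp
    qed
  qed
qed

lemma ilen_gens:
  assumes Y: "ideal Y R" and "finite A" "A \<subseteq> carrier R" "\<And>m x. \<lbrakk>m \<in> \<mm>; x \<in> A\<rbrakk> \<Longrightarrow> m \<otimes> x \<in> Y"
  shows "ilen Y (Idl A <+> Y) \<le> enat (card A)"
  using assms(2-4)
proof (induction A)
  case empty
  have e: "ideal (Idl {}) R" by (rule genideal_ideal) simp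
  have "Idl {} \<subseteq> Y" using genideal_minimal[OF Y] by simp
  then have "Idl {} <+> Y = Y" using set_add_least[OF Y, of "Idl {}" Y] set_add_upper2[OF e Y] by auto
  then show ?case using ideals.len_self by (simp add: zero_enat_def)
next
  case (insert a A)
  have c: "a \<in> carrier R" "A \<subseteq> carrier R" using insert by auto
  have ids: "ideal (PIdl a) R" "ideal (Idl A) R" using c by (auto intro: cgenideal_ideal genideal_ideal)
  let ?Z = "Idl A <+> Y"
  have Z: "ideal ?Z R" using add_ideals ids Y by auto
  have YZ: "Y \<subseteq> ?Z" using set_add_upper2 ids Y by auto
  have "Idl (insert a A) <+> Y = PIdl a <+> ?Z"
    unfolding Idl_insert[OF c] using ids Y
      by (simp add: add.set_mult_assoc additive_subgroup.a_subset ideal.axioms(1) set_add_defs(1))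
  moreover have "ilen Y (PIdl a <+> ?Z) = ilen Y ?Z + ilen ?Z (PIdl a <+> ?Z)"
    using YZ Z ids Y set_add_upper2[of "PIdl a" ?Z] add_ideals by (intro ilen_add) auto
  moreover have "ilen ?Z (PIdl a <+> ?Z) \<le> 1" using Z c insert YZ by (intro ilen_principal_step) auto
  moreover have "ilen Y ?Z \<le> enat (card A)" using insert by auto
  ultimately have "ilen Y (Idl (insert a A) <+> Y) \<le> enat (card A) + 1" by (simp add: add_mono)
  then show ?case using insert by (simp add: one_enat_def)
qed

lemma ilen_\<mm>_prod_finite:
  assumes X: "ideal X R" shows "ilen (\<mm> \<cdot> X) X \<noteq> \<infinity>"
proof -
  obtain A where A: "finite A" "A \<subseteq> X" "X = Idl A" using ideal_fin_gen[OF X] by auto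
  have mX: "ideal (\<mm> \<cdot> X) R" "\<mm> \<cdot> X \<subseteq> X" using X \<mm>_ideal ideal_prod_is_ideal ideal_prod_sub2 by auto
  have "X = Idl A <+> (\<mm> \<cdot> X)" using A mX set_add_upper1[OF X mX(1)] set_add_least[OF X _ mX(2), of X] by auto
  moreover have "ilen (\<mm> \<cdot> X) (Idl A <+> (\<mm> \<cdot> X)) \<le> enat (card A)"
    using A mX ideal_sub[OF X] by (intro ilen_gens) (auto intro: ideal_prod.prod)
  ultimately have "ilen (\<mm> \<cdot> X) X \<le> enat (card A)" by simp
  then show ?thesis by (cases "ilen (\<mm> \<cdot> X) X") auto
qed

lemma ipow_prod_Suc: "ideal X R \<Longrightarrow> ipow \<mm> (Suc n) \<cdot> X = \<mm> \<cdot> (ipow \<mm> n \<cdot> X)"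
  by (metis \<mm>_ideal ideal_prod_assoc ideal_prod_commute ipow_Suc ipow_ideal)

lemma ilen_ipow_prod_finite:
  assumes X: "ideal X R" shows "ilen (ipow \<mm> n \<cdot> X) X \<noteq> \<infinity>"
proof (induction n)
  case 0 then show ?case using X ideals.len_self by (simp add: ideal_prod_one_left)
next
  case (Suc n)
  have id: "ideal (ipow \<mm> n \<cdot> X) R" "ipow \<mm> n \<cdot> X \<subseteq> X" using X \<mm>_ideal
    by (auto simp: ipow_prod_ideal ideal_prod_sub2 ipow_ideal)
  have id2: "ideal (ipow \<mm> (Suc n) \<cdot> X) R" using X \<mm>_ideal ipow_prod_ideal by blast
  have "ilen (ipow \<mm> (Suc n) \<cdot> X) X = ilen (ipow \<mm> (Suc n) \<cdot> X) (ipow \<mm> n \<cdot> X) + ilen (ipow \<mm> n \<cdot> X) X"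
    using id id2 X \<mm>_ideal ipow_prod_Suc[OF X] ideal_prod_sub2[OF \<mm>_ideal id(1)]
      by (intro ilen_add) (auto simp del: nat_pow_Suc)
  then show ?case
    using Suc ilen_\<mm>_prod_finite[OF id(1)] ipow_prod_Suc[OF X]
      by (simp add: enat_add_finite del: nat_pow_Suc not_infinity_eq)
qed

lemma ilen_finite:
  assumes J: "ideal J R" "ipow \<mm> u \<subseteq> J" and C: "ideal C R" "J \<subseteq> C"
  shows "ilen J C \<noteq> \<infinity>"
proof -
  have "ilen J C \<le> ilen (ipow \<mm> u) (carrier R)" using J C ideal_sub by (intro ideals.len_mono) auto
  moreover have "ilen (ipow \<mm> u) (carrier R) \<noteq> \<infinity>"
    using ilen_ipow_prod_finite[OF oneideal, of u] \<mm>_ideal by (simp add: ideal_prod_one ipow_ideal)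
  ultimately show ?thesis by (metis enat_ord_simps(5))
qed

end

text \<open>A nonunit generates a proper ideal, which the Noetherian condition places inside a
  maximal ideal, and there is only one.\<close>

lemma (in local_ring) noetherian_localI:
  assumes "noetherian_ring R"
  shows "noetherian_local R (max_ideal R)"
proof -
  interpret noetherian_ring R by fact
  have mx: "maximalideal (max_ideal R) R" unfolding max_ideal_def by (rule theI') (rule ex1_maximalideal)
  then interpret m: maximalideal "max_ideal R" R .
  show ?thesis
  proof (intro noetherian_local.intro noetherian_cring.intro noetherian_local_axioms.intro is_cring assms)
    show "ideal (max_ideal R) R" by (rule m.is_ideal)
    show "\<one> \<notin> max_ideal R" using m.I_notcarr m.one_imp_carrier by auto
    fix x assume x: "x \<in> carrier R" "x \<notin> max_ideal R"
    show "x \<in> Units R"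
    proof (rule ccontr)
      assume nu: "x \<notin> Units R"
      let ?A = "{J. ideal J R \<and> J \<noteq> carrier R \<and> PIdl x \<subseteq> J}"
      have "PIdl x \<noteq> carrier R"
      proof
        assume "PIdl x = carrier R"
        then obtain r where "r \<in> carrier R" "\<one> = r \<otimes> x" by (metis mem_PIdl one_closed)
        then show False using nu x unfolding Units_def using m_comm by auto
      qed
      then obtain K where K: "K \<in> ?A" and max: "\<And>J. \<lbrakk>J \<in> ?A; K \<subseteq> J\<rbrakk> \<Longrightarrow> J = K"
        using ideal_maximal_element[of ?A] cgenideal_ideal[OF x(1)] by blast
      have "maximalideal K R"
      proof (rule maximalidealI)
        fix J assume "ideal J R" "K \<subseteq> J"
        then show "J = K \<or> J = carrier R" using max[of J] K by auto
      qed (use K in auto)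
      then have "K = max_ideal R" using mx ex1_maximalideal by auto
      then show False using K x cgenideal_self[of x] by auto
    qed
  qed
qed

section \<open>A superficial element\<close>

context cring
begin

text \<open>If none of the \<open>N + 1\<close> elements depended on its predecessors modulo
  \<open>Y\<close>, adjoining them one by one would give \<open>N + 1\<close> strict inclusions
  between \<open>Y\<close> and \<open>X\<close>.\<close>

lemma dependent_in_quotient:
  assumes Y: "ideal Y R" and X: "ideal X R" and YX: "Y \<subseteq> X" and v: "\<And>j. j \<le> N \<Longrightarrow> v j \<in> X"
    and len: "ilen Y X \<le> enat N"
  shows "\<exists>i\<le>N. v i \<in> Y <+> Idl (v ` {..<i})"
proof (rule ccontr)
  assume neg: "\<not> ?thesis"
  define C where "C i = Y <+> Idl (v ` {..<i})" for i
  have vc: "v ` {..<i} \<subseteq> carrier R" if "i \<le> Suc N" for i using v that ideal_sub[OF X] by auto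
  have ids: "ideal (Idl (v ` {..<i})) R" if "i \<le> Suc N" for i using vc[OF that] by (rule genideal_ideal)
  have "enat (Suc N) \<le> ilen Y X" unfolding ideals.len_def
  proof (rule chain_height_geI[of _ C])
    fix i assume i: "i \<le> Suc N"
    have "Idl (v ` {..<i}) \<subseteq> X" using v i by (intro genideal_minimal[OF X]) auto
    then show "C i \<in> {Xa \<in> {I. ideal I R}. Y \<subseteq> Xa \<and> Xa \<subseteq> X}"
      using add_ideals[OF Y ids[OF i]] set_add_upper1[OF Y ids[OF i]] set_add_least[OF X YX] unfolding C_def
        by auto
  next
    fix i assume i: "i < Suc N"
    have "Idl (v ` {..<i}) \<subseteq> Idl (v ` {..<Suc i})" using vc[of "Suc i"] i by (intro subset_Idl_subset) auto
    then have "C i \<subseteq> C (Suc i)" unfolding C_def by (intro set_add_mono') auto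
    moreover have "v i \<in> C (Suc i)"
      using genideal_self[OF vc[of "Suc i"]] set_add_upper2[OF Y ids[of "Suc i"]] i unfolding C_def by auto
    moreover have "v i \<notin> C i" using neg i unfolding C_def by auto
    ultimately show "C i \<subset> C (Suc i)" by auto
  qed
  with len have "enat (Suc N) \<le> enat N" by (rule order_trans[rotated])
  then show False by simp
qed

text \<open>In the graded ring modulo \<open>F\<close>, elements of degree \<open>s\<close> that
  agree have equal powers, since \<alpha> \<ominus> \<beta> divides the difference of the powers.
  Thus nilpotency passes from \<beta> to \<alpha>.\<close>

lemma pow_in_graded:
  assumes M: "ideal M R" and F: "\<And>n. ideal (F n) R" "\<And>n k. F n \<cdot> ipow M k \<subseteq> F (n + k)"
    and al: "\<alpha> \<in> ipow M s" and be: "\<beta> \<in> ipow M s" and d: "\<alpha> \<ominus> \<beta> \<in> F s" and k: "\<beta> [^] (k::nat) \<in> F (s * k)"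
  shows "\<alpha> [^] k \<in> F (s * k)"
proof -
  have c: "\<alpha> \<in> carrier R" "\<beta> \<in> carrier R" using al be ipow_sub[OF M] by auto
  have FM: "x \<otimes> y \<in> F (n + l)" if "x \<in> F n" "y \<in> ipow M l" for x y n l
    using F(2)[of n l] ideal_prod.prod[of x "F n" y "ipow M l" R] that by auto
  have diff: "\<alpha> [^] j \<ominus> \<beta> [^] j \<in> F (s * j)" for j :: nat
  proof (induction j)
    case 0
    then show ?case using ideal_zero[OF F(1)[of 0]] by (simp add: a_minus_def r_neg)
  next
    case (Suc j)
    have "\<alpha> [^] Suc j \<ominus> \<beta> [^] Suc j = (\<alpha> [^] j \<ominus> \<beta> [^] j) \<otimes> \<alpha> \<oplus> (\<alpha> \<ominus> \<beta>) \<otimes> \<beta> [^] j"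
    proof -
      have p: "\<alpha> [^] j \<in> carrier R" "\<beta> [^] j \<in> carrier R" using c by auto
      define A B where "A = \<alpha> [^] j" and "B = \<beta> [^] j"
      have "A \<in> carrier R" "B \<in> carrier R" using p by (auto simp: A_def B_def)
      then have "A \<otimes> \<alpha> \<ominus> B \<otimes> \<beta> = (A \<ominus> B) \<otimes> \<alpha> \<oplus> (\<alpha> \<ominus> \<beta>) \<otimes> B" using c by algebra
      then show ?thesis by (simp add: A_def B_def)
    qed
    moreover have "(\<alpha> [^] j \<ominus> \<beta> [^] j) \<otimes> \<alpha> \<in> F (s * Suc j)" using FM[OF Suc al] by (simp add: add.commute)
    moreover have "(\<alpha> \<ominus> \<beta>) \<otimes> \<beta> [^] j \<in> F (s * Suc j)" using FM[OF d ipow_pow_closed[OF M be]] by simp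
    ultimately show ?case using ideal_add[OF F(1)] by simp
  qed
  have "\<alpha> [^] k = (\<alpha> [^] k \<ominus> \<beta> [^] k) \<oplus> \<beta> [^] k" using c by (simp add: a_minus_def a_assoc l_neg)
  then show ?thesis using diff[of k] k ideal_add[OF F(1)] by metis
qed

end

text \<open>The element \<open>b\<close> is a parameter that is a nonzerodivisor, and
  \<open>b_primary\<close> is the algebraic form of dimension one: \<open>R\<close> modulo
  \<open>b\<close> has finite length. The Krull dimension itself matters only where
  \<open>cm_type\<close> and \<open>hs_multiplicity\<close> mention it.\<close>

locale cm_local_one = noetherian_local R \<mm> for R (structure) and \<mm> +
  fixes b
  assumes b_\<mm>: "b \<in> \<mm>" and b_nzd: "nonzerodivisor b" and b_primary: "\<exists>u. ipow \<mm> u \<subseteq> PIdl b"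
begin

lemma b_carr: "b \<in> carrier R" using b_\<mm> \<mm>_carr by simp

abbreviation mp :: "nat \<Rightarrow> 'a set" where "mp n \<equiv> ipow \<mm> n"

lemma mp_ideal: "ideal (mp n) R" using \<mm>_ideal by (rule ipow_ideal)

lemma mp_carr: "x \<in> mp n \<Longrightarrow> x \<in> carrier R" using mp_ideal by (rule ideal_carr)

lemma mp_sub: "mp n \<subseteq> carrier R" using mp_ideal by (rule ideal_sub)

lemma mp_antimono: "m \<le> n \<Longrightarrow> mp n \<subseteq> mp m" by (rule ipow_antimono[OF \<mm>_ideal])

lemma mp_add: "mp (m + n) = mp m \<cdot> mp n" by (rule ipow_add[OF \<mm>_ideal])

lemma ilen_PIdl_b_finite: "ilen (PIdl b) (carrier R) \<noteq> \<infinity>"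
  using b_primary cgenideal_ideal[OF b_carr] ilen_finite[of "PIdl b"] oneideal ideal_sub by blast

text \<open>The length of \<open>R / cX\<close> is computed through \<open>X\<close> and through
  \<open>cR\<close>. Since \<open>cR / cX\<close> has the same finite length as
  \<open>R / X\<close>, it cancels.\<close>

lemma ilen_scale_self:
  assumes X: "ideal X R" "mp u \<subseteq> X" and c: "nonzerodivisor c"
  shows "ilen (scale c X) X = ilen (PIdl c) (carrier R)"
proof -
  have cc: "c \<in> carrier R" using c by (rule nonzerodivisor_carr)
  have sX: "ideal (scale c X) R" "scale c X \<subseteq> X" using X cc
    by (auto intro: scale_ideal scale_subset[THEN subsetD])
  have Pc: "ideal (PIdl c) R" "scale c X \<subseteq> PIdl c" "PIdl c \<subseteq> carrier R"
    using cgenideal_ideal[OF cc] ideal_sub scale_mono[of X "carrier R" c] scale_carrier[OF cc] ideal_sub[OF X(1)]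
      by auto
  have "ilen (scale c X) (carrier R) = ilen (scale c X) X + ilen X (carrier R)"
    using sX X ideal_sub oneideal by (intro ilen_add) auto
  moreover have "ilen (scale c X) (carrier R) = ilen (scale c X) (PIdl c) + ilen (PIdl c) (carrier R)"
    using sX Pc oneideal by (intro ilen_add) auto
  moreover have "ilen (scale c X) (PIdl c) = ilen X (carrier R)"
    using ilen_scale[OF c X(1) oneideal] scale_carrier[OF cc] by simp
  moreover have "ilen X (carrier R) \<noteq> \<infinity>" using X ideal_sub oneideal by (intro ilen_finite) auto
  ultimately show ?thesis by (auto simp: add.commute)
qed

section \<open>The Hilbert function of the associated graded ring\<close>

definition hilb :: "nat \<Rightarrow> enat" where "hilb n = ilen (mp (Suc n)) (mp n)"

text \<open>The ideal \<open>b \<mm>^n\<close> is contained in \<open>\<mm>^(n+1)\<close>, and its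
  colength in \<open>\<mm>^n\<close> is that of \<open>bR\<close> in \<open>R\<close>.\<close>

lemma hilb_bounded: "hilb n \<le> ilen (PIdl b) (carrier R)"
proof -
  have "scale b (mp n) \<subseteq> mp (Suc n)"
    using b_\<mm> b_carr scale_eq_prod[OF b_carr mp_ideal] cgenideal_minimal[OF \<mm>_ideal]
    by (metis ideal_prod_commute ideal_prod_mono ipow_Suc mp_ideal order_refl \<mm>_ideal)
  then have "hilb n \<le> ilen (scale b (mp n)) (mp n)" unfolding hilb_def by (intro ideals.len_mono) auto
  then show ?thesis using ilen_scale_self[OF mp_ideal order_refl b_nzd] by simp
qed

text \<open>The ideals \<open>a \<mm>\<^bsup>n-t\<^esup> + \<mm>\<^bsup>n+1\<^esup>\<close>: the degree \<open>n\<close> part of the ideal that the class of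
  \<open>a \<in> \<mm>\<^bsup>t\<^esup>\<close> generates in the associated graded ring. (For \<open>n < t\<close> the truncated subtraction
  is harmless, since then \<open>a \<in> \<mm>\<^bsup>n+1\<^esup>\<close>.)\<close>

definition gr_ideal :: "nat \<Rightarrow> 'a \<Rightarrow> nat \<Rightarrow> 'a set" where
  "gr_ideal t a n = scale a (mp (n - t)) <+> mp (Suc n)"

lemma gr_ideal_ideal: "a \<in> carrier R \<Longrightarrow> ideal (gr_ideal t a n) R"
  unfolding gr_ideal_def using mp_ideal by (intro add_ideals scale_ideal)

lemma gr_idealI1: "\<lbrakk>a \<in> carrier R; r \<in> mp (n - t)\<rbrakk> \<Longrightarrow> a \<otimes> r \<in> gr_ideal t a n"
  unfolding gr_ideal_def using set_add_upper1[OF scale_ideal[OF _ mp_ideal] mp_ideal, of a "n - t" "Suc n"]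
  by (auto simp: scale_def)

lemma gr_idealI2: "\<lbrakk>a \<in> carrier R; u \<in> mp (Suc n)\<rbrakk> \<Longrightarrow> u \<in> gr_ideal t a n"
  unfolding gr_ideal_def by (rule subsetD[OF set_add_upper2[OF scale_ideal[OF _ mp_ideal] mp_ideal]])

lemma gr_ideal_mult:
  assumes a: "a \<in> mp t"
  shows "gr_ideal t a n \<cdot> mp k \<subseteq> gr_ideal t a (n + k)"
proof -
  have ac: "a \<in> carrier R" using a mp_sub by auto
  show ?thesis
  proof (rule ideal_prod_least[OF gr_ideal_ideal[OF ac]])
    fix x y assume x: "x \<in> gr_ideal t a n" and y: "y \<in> mp k"
    have yc: "y \<in> carrier R" using y mp_sub by auto
    obtain r u where ru: "r \<in> mp (n - t)" "u \<in> mp (Suc n)" "x = a \<otimes> r \<oplus> u"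
      using x unfolding gr_ideal_def scale_def mem_set_add by auto
    have c: "r \<in> carrier R" "u \<in> carrier R" using mp_carr[OF ru(1)] mp_carr[OF ru(2)] .
    have "x \<otimes> y = a \<otimes> (r \<otimes> y) \<oplus> u \<otimes> y" using ru c ac yc by (simp add: l_distr m_assoc)
    moreover have "u \<otimes> y \<in> gr_ideal t a (n + k)"
      using ipow_mult_closed[OF \<mm>_ideal ru(2) y] by (intro gr_idealI2[OF ac]) simp
    moreover have "a \<otimes> (r \<otimes> y) \<in> gr_ideal t a (n + k)"
    proof (cases "t \<le> n")
      case True
      then show ?thesis using ipow_mult_closed[OF \<mm>_ideal ru(1) y] by (intro gr_idealI1[OF ac]) simp
    next
      case False
      have "a \<otimes> (r \<otimes> y) \<in> mp (t + (n - t + k))"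
        by (intro ipow_mult_closed[OF \<mm>_ideal] a ru y)
      moreover have "mp (t + (n - t + k)) \<subseteq> mp (Suc (n + k))" using False by (intro mp_antimono) auto
      ultimately show ?thesis by (intro gr_idealI2[OF ac]) auto
    qed
    ultimately show "x \<otimes> y \<in> gr_ideal t a (n + k)" using ideal_add[OF gr_ideal_ideal[OF ac]] by simp
  qed
qed

lemma gr_ideal_memD:
  assumes "a \<in> mp t" "x \<in> gr_ideal t a n" "y \<in> mp k"
  shows "x \<otimes> y \<in> gr_ideal t a (n + k)"
  using gr_ideal_mult[OF assms(1), of n k] ideal_prod.prod[OF assms(2,3), of R] by auto

lemma gr_ideal_pow_mono:
  assumes "a \<in> mp t" "x \<in> \<mm>" "x [^] p \<in> gr_ideal t a p" "p \<le> q"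
  shows "x [^] q \<in> gr_ideal t a q"
proof -
  have "x [^] (q - p) \<in> mp (q - p)"
    using ipow_pow_closed[OF \<mm>_ideal, of x 1 "q - p"] assms(2) \<mm>_ideal by (simp add: ideal_prod_one_left)
  then have "x [^] p \<otimes> x [^] (q - p) \<in> gr_ideal t a (p + (q - p))" using assms by (intro gr_ideal_memD)
  then show ?thesis using assms \<mm>_carr by (simp add: nat_pow_mult)
qed

text \<open>Put \<open>y = x\<^sup>t\<close>. The lengths of \<open>\<mm>\<^sup>n / \<mm>\<^bsup>n+1\<^esup>\<close> are at most some \<open>N\<close>, so the monomials
  \<open>a\<^sup>j y\<^bsup>N-j\<^esup>\<close> with \<open>j \<le> N\<close> are dependent in the graded ring: \<open>y\<^bsup>N-i\<^esup> (a\<^sup>i - y w) = 0\<close> there for some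
  \<open>i\<close> and \<open>w\<close>. For \<open>i > 0\<close> both \<open>a\<close> and \<open>y\<close> are nilpotent modulo \<open>a' = a\<^sup>i - y w + y\<^sup>i\<close>, since
  \<open>y\<^sup>N = y\<^bsup>N-i\<^esup> a'\<close> and \<open>a\<^sup>i\<close> is a multiple of \<open>y\<close> modulo \<open>a'\<close>.\<close>

lemma gr_ideal_nilpotent_step:
  assumes a: "a \<in> mp t" and t: "t \<ge> 1" and x: "x \<in> \<mm>"
    and A: "\<And>z. z \<in> A \<Longrightarrow> z \<in> \<mm> \<and> z [^] (p::nat) \<in> gr_ideal t a p"
  shows "\<exists>t' a' p'. t' \<ge> 1 \<and> a' \<in> mp t' \<and> (\<forall>z\<in>insert x A. z [^] (p'::nat) \<in> gr_ideal t' a' p')"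
proof -
  have ac: "a \<in> carrier R" and xc: "x \<in> carrier R" using a mp_sub x \<mm>_carr by auto
  obtain N where N: "ilen (PIdl b) (carrier R) = enat N" using ilen_PIdl_b_finite by auto
  define y where "y = x [^] t"
  have yt: "y \<in> mp t" unfolding y_def
    using ipow_pow_closed[OF \<mm>_ideal, of x 1 t] x \<mm>_ideal by (simp add: ideal_prod_one_left)
  have yc: "y \<in> carrier R" using yt mp_sub by auto
  have ypow: "y [^] k \<in> mp (t * k)" and apow: "a [^] k \<in> mp (t * k)" for k :: nat
    using ipow_pow_closed[OF \<mm>_ideal] yt a by auto
  define v where "v j = a [^] j \<otimes> y [^] (N - j)" for j
  have v: "v j \<in> mp (t * N)" if "j \<le> N" for j
  proof -
    have "t * j + t * (N - j) = t * N" using that by (metis add_mult_distrib2 le_add_diff_inverse)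
    then show ?thesis using ipow_mult_closed[OF \<mm>_ideal apow[of j] ypow[of "N - j"]] unfolding v_def by simp
  qed
  have "\<exists>i\<le>N. v i \<in> mp (Suc (t * N)) <+> Idl (v ` {..<i})"
    using hilb_bounded[of "t * N"] N v
    by (intro dependent_in_quotient[OF mp_ideal mp_ideal mp_antimono]) (auto simp: hilb_def simp del: Group.nat_pow_Suc)
  then obtain i where i: "i \<le> N" "v i \<in> mp (Suc (t * N)) <+> Idl (v ` {..<i})" by blast
  have xpow: "x [^] (t * N) = y [^] N" unfolding y_def using xc by (simp add: nat_pow_pow)
  show ?thesis
  proof (cases i)
    case 0
    \<comment> \<open>A dependence at \<open>i = 0\<close> says that \<open>y^N\<close> vanishes in
      the graded ring. Then \<open>x\<close> is already nilpotent there, and \<open>a\<close> is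
      kept.\<close>
    have "v 0 \<in> mp (Suc (t * N))"
    proof -
      have "Idl {} \<subseteq> mp (Suc (t * N))" by (rule genideal_minimal[OF mp_ideal]) simp
      then have "mp (Suc (t * N)) <+> Idl {} \<subseteq> mp (Suc (t * N))"
        by (rule set_add_least[OF mp_ideal order_refl])
      then show ?thesis using i 0 by auto
    qed
    then have "x [^] (t * N) \<in> gr_ideal t a (t * N)"
      unfolding xpow v_def using yc by (intro gr_idealI2[OF ac]) (simp del: Group.nat_pow_Suc)
    then have "\<forall>z\<in>insert x A. z [^] (p + t * N) \<in> gr_ideal t a (p + t * N)"
      using gr_ideal_pow_mono[OF a x, of "t * N"] gr_ideal_pow_mono[OF a, of _ p] A by auto
    then show ?thesis using a t by blast
  next
    case (Suc i')
    \<comment> \<open>Every \<open>v j\<close> with \<open>j < i\<close> contains the factor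
      \<open>y^(N-i+1)\<close>, and the cofactor has degree \<open>t * i'\<close> with
      \<open>i' = i - 1\<close>. This is where \<open>w\<close> and its degree come from.\<close>
    let ?W = "scale (y [^] (N - i) \<otimes> y) (mp (t * i'))"
    have W: "ideal ?W R" using mp_ideal yc by (intro scale_ideal) auto
    have "Idl (v ` {..<i}) \<subseteq> ?W"
    proof (rule genideal_minimal[OF W], rule image_subsetI)
      fix j assume "j \<in> {..<i}"
      then have j: "j < i" "j \<le> i'" using Suc by auto
      have e: "N - j = (N - i) + (1 + (i' - j))" using j i Suc by simp
      have "y [^] (N - j) = y [^] (N - i) \<otimes> (y \<otimes> y [^] (i' - j))"
        unfolding e using yc by (simp only: nat_pow_mult[symmetric] nat_pow_eone)
      then have "v j = (y [^] (N - i) \<otimes> y) \<otimes> (a [^] j \<otimes> y [^] (i' - j))"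
        unfolding v_def using yc ac by (simp add: m_ac)
      moreover have "a [^] j \<otimes> y [^] (i' - j) \<in> mp (t * i')"
      proof -
        have "t * j + t * (i' - j) = t * i'" using j by (metis add_mult_distrib2 le_add_diff_inverse)
        then show ?thesis using ipow_mult_closed[OF \<mm>_ideal apow[of j] ypow[of "i' - j"]] by simp
      qed
      ultimately show "v j \<in> ?W" by (auto simp: scale_def)
    qed
    then obtain u w where uw: "u \<in> mp (Suc (t * N))" "w \<in> mp (t * i')" "v i = u \<oplus> (y [^] (N - i) \<otimes> y) \<otimes> w"
      using i unfolding mem_set_add scale_def by blast
    have uwc: "u \<in> carrier R" "w \<in> carrier R" using uw mp_sub by (auto simp del: Group.nat_pow_Suc)
    define a' where "a' = (a [^] i \<ominus> y \<otimes> w) \<oplus> y [^] i"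
    have ti: "t * i = t + t * i'" using Suc by simp
    have yw: "y \<otimes> w \<in> mp (t * i)" unfolding ti using ipow_mult_closed[OF \<mm>_ideal yt uw(2)] by simp
    have a': "a' \<in> mp (t * i)" unfolding a'_def using yw apow ypow
      by (intro ideal_add[OF mp_ideal] ideal_diff[OF mp_ideal])
    have a'c: "a' \<in> carrier R" using a' mp_sub by auto
    note FI = gr_ideal_ideal[OF a'c, of "t * i"]
    have Nt: "t * N - t * i = t * (N - i)" using i by (simp add: diff_mult_distrib2)
    have yN: "y [^] N \<in> gr_ideal (t * i) a' (t * N)"
    proof -
      define Z where "Z = y [^] (N - i)"
      have Zc: "Z \<in> carrier R" unfolding Z_def using yc by simp
      have e1: "a [^] i \<otimes> Z = u \<oplus> (Z \<otimes> y) \<otimes> w" using uw(3) by (simp add: v_def Z_def)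
      have e2: "y [^] N = Z \<otimes> y [^] i" unfolding Z_def using i yc by (simp add: nat_pow_mult)
      define Q P where "Q = y [^] i" and "P = a [^] i"
      have QP: "Q \<in> carrier R" "P \<in> carrier R" using yc ac by (auto simp: Q_def P_def)
      have "a' \<otimes> Z = ((P \<ominus> y \<otimes> w) \<oplus> Q) \<otimes> Z" by (simp add: a'_def Q_def P_def)
      also have "\<dots> = (P \<otimes> Z \<ominus> (Z \<otimes> y) \<otimes> w) \<oplus> Z \<otimes> Q" using QP Zc yc uwc by algebra
      also have "P \<otimes> Z = u \<oplus> (Z \<otimes> y) \<otimes> w" using e1 by (simp add: P_def)
      also have "(u \<oplus> (Z \<otimes> y) \<otimes> w \<ominus> (Z \<otimes> y) \<otimes> w) \<oplus> Z \<otimes> Q = u \<oplus> Z \<otimes> Q" using QP Zc yc uwc by algebra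
      finally have "y [^] N = a' \<otimes> Z \<ominus> u" using e2 QP Zc uwc
        by (simp add: Q_def a_minus_def a_ac r_neg1 r_neg2)
      moreover have "a' \<otimes> Z \<in> gr_ideal (t * i) a' (t * N)"
        using ypow[of "N - i"] by (intro gr_idealI1[OF a'c]) (simp add: Nt Z_def)
      moreover have "u \<in> gr_ideal (t * i) a' (t * N)" by (rule gr_idealI2[OF a'c uw(1)])
      ultimately show ?thesis using ideal_diff[OF FI] by simp
    qed
    \<comment> \<open>Chosen so that \<open>a' = a^i - y w'\<close>. Modulo \<open>a'\<close> the
      power \<open>a^i\<close> becomes \<open>y w'\<close>, whose \<open>N\<close>-th power vanishes
      together with \<open>y^N\<close>.\<close>
    define w' where "w' = w \<ominus> y [^] i'"
    have w': "w' \<in> mp (t * i')" unfolding w'_def using uw ypow by (intro ideal_diff[OF mp_ideal])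
    have w'c: "w' \<in> carrier R" using w' mp_sub by auto
    have aiN: "(a [^] i) [^] N \<in> gr_ideal (t * i) a' ((t * i) * N)"
    proof (rule pow_in_graded[OF \<mm>_ideal FI gr_ideal_mult[OF a'] apow])
      show "y \<otimes> w' \<in> mp (t * i)" unfolding ti using ipow_mult_closed[OF \<mm>_ideal yt w'] by simp
      have "a [^] i \<ominus> y \<otimes> w' = a'"
      proof -
        define P Q where "P = a [^] i" and "Q = y [^] i'"
        have "P \<in> carrier R" "Q \<in> carrier R" using ac yc by (auto simp: P_def Q_def)
        then have "P \<ominus> y \<otimes> (w \<ominus> Q) = (P \<ominus> y \<otimes> w) \<oplus> Q \<otimes> y" using yc uwc by algebra
        then show ?thesis unfolding a'_def w'_def P_def Q_def using Suc by simp
      qed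
      then show "a [^] i \<ominus> y \<otimes> w' \<in> gr_ideal (t * i) a' (t * i)"
        using gr_idealI1[OF a'c, of \<one> "t * i" "t * i"] a'c by simp
      have "y [^] N \<otimes> w' [^] N \<in> gr_ideal (t * i) a' (t * N + (t * i') * N)"
        by (rule gr_ideal_memD[OF a' yN ipow_pow_closed[OF \<mm>_ideal w']])
      moreover have "t * N + (t * i') * N = (t * i) * N" unfolding ti by (simp add: algebra_simps)
      ultimately show "(y \<otimes> w') [^] N \<in> gr_ideal (t * i) a' ((t * i) * N)"
        using yc w'c by (simp add: nat_pow_distrib)
    qed
    \<comment> \<open>Enlarging the exponent from \<open>p\<close> to \<open>q \<ge> t\<close> turns
      \<open>q - t\<close> into a genuine subtraction: \<open>z^q\<close> is congruent to some
      \<open>a r\<close> with \<open>r\<close> of degree \<open>q - t\<close>, and so inherits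
      nilpotency from \<open>a\<close>.\<close>
    define q where "q = p + t"
    have zq: "z [^] (q * (i * N)) \<in> gr_ideal (t * i) a' (q * (i * N))" if z: "z \<in> A" for z
    proof -
      have zc: "z \<in> carrier R" using A z \<mm>_carr by auto
      have "z [^] q \<in> gr_ideal t a q" using gr_ideal_pow_mono[OF a] A[OF z] by (auto simp: q_def)
      then obtain r u' where ru: "r \<in> mp (q - t)" "u' \<in> mp (Suc q)" "z [^] q = a \<otimes> r \<oplus> u'"
        unfolding gr_ideal_def scale_def mem_set_add by auto
      have c: "r \<in> carrier R" "u' \<in> carrier R" using ru mp_sub by (auto simp del: Group.nat_pow_Suc)
      have zqm: "z [^] q \<in> mp q"
        using ipow_pow_closed[OF \<mm>_ideal, of z 1 q] A z \<mm>_ideal by (simp add: ideal_prod_one_left)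
      have ar: "a \<otimes> r \<in> mp q" using ipow_mult_closed[OF \<mm>_ideal a ru(1)] by (simp add: q_def add.commute)
      have "(z [^] q) [^] (i * N) \<in> gr_ideal (t * i) a' (q * (i * N))"
      proof (rule pow_in_graded[OF \<mm>_ideal FI gr_ideal_mult[OF a'] zqm ar])
        have "z [^] q \<ominus> a \<otimes> r = u'" unfolding ru(3) using c ac by algebra
        then show "z [^] q \<ominus> a \<otimes> r \<in> gr_ideal (t * i) a' q" using gr_idealI2[OF a'c ru(2)] by simp
        have "(a [^] i) [^] N \<otimes> r [^] (i * N) \<in> gr_ideal (t * i) a' ((t * i) * N + (q - t) * (i * N))"
          by (rule gr_ideal_memD[OF a' aiN ipow_pow_closed[OF \<mm>_ideal ru(1)]])
        moreover have "(t * i) * N + (q - t) * (i * N) = q * (i * N)" unfolding q_def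
          by (simp add: algebra_simps)
        ultimately show "(a \<otimes> r) [^] (i * N) \<in> gr_ideal (t * i) a' (q * (i * N))"
          using ac c by (simp add: nat_pow_distrib nat_pow_pow)
      qed
      then show ?thesis using zc by (simp add: nat_pow_pow)
    qed
    have "\<forall>z\<in>insert x A. z [^] (q * (i * N) + t * N) \<in> gr_ideal (t * i) a' (q * (i * N) + t * N)"
    proof
      fix z assume "z \<in> insert x A"
      then show "z [^] (q * (i * N) + t * N) \<in> gr_ideal (t * i) a' (q * (i * N) + t * N)"
        using gr_ideal_pow_mono[OF a' x, of "t * N"] yN xpow zq gr_ideal_pow_mono[OF a', of z "q * (i * N)"] A
          by auto
    qed
    moreover have "t * i \<ge> 1" using t Suc by simp
    ultimately show ?thesis using a' by blast
  qed
qed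

text \<open>All generators of \<open>\<mm>\<close> are made nilpotent modulo one homogeneous element
  \<open>a\<close>, so the graded ring modulo \<open>a\<close> vanishes in large degrees, and
  Nakayama's lemma lifts this to \<open>\<mm>^(n+t) = a \<mm>^n\<close>. A power of \<open>b\<close>
  is then a multiple of \<open>a\<close>, and a divisor of a nonzerodivisor is one.\<close>

lemma superficial:
  obtains t a n0 where "t \<ge> 1" "a \<in> mp t" "nonzerodivisor a" "\<And>n. n \<ge> n0 \<Longrightarrow> mp (n + t) = scale a (mp n)"
proof -
  obtain A where A: "finite A" "A \<subseteq> \<mm>" "\<mm> = Idl A" using ideal_fin_gen[OF \<mm>_ideal] by auto
  have "\<exists>t a p. t \<ge> 1 \<and> a \<in> mp t \<and> (\<forall>z\<in>A. z [^] (p::nat) \<in> gr_ideal t a p)"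
    using A(1,2)
  proof (induction A)
    case empty
    \<comment> \<open>With no generators to treat, the element zero in degree one is a legitimate
      start.\<close>
    have "\<zero> \<in> mp 1" by (rule ideal_zero[OF mp_ideal])
    then show ?case by blast
  next
    case (insert x A)
    then obtain t a p where "t \<ge> 1" "a \<in> mp t" "\<forall>z\<in>A. z [^] (p::nat) \<in> gr_ideal t a p" by auto
    then show ?case using gr_ideal_nilpotent_step[of a t x A p] insert by auto
  qed
  then obtain t a p where tap: "t \<ge> 1" "a \<in> mp t" "\<And>z. z \<in> A \<Longrightarrow> z [^] (p::nat) \<in> gr_ideal t a p" by blast
  have ac: "a \<in> carrier R" using tap mp_sub by auto
  have "\<exists>u. \<forall>k. ipow (Idl A) u \<cdot> mp k \<subseteq> gr_ideal t a (u + k)"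
    by (rule ipow_Idl_subset[OF \<mm>_ideal gr_ideal_ideal[OF ac] gr_ideal_mult[OF tap(2)] A(1,2) tap(3)])
  then obtain u where u: "\<And>k. mp (u + k) \<subseteq> gr_ideal t a (u + k)" using A(3) mp_add by metis
  have eq: "mp (n + t) = scale a (mp n)" if n: "n \<ge> u" for n
  proof
    have "mp (n + t) \<subseteq> scale a (mp n) <+> mp (Suc (n + t))"
      using u[of "n + t - u"] n by (simp add: gr_ideal_def del: Group.nat_pow_Suc)
    moreover have "mp (Suc (n + t)) = \<mm> \<cdot> mp (n + t)"
      by (simp add: ideal_prod_commute mp_ideal \<mm>_ideal)
    ultimately show "mp (n + t) \<subseteq> scale a (mp n)"
      using nakayama[OF scale_ideal[OF ac mp_ideal] mp_ideal] by simp
    show "scale a (mp n) \<subseteq> mp (n + t)"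
      using ipow_mult_closed[OF \<mm>_ideal tap(2)] by (auto simp: scale_def add.commute)
  qed
  have "nonzerodivisor a"
  proof -
    have "b [^] (u + t) \<in> mp (u + t)"
      using ipow_pow_closed[OF \<mm>_ideal, of b 1 "u + t"] b_\<mm> \<mm>_ideal by (simp add: ideal_prod_one_left)
    then obtain r where "r \<in> mp u" "b [^] (u + t) = a \<otimes> r" using eq[of u] by (auto simp: scale_def)
    then show ?thesis using nonzerodivisor_factor[of a r] nonzerodivisor_pow[OF b_nzd, of "u + t"] ac mp_sub
      by auto
  qed
  then show ?thesis using that tap eq by blast
qed

end

section \<open>Ratliff-Rush closures of the ideals \<open>\<mm>^s J\<close>\<close>

context cm_local_one
begin

text \<open>Multiplying the hypothesis by \<open>\<mm>^(tN-N)\<close> gives \<open>a^N x\<close> in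
  \<open>\<mm>^(tN+s) J = a^N \<mm>^s J\<close>, and \<open>a^N\<close> cancels. The bound
  \<open>n0\<close> is uniform in \<open>J\<close> and \<open>N\<close>, because the relation
  \<open>\<mm>^(n+t) = a \<mm>^n\<close> is applied only for \<open>n \<ge> s\<close>.\<close>

lemma ratliff_rush:
  obtains n0 where "\<And>s J x N. \<lbrakk>s \<ge> n0; ideal J R; x \<in> carrier R; \<And>y. y \<in> mp N \<Longrightarrow> y \<otimes> x \<in> mp (N + s) \<cdot> J\<rbrakk>
    \<Longrightarrow> x \<in> mp s \<cdot> J"
proof -
  obtain t a n0 where t: "t \<ge> 1" and a: "a \<in> mp t" "nonzerodivisor a"
    and sup: "\<And>n. n \<ge> n0 \<Longrightarrow> mp (n + t) = scale a (mp n)" using superficial by metis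
  have ac: "a \<in> carrier R" using a mp_carr by auto
  have "x \<in> mp s \<cdot> J" if s: "s \<ge> n0" and J: "ideal J R" and x: "x \<in> carrier R"
    and y: "\<And>y. y \<in> mp N \<Longrightarrow> y \<otimes> x \<in> mp (N + s) \<cdot> J" for s J x N
  proof -
    have mJ: "ideal (mp k \<cdot> J) R" for k using J mp_ideal by (intro ideal_prod_is_ideal)
    have scl: "mp (t * n + s) \<cdot> J = scale (a [^] n) (mp s \<cdot> J)" for n :: nat
    proof (induction n)
      case 0 then show ?case using ideal_sub[OF mJ] by (auto simp: scale_def image_iff subset_iff)
    next
      case (Suc n)
      have "mp (t * Suc n + s) = scale a (mp (t * n + s))" using sup[of "t * n + s"] s
        by (simp add: algebra_simps)
      then have "mp (t * Suc n + s) \<cdot> J = scale a (mp (t * n + s) \<cdot> J)"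
        using scale_eq_prod[OF ac] mp_ideal J mJ cgenideal_ideal[OF ac] by (simp add: ideal_prod_assoc)
      also have "\<dots> = scale (a \<otimes> a [^] n) (mp s \<cdot> J)" using Suc ac ideal_sub[OF mJ] by (simp add: scale_scale)
      also have "a \<otimes> a [^] n = a [^] Suc n" using ac by (simp add: m_comm)
      finally show ?case .
    qed
    have K: "ideal {z \<in> carrier R. z \<otimes> x \<in> mp (t * N + s) \<cdot> J} R"
    proof (rule idealI')
      fix r z assume "r \<in> carrier R" "z \<in> {z \<in> carrier R. z \<otimes> x \<in> mp (t * N + s) \<cdot> J}"
      then show "r \<otimes> z \<in> {z \<in> carrier R. z \<otimes> x \<in> mp (t * N + s) \<cdot> J}"
        using ideal_mult[OF mJ, of r "z \<otimes> x"] x by (auto simp: m_assoc)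
    qed (use x mJ ideal_zero ideal_add in \<open>auto simp: l_distr\<close>)
    have e: "N + (t * N - N) = t * N" using t by simp
    have "mp (t * N) = mp (t * N - N) \<cdot> mp N" using mp_add[of "t * N - N" N] e by (simp add: add.commute)
    also have "\<dots> \<subseteq> {z \<in> carrier R. z \<otimes> x \<in> mp (t * N + s) \<cdot> J}"
    proof (rule ideal_prod_least[OF K])
      fix i j assume i: "i \<in> mp (t * N - N)" and j: "j \<in> mp N"
      have "i \<otimes> (j \<otimes> x) \<in> mp (t * N - N) \<cdot> (mp (N + s) \<cdot> J)" using i y[OF j] by (rule ideal_prod.prod)
      also have "\<dots> = mp ((t * N - N) + (N + s)) \<cdot> J" using mp_ideal J
        by (simp add: mp_add[of "t * N - N"] ideal_prod_assoc)
      also have "(t * N - N) + (N + s) = t * N + s" using e by simp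
      finally show "i \<otimes> j \<in> {z \<in> carrier R. z \<otimes> x \<in> mp (t * N + s) \<cdot> J}"
        using mp_carr[OF i] mp_carr[OF j] x by (simp add: m_assoc)
    qed
    finally have "a [^] N \<otimes> x \<in> mp (t * N + s) \<cdot> J" using ipow_pow_closed[OF \<mm>_ideal a(1), of N] by auto
    then show ?thesis
      unfolding scl using scale_mem_cancel[OF nonzerodivisor_pow[OF a(2)] ideal_sub[OF mJ] x] by simp
  qed
  then show ?thesis using that by blast
qed

end

section \<open>The Dedekind--Mertens lemma\<close>

context cring
begin

text \<open>Polynomials are represented by coefficient sequences on all of \<open>nat\<close>, and
  \<open>conv\<close> is their product; degree bounds appear as separate hypotheses.\<close>

definition conv :: "(nat \<Rightarrow> 'a) \<Rightarrow> (nat \<Rightarrow> 'a) \<Rightarrow> nat \<Rightarrow> 'a" where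
  "conv f h p = (\<Oplus>i\<in>{..p}. f i \<otimes> h (p - i))"

lemma finsum_split_at:
  assumes "finite A" "k \<in> A" "G \<in> A \<rightarrow> carrier R"
  shows "finsum R G A = G k \<oplus> finsum R (G(k := \<zero>)) A"
proof -
  have A: "A = insert k (A - {k})" using assms by auto
  have "finsum R G (insert k (A - {k})) = G k \<oplus> finsum R G (A - {k})"
    using assms by (intro finsum_insert) auto
  moreover have "finsum R (G(k := \<zero>)) (insert k (A - {k})) = (G(k := \<zero>)) k \<oplus> finsum R (G(k := \<zero>)) (A - {k})"
    using assms by (intro finsum_insert) auto
  moreover have "finsum R (G(k := \<zero>)) (A - {k}) = finsum R G (A - {k})"
    using assms by (intro finsum_cong') auto
  moreover have "finsum R G (A - {k}) \<in> carrier R" using assms by (intro finsum_closed) auto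
  ultimately show ?thesis using A by simp
qed

lemma conv_closed: "\<lbrakk>\<And>i. f i \<in> carrier R; \<And>i. h i \<in> carrier R\<rbrakk> \<Longrightarrow> conv f h p \<in> carrier R"
  unfolding conv_def by (intro finsum_closed) auto

lemma conv_update_left:
  assumes "\<And>i. f i \<in> carrier R" "\<And>i. h i \<in> carrier R"
  shows "conv f h p = (if k \<le> p then f k \<otimes> h (p - k) else \<zero>) \<oplus> conv (f(k := \<zero>)) h p"
proof (cases "k \<le> p")
  case True
  have "conv f h p = f k \<otimes> h (p - k) \<oplus> finsum R ((\<lambda>i. f i \<otimes> h (p - i))(k := \<zero>)) {..p}"
    unfolding conv_def using assms True by (intro finsum_split_at) auto
  also have "finsum R ((\<lambda>i. f i \<otimes> h (p - i))(k := \<zero>)) {..p} = conv (f(k := \<zero>)) h p"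
    unfolding conv_def using assms by (intro finsum_cong') auto
  finally show ?thesis using True by simp
next
  case False
  have "conv f h p = conv (f(k := \<zero>)) h p" unfolding conv_def using assms False by (intro finsum_cong') auto
  then show ?thesis using False conv_closed[of "f(k := \<zero>)" h p] assms by simp
qed

lemma conv_update_right:
  assumes "\<And>i. f i \<in> carrier R" "\<And>i. h i \<in> carrier R"
  shows "conv f h p = (if k \<le> p then f (p - k) \<otimes> h k else \<zero>) \<oplus> conv f (h(k := \<zero>)) p"
proof (cases "k \<le> p")
  case True
  have "conv f h p = f (p - k) \<otimes> h (p - (p - k)) \<oplus> finsum R ((\<lambda>i. f i \<otimes> h (p - i))(p - k := \<zero>)) {..p}"
    unfolding conv_def using assms True by (intro finsum_split_at) auto
  also have "finsum R ((\<lambda>i. f i \<otimes> h (p - i))(p - k := \<zero>)) {..p} = conv f (h(k := \<zero>)) p"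
    unfolding conv_def using assms True by (intro finsum_cong') auto
  finally show ?thesis using True by simp
next
  case False
  have "conv f h p = conv f (h(k := \<zero>)) p" unfolding conv_def using assms False by (intro finsum_cong') auto
  then show ?thesis using False conv_closed[of f "h(k := \<zero>)" p] assms by simp
qed

lemma conv_scale_right:
  assumes "\<And>i. f i \<in> carrier R" "\<And>i. h i \<in> carrier R" "a \<in> carrier R"
  shows "conv f (\<lambda>j. a \<otimes> h j) p = a \<otimes> conv f h p"
  unfolding conv_def using assms by (subst finsum_rdistr) (auto intro!: finsum_cong' simp: m_lcomm)

lemma colon_ideal:
  assumes "ideal K R" "Y \<subseteq> carrier R"
  shows "ideal {d \<in> carrier R. \<forall>y\<in>Y. y \<otimes> d \<in> K} R"
proof (rule idealI')
  fix r x assume *: "r \<in> carrier R" "x \<in> {d \<in> carrier R. \<forall>y\<in>Y. y \<otimes> d \<in> K}"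
  have "y \<otimes> (r \<otimes> x) \<in> K" if "y \<in> Y" for y
  proof -
    have "y \<otimes> (r \<otimes> x) = r \<otimes> (y \<otimes> x)" using * that assms by (intro m_lcomm) auto
    then show ?thesis using * that ideal_mult[OF assms(1)] by auto
  qed
  then show "r \<otimes> x \<in> {d \<in> carrier R. \<forall>y\<in>Y. y \<otimes> d \<in> K}" using * by auto
qed (use assms ideal_zero ideal_add in \<open>auto simp: r_distr subset_iff\<close>)

text \<open>Unlike in \<open>ipow_sum_pigeonhole\<close>, the second summand is a pure power of
  \<open>Y\<close>. This is the case distinction of the Dedekind-Mertens induction: a product of
  coefficients of \<open>f\<close> contains the last coefficient or avoids it.\<close>

lemma ipow_sum_Suc:
  assumes X: "ideal X R" and Y: "ideal Y R"
  shows "ipow (X <+> Y) (Suc n) \<subseteq> (X \<cdot> ipow (X <+> Y) n) <+> ipow Y (Suc n)"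
proof (induction n)
  case 0
  then show ?case using X Y by (simp add: ideal_prod_one_left ideal_prod_one add_ideals)
next
  case (Suc n)
  let ?S = "X <+> Y"
  have S: "ideal ?S R" using X Y by (rule add_ideals)
  note ids = X Y S ipow_ideal[OF S] ipow_ideal[OF Y] ideal_prod_is_ideal
  let ?T = "(X \<cdot> ipow ?S (Suc n)) <+> ipow Y (Suc (Suc n))"
  have T: "ideal ?T R" by (intro add_ideals ids)
  have "ipow ?S (Suc (Suc n)) = (ipow ?S (Suc n) \<cdot> X) <+> (ipow ?S (Suc n) \<cdot> Y)"
    unfolding ipow_Suc[of _ "Suc n"] by (intro ideal_prod_r_distr ids)
  also have "\<dots> \<subseteq> ?T"
  proof (rule set_add_least[OF T])
    have "ipow ?S (Suc n) \<cdot> X = X \<cdot> ipow ?S (Suc n)" by (intro ideal_prod_commute ids)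
    then show "ipow ?S (Suc n) \<cdot> X \<subseteq> ?T"
      using set_add_upper1[of "X \<cdot> ipow ?S (Suc n)" "ipow Y (Suc (Suc n))"] ids by simp
    have "ipow ?S (Suc n) \<cdot> Y \<subseteq> ((X \<cdot> ipow ?S n) <+> ipow Y (Suc n)) \<cdot> Y"
      using Suc by (rule ideal_prod_mono) simp
    also have "\<dots> = (X \<cdot> ipow ?S n) \<cdot> Y <+> ipow Y (Suc n) \<cdot> Y" by (intro ideal_prod_distr(2) ids)
    also have "\<dots> \<subseteq> ?T"
    proof (rule set_add_mono')
      have "(X \<cdot> ipow ?S n) \<cdot> Y = X \<cdot> (ipow ?S n \<cdot> Y)" by (intro ideal_prod_assoc ids)
      also have "\<dots> \<subseteq> X \<cdot> ipow ?S (Suc n)"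
        unfolding ipow_Suc[of _ n] using set_add_upper2[OF X Y] by (intro ideal_prod_mono) auto
      finally show "(X \<cdot> ipow ?S n) \<cdot> Y \<subseteq> X \<cdot> ipow ?S (Suc n)" .
    qed simp
    finally show "ipow ?S (Suc n) \<cdot> Y \<subseteq> ?T" .
  qed
  finally show ?case .
qed

text \<open>For a polynomial \<open>h\<close> with \<open>N\<close> coefficients, the content of
  \<open>f\<close> to the power \<open>N\<close>, times the content of \<open>h\<close>, lies in the
  content of \<open>f\<close> to the power \<open>N - 1\<close> times the content of
  \<open>f h\<close>. Any ideal \<open>L\<close> containing the coefficients of \<open>f h\<close>
  is allowed, since \<open>L\<close> changes in both inductions: the outer one on the number of
  coefficients of \<open>h\<close>, the inner one on that of \<open>f\<close>. They split off the
  last coefficients \<open>b\<close> and \<open>a\<close>, whose product is the coefficient of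
  \<open>f h\<close> at \<open>k + N\<close>.\<close>

lemma dedekind_mertens:
  assumes "\<And>i. f i \<in> carrier R" "\<And>i. i \<ge> k \<Longrightarrow> f i = \<zero>" "\<And>j. h j \<in> carrier R" "\<And>j. j \<ge> N \<Longrightarrow> h j = \<zero>"
    and "ideal L R" "\<And>p. conv f h p \<in> L" "y \<in> ipow (Idl (f ` {..<k})) N"
  shows "y \<otimes> h j \<in> ipow (Idl (f ` {..<k})) (N - 1) \<cdot> L"
  using assms
proof (induction N arbitrary: k f h L y j)
  case 0
  have C: "ideal (Idl (f ` {..<k})) R" using 0(1) by (intro genideal_ideal) auto
  have "h j = \<zero>" "y \<in> carrier R" using 0 by auto
  then show ?case using 0(5) ideal_zero[OF ipow_prod_ideal[OF C 0(5), of "0 - 1"]] by simp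
next
  case (Suc N)
  note IH = Suc.IH
  show ?case using Suc.prems
  proof (induction k arbitrary: f h L y j)
    case 0
    have z: "Idl (f ` {..<0}) = {\<zero>}"
      using genideal_minimal[OF zeroideal, of "{}"] ideal_zero[OF genideal_ideal[of "{}"]] by auto
    have "ipow (Idl (f ` {..<0})) (Suc N) \<subseteq> {\<zero>}"
      unfolding z ipow_Suc using ideal_prod_sub2[OF ipow_ideal[OF zeroideal] zeroideal] .
    then have "y = \<zero>" using 0(7) by blast
    moreover have "ideal (Idl (f ` {..<0})) R" by (intro genideal_ideal) auto
    ultimately show ?case using 0(3) ideal_zero[OF ipow_prod_ideal[OF _ 0(5)]] by simp
  next
    case (Suc k)
    define a b f' h' where "a = f k" and "b = h N" and "f' = f(k := \<zero>)" and "h' = h(N := \<zero>)"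
    define C C' where "C = Idl (f ` {..<Suc k})" and "C' = Idl (f' ` {..<k})"
    note fc = Suc.prems(1) and fz = Suc.prems(2) and hc = Suc.prems(3) and hz = Suc.prems(4)
      and L = Suc.prems(5) and cv = Suc.prems(6)
    have ac: "a \<in> carrier R" "b \<in> carrier R" using fc hc by (auto simp: a_def b_def)
    have fkc: "f ` {..<Suc k} \<subseteq> carrier R" "f' ` {..<k} \<subseteq> carrier R" using fc by (auto simp: f'_def)
    have C: "ideal C R" "ideal C' R" unfolding C_def C'_def using fkc by (auto intro: genideal_ideal)
    have "f ` {..<Suc k} = insert a (f' ` {..<k})" unfolding a_def f'_def lessThan_Suc
      by (auto intro!: image_cong)
    then have Ceq: "C = PIdl a <+> C'" unfolding C_def C'_def using Idl_insert[OF ac(1) fkc(2)] by simp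
    have Pa: "ideal (PIdl a) R" using ac(1) by (rule cgenideal_ideal)
    have C'C: "C' \<subseteq> C" and aC: "a \<in> C"
      using set_add_upper2[OF Pa C(2)] set_add_upper1[OF Pa C(2)] cgenideal_self[OF ac(1)] Ceq by auto
    have fC: "f i \<in> C" for i
    proof (cases "i < Suc k")
      case True then show ?thesis using genideal_self[OF fkc(1)] C_def by auto
    next
      case False then show ?thesis using fz ideal_zero[OF C(1)] by simp
    qed
    let ?T = "ipow C N \<cdot> L"
    have T: "ideal ?T R" using ipow_prod_ideal C L by auto
    have ab: "a \<otimes> b \<in> L"
    proof -
      have "conv f' h (k + N) = \<zero>" unfolding conv_def
      proof (rule add.finprod_one_eqI)
        fix i assume "i \<in> {..k + N}"
        then show "f' i \<otimes> h (k + N - i) = \<zero>"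
          using fz[of i] hz[of "k + N - i"] fc hc by (cases "i < k"; cases "i = k") (auto simp: f'_def)
      qed
      then have "conv f h (k + N) = a \<otimes> b"
        using conv_update_left[of f h "k + N" k, OF fc hc] ac by (simp add: a_def b_def f'_def)
      then show ?thesis using cv by metis
    qed
    \<comment> \<open>Products containing \<open>a\<close>. Without its last coefficient,
      \<open>a h\<close> has a product with \<open>f\<close> whose coefficients lie in
      \<open>C \<cdot> L\<close>: they differ from \<open>a\<close> times those of
      \<open>f h\<close> by multiples of \<open>a b\<close> by coefficients of \<open>f\<close>. The
      outer induction applies, and the extra factor \<open>C\<close> restores the exponent
      \<open>N\<close>.\<close>
    have part1: "y \<otimes> (a \<otimes> h j) \<in> ?T" if y: "y \<in> ipow C N" for y j
    proof -
      have yc: "y \<in> carrier R" using y ipow_sub[OF C(1)] by auto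
      consider "j < N" | "j = N" | "j > N" by linarith
      then show ?thesis
      proof cases
        case 1
        have h'c: "h' i \<in> carrier R" for i using hc by (auto simp: h'_def)
        have CL: "ideal (C \<cdot> L) R" using C L by (intro ideal_prod_is_ideal)
        have "y \<otimes> (a \<otimes> h' j) \<in> ipow (Idl (f ` {..<Suc k})) (N - 1) \<cdot> (C \<cdot> L)"
        proof (rule IH[where h = "\<lambda>j. a \<otimes> h' j", OF fc fz])
          fix p
          have "a \<otimes> conv f h p = a \<otimes> ((if N \<le> p then f (p - N) \<otimes> b else \<zero>) \<oplus> conv f h' p)"
            using conv_update_right[of f h p N, OF fc hc] by (simp add: b_def h'_def)
          also have "\<dots> = (if N \<le> p then f (p - N) \<otimes> (a \<otimes> b) else \<zero>) \<oplus> conv f (\<lambda>j. a \<otimes> h' j) p"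
            using ac fc h'c conv_closed[of f h' p, OF fc h'c] by (auto simp: conv_scale_right r_distr m_lcomm)
          finally have e: "a \<otimes> conv f h p = conv f (\<lambda>j. a \<otimes> h' j) p \<oplus> (if N \<le> p then f (p - N) \<otimes> (a \<otimes> b) else \<zero>)"
            using ac fc h'c conv_closed[of f "\<lambda>j. a \<otimes> h' j" p] by (simp add: a_comm)
          show "conv f (\<lambda>j. a \<otimes> h' j) p \<in> C \<cdot> L"
          proof (rule ideal_add_cancel[OF CL])
            show "(if N \<le> p then f (p - N) \<otimes> (a \<otimes> b) else \<zero>) \<in> C \<cdot> L"
              using fC ab ideal_zero[OF CL] by (auto intro: ideal_prod.prod)
            show "conv f (\<lambda>j. a \<otimes> h' j) p \<oplus> (if N \<le> p then f (p - N) \<otimes> (a \<otimes> b) else \<zero>) \<in> C \<cdot> L"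
              unfolding e[symmetric] using aC cv by (rule ideal_prod.prod)
            show "conv f (\<lambda>j. a \<otimes> h' j) p \<in> carrier R" using ac fc h'c by (intro conv_closed) auto
          qed
        next
          show "y \<in> ipow (Idl (f ` {..<Suc k})) N" using y by (simp add: C_def)
        qed (use ac h'c CL hz in \<open>auto simp: h'_def not_less_eq_eq le_Suc_eq\<close>)
        moreover have "ipow C (N - 1) \<cdot> (C \<cdot> L) = ?T"
          using 1 C L ipow_Suc[of C "N - 1"] by (simp add: ideal_prod_assoc ipow_ideal del: Group.nat_pow_Suc)
        ultimately show ?thesis using 1 by (simp add: C_def h'_def)
      next
        case 2
        then show ?thesis using y ab by (auto simp: b_def intro: ideal_prod.prod)
      next
        case 3
        then show ?thesis using hz[of j] ac yc ideal_zero[OF T] by simp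
      qed
    qed
    \<comment> \<open>Products avoiding \<open>a\<close>. Removing the last coefficient of
      \<open>f\<close> changes the coefficients of \<open>f h\<close> by elements of
      \<open>a D\<close>, where \<open>D\<close> is the content of \<open>h\<close>. The inner
      induction is applied to \<open>L\<close> enlarged by \<open>a D\<close>, and
      \<open>part1\<close> absorbs the enlargement.\<close>
    have part2: "y \<otimes> h j \<in> ?T" if y: "y \<in> ipow C' (Suc N)" for y
    proof -
      define D where "D = Idl (range h)"
      have D: "ideal D R" unfolding D_def using hc by (intro genideal_ideal) auto
      have aD: "ideal (scale a D) R" using ac D by (intro scale_ideal)
      have L2: "ideal (L <+> scale a D) R" using L aD by (rule add_ideals)
      have hD: "h i \<in> D" for i unfolding D_def using genideal_self[of "range h"] hc by auto
      have "y \<otimes> h j \<in> ipow (Idl (f' ` {..<k})) (Suc N - 1) \<cdot> (L <+> scale a D)"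
      proof (rule Suc.IH)
        fix p
        have f'c: "f' i \<in> carrier R" for i using fc by (auto simp: f'_def)
        let ?u = "if k \<le> p then a \<otimes> h (p - k) else \<zero>"
        have e: "conv f h p = conv f' h p \<oplus> ?u"
          using conv_update_left[of f h p k, OF fc hc] conv_closed[of f' h p, OF f'c hc] ac hc
            by (simp add: a_def f'_def a_comm)
        show "conv f' h p \<in> L <+> scale a D"
        proof (rule ideal_add_cancel[OF L2])
          have "?u \<in> scale a D" using hD ideal_zero[OF aD] by (auto simp: scale_def)
          then show "?u \<in> L <+> scale a D" using set_add_upper2[OF L aD] by blast
          show "conv f' h p \<oplus> ?u \<in> L <+> scale a D" unfolding e[symmetric] using cv set_add_upper1[OF L aD]
            by blast
          show "conv f' h p \<in> carrier R" using f'c hc by (rule conv_closed)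
        qed
      next
        fix i assume "i \<ge> k" then show "f' i = \<zero>" using fz[of i]
          by (auto simp: f'_def not_less_eq_eq le_Suc_eq)
      qed (use fc hc hz L2 y in \<open>auto simp: f'_def C'_def\<close>)
      then have "y \<otimes> h j \<in> ipow C' N \<cdot> (L <+> scale a D)" by (simp add: C'_def)
      also have "\<dots> = ipow C' N \<cdot> L <+> ipow C' N \<cdot> scale a D" using C L aD
        by (intro ideal_prod_r_distr ipow_ideal)
      also have "\<dots> \<subseteq> ?T"
      proof (rule set_add_least[OF T])
        show "ipow C' N \<cdot> L \<subseteq> ?T" using ipow_mono[OF C'C] by (intro ideal_prod_mono) auto
        let ?K = "{d \<in> carrier R. \<forall>y\<in>ipow C N. y \<otimes> (a \<otimes> d) \<in> ?T}"
        have "?K = {d \<in> carrier R. \<forall>y\<in>(\<lambda>y. y \<otimes> a) ` ipow C N. y \<otimes> d \<in> ?T}"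
          using ipow_sub[OF C(1), of N] ac by (auto simp: m_assoc subset_iff)
        then have "ideal ?K R" using colon_ideal[OF T, of "(\<lambda>y. y \<otimes> a) ` ipow C N"] ipow_sub[OF C(1)] ac
          by auto
        then have DK: "D \<subseteq> ?K" unfolding D_def using part1 hc by (intro genideal_minimal) auto
        show "ipow C' N \<cdot> scale a D \<subseteq> ?T"
        proof (rule ideal_prod_least[OF T])
          fix i j assume "i \<in> ipow C' N" "j \<in> scale a D"
          then show "i \<otimes> j \<in> ?T" using DK ipow_mono[OF C'C, of N] by (auto simp: scale_def)
        qed
      qed
      finally show ?thesis .
    qed
    have "y \<in> ipow (PIdl a <+> C') (Suc N)" using Suc.prems(7) Ceq by (simp add: C_def del: Group.nat_pow_Suc)
    then have "y \<in> ((PIdl a) \<cdot> ipow C N) <+> ipow C' (Suc N)" using ipow_sum_Suc[OF Pa C(2), of N] Ceq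
      by blast
    then obtain y1 y2 where yy: "y1 \<in> (PIdl a) \<cdot> ipow C N" "y2 \<in> ipow C' (Suc N)" "y = y1 \<oplus> y2"
      unfolding mem_set_add by blast
    obtain z where z: "z \<in> ipow C N" "y1 = a \<otimes> z" using mem_prod_PIdl[OF ipow_ideal[OF C(1)] ac(1) yy(1)]
      by blast
    have c: "z \<in> carrier R" "y2 \<in> carrier R"
      using ideal_carr[OF ipow_ideal[OF C(1)] z(1)] ideal_carr[OF ipow_ideal[OF C(2)] yy(2)] .
    have "y \<otimes> h j = z \<otimes> (a \<otimes> h j) \<oplus> y2 \<otimes> h j"
      unfolding yy(3) z(2) using c ac hc[of j] by algebra
    also have "\<dots> \<in> ?T" using part1[OF z(1)] part2[OF yy(2)] by (rule ideal_add[OF T])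
    finally show ?case by (simp add: C_def)
  qed
qed

end

section \<open>Modules\<close>

context module
begin

lemma submod_carr: "\<lbrakk>submodule N R M; x \<in> N\<rbrakk> \<Longrightarrow> x \<in> carrier M"
  using submoduleE(1) by blast

lemma submod_zero: "submodule N R M \<Longrightarrow> \<zero>\<^bsub>M\<^esub> \<in> N"
  using subgroup.one_closed[of N "add_monoid M"] by (simp add: submodule_def)

lemma submod_add: "\<lbrakk>submodule N R M; x \<in> N; y \<in> N\<rbrakk> \<Longrightarrow> x \<oplus>\<^bsub>M\<^esub> y \<in> N"
  by (rule submoduleE(5))

lemma submod_smult: "\<lbrakk>submodule N R M; a \<in> carrier R; x \<in> N\<rbrakk> \<Longrightarrow> a \<odot>\<^bsub>M\<^esub> x \<in> N"
  by (rule submoduleE(4))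

lemma submod_neg: "\<lbrakk>submodule N R M; x \<in> N\<rbrakk> \<Longrightarrow> \<ominus>\<^bsub>M\<^esub> x \<in> N"
  by (rule submoduleE(3))

lemma submod_diff: "\<lbrakk>submodule N R M; x \<in> N; y \<in> N\<rbrakk> \<Longrightarrow> x \<ominus>\<^bsub>M\<^esub> y \<in> N"
  unfolding a_minus_def by (simp add: submod_add submod_neg)

lemma submoduleI':
  assumes "H \<subseteq> carrier M" "\<zero>\<^bsub>M\<^esub> \<in> H" "\<And>a b. \<lbrakk>a \<in> H; b \<in> H\<rbrakk> \<Longrightarrow> a \<oplus>\<^bsub>M\<^esub> b \<in> H"
    and "\<And>a x. \<lbrakk>a \<in> carrier R; x \<in> H\<rbrakk> \<Longrightarrow> a \<odot>\<^bsub>M\<^esub> x \<in> H"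
  shows "submodule H R M"
proof (rule submoduleI)
  fix x assume x: "x \<in> H"
  then have "\<ominus>\<^bsub>M\<^esub> x = (\<ominus> \<one>) \<odot>\<^bsub>M\<^esub> x" using assms(1) smult_l_minus[of \<one> x] by auto
  then show "\<ominus>\<^bsub>M\<^esub> x \<in> H" using assms(4)[of "\<ominus> \<one>" x] x by simp
qed (use assms in auto)

lemma submod_inter: "\<lbrakk>submodule N R M; submodule N' R M\<rbrakk> \<Longrightarrow> submodule (N \<inter> N') R M"
  by (rule submoduleI') (auto intro: submod_carr submod_zero submod_add submod_smult)

lemma mem_msum: "x \<in> set_add M X Y \<longleftrightarrow> (\<exists>i\<in>X. \<exists>j\<in>Y. x = i \<oplus>\<^bsub>M\<^esub> j)"
  by (auto simp: set_add_def set_mult_def)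

lemma submod_sum:
  assumes X: "submodule X R M" and Y: "submodule Y R M" shows "submodule (set_add M X Y) R M"
proof (rule submoduleI')
  note c = submod_carr[OF X] submod_carr[OF Y]
  show "set_add M X Y \<subseteq> carrier M" using c by (auto simp: mem_msum)
  show "\<zero>\<^bsub>M\<^esub> \<in> set_add M X Y"
    using submod_zero[OF X] submod_zero[OF Y] unfolding mem_msum by (metis M.l_zero M.zero_closed)
  fix a b assume "a \<in> set_add M X Y" "b \<in> set_add M X Y"
  then obtain x y x' y' where "x \<in> X" "y \<in> Y" "x' \<in> X" "y' \<in> Y" "a = x \<oplus>\<^bsub>M\<^esub> y" "b = x' \<oplus>\<^bsub>M\<^esub> y'"
    unfolding mem_msum by blast
  moreover then have "a \<oplus>\<^bsub>M\<^esub> b = (x \<oplus>\<^bsub>M\<^esub> x') \<oplus>\<^bsub>M\<^esub> (y \<oplus>\<^bsub>M\<^esub> y')" using c by (simp add: M.a_ac)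
  ultimately show "a \<oplus>\<^bsub>M\<^esub> b \<in> set_add M X Y"
    unfolding mem_msum using submod_add[OF X] submod_add[OF Y] by blast
next
  note c = submod_carr[OF X] submod_carr[OF Y]
  fix r a assume r: "r \<in> carrier R" and "a \<in> set_add M X Y"
  then obtain x y where "x \<in> X" "y \<in> Y" "a = x \<oplus>\<^bsub>M\<^esub> y" unfolding mem_msum by blast
  moreover then have "r \<odot>\<^bsub>M\<^esub> a = r \<odot>\<^bsub>M\<^esub> x \<oplus>\<^bsub>M\<^esub> r \<odot>\<^bsub>M\<^esub> y" using c r by (simp add: smult_r_distr)
  ultimately show "r \<odot>\<^bsub>M\<^esub> a \<in> set_add M X Y"
    unfolding mem_msum using submod_smult[OF X r] submod_smult[OF Y r] by blast
qed

lemma submod_sum_upper1: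
  assumes "submodule X R M" "submodule Y R M" shows "X \<subseteq> set_add M X Y"
proof
  fix x assume x: "x \<in> X"
  then have "x = x \<oplus>\<^bsub>M\<^esub> \<zero>\<^bsub>M\<^esub>" using submod_carr[OF assms(1)] by simp
  then show "x \<in> set_add M X Y" unfolding mem_msum using submod_zero[OF assms(2)] x by blast
qed

lemma submod_sum_upper2:
  assumes "submodule X R M" "submodule Y R M" shows "Y \<subseteq> set_add M X Y"
proof
  fix x assume x: "x \<in> Y"
  then have "x = \<zero>\<^bsub>M\<^esub> \<oplus>\<^bsub>M\<^esub> x" using submod_carr[OF assms(2)] by simp
  then show "x \<in> set_add M X Y" unfolding mem_msum using submod_zero[OF assms(1)] x by blast
qed

lemma submod_sum_least: "\<lbrakk>submodule Z R M; X \<subseteq> Z; Y \<subseteq> Z\<rbrakk> \<Longrightarrow> set_add M X Y \<subseteq> Z"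
  using submod_add by (fastforce simp: mem_msum)

sublocale submods: modular_family "{N. submodule N R M}" "set_add M"
proof (unfold_locales, goal_cases)
  case 1 then show ?case by (auto intro: submod_inter)
next
  case 2 then show ?case by (auto intro: submod_sum)
next
  case 3 then show ?case using submod_sum_upper1 by blast
next
  case 4 then show ?case using submod_sum_upper2 by blast
next
  case 5 then show ?case using submod_sum_least by blast
next
  case (6 X Y D)
  then have sub: "submodule X R M" "submodule Y R M" "submodule D R M" by auto
  have "Y \<subseteq> X"
  proof
    fix y assume y: "y \<in> Y"
    have "y \<in> set_add M X D" using y 6 submod_sum_upper1[of Y D] by auto
    then obtain x d where xd: "x \<in> X" "d \<in> D" "y = x \<oplus>\<^bsub>M\<^esub> d" by (auto simp: mem_msum)
    have c: "x \<in> carrier M" "d \<in> carrier M" using submod_carr[OF sub(1) xd(1)] submod_carr[OF sub(3) xd(2)] .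
    have "x \<in> Y" using xd 6 by auto
    then have "y \<ominus>\<^bsub>M\<^esub> x \<in> Y" using submod_diff[OF sub(2) y] by simp
    moreover have "y \<ominus>\<^bsub>M\<^esub> x = d" using c xd by (simp add: a_minus_def M.a_comm[of x d] M.a_assoc M.r_neg)
    ultimately have "d \<in> X" using xd 6 by blast
    then show "y \<in> X" using xd submod_add[OF sub(1)] by auto
  qed
  then show ?case using 6 by auto
qed

lemma submod_normal: "submodule N R M \<Longrightarrow> normal N (add_monoid M)"
  unfolding submodule_def using M.a_comm_group comm_group.subgroup_imp_normal by auto

lemma coset_mem:
  assumes N: "submodule N R M" and x: "x \<in> carrier M" and y: "y \<in> carrier M"
  shows "y \<in> N +>\<^bsub>M\<^esub> x \<longleftrightarrow> y \<ominus>\<^bsub>M\<^esub> x \<in> N"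
proof
  assume "y \<in> N +>\<^bsub>M\<^esub> x"
  then obtain n where n: "n \<in> N" "y = n \<oplus>\<^bsub>M\<^esub> x" by (auto simp: a_r_coset_def r_coset_def)
  then have "y \<ominus>\<^bsub>M\<^esub> x = n" using submod_carr[OF N] x by (simp add: a_minus_def M.a_assoc M.r_neg)
  then show "y \<ominus>\<^bsub>M\<^esub> x \<in> N" using n by simp
next
  assume *: "y \<ominus>\<^bsub>M\<^esub> x \<in> N"
  have "y = (y \<ominus>\<^bsub>M\<^esub> x) \<oplus>\<^bsub>M\<^esub> x" using x y by (simp add: a_minus_def M.a_assoc M.l_neg)
  then show "y \<in> N +>\<^bsub>M\<^esub> x" using * by (auto simp: a_r_coset_def r_coset_def)
qed

lemma coset_sub: "\<lbrakk>submodule N R M; x \<in> carrier M\<rbrakk> \<Longrightarrow> N +>\<^bsub>M\<^esub> x \<subseteq> carrier M"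
  using submod_carr by (auto simp: a_r_coset_def r_coset_def)

lemma coset_self: "\<lbrakk>submodule N R M; x \<in> carrier M\<rbrakk> \<Longrightarrow> x \<in> N +>\<^bsub>M\<^esub> x"
  using coset_mem submod_zero by (simp add: a_minus_def M.r_neg)

lemma coset_eq:
  assumes N: "submodule N R M" and x: "x \<in> carrier M" and y: "y \<in> carrier M"
  shows "N +>\<^bsub>M\<^esub> x = N +>\<^bsub>M\<^esub> y \<longleftrightarrow> x \<ominus>\<^bsub>M\<^esub> y \<in> N"
proof
  assume "N +>\<^bsub>M\<^esub> x = N +>\<^bsub>M\<^esub> y"
  then show "x \<ominus>\<^bsub>M\<^esub> y \<in> N" using coset_self[OF N x] coset_mem[OF N y x] by simp
next
  assume d: "x \<ominus>\<^bsub>M\<^esub> y \<in> N"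
  have "z \<ominus>\<^bsub>M\<^esub> x \<in> N \<longleftrightarrow> z \<ominus>\<^bsub>M\<^esub> y \<in> N" if z: "z \<in> carrier M" for z
  proof
    assume "z \<ominus>\<^bsub>M\<^esub> x \<in> N"
    then have "(z \<ominus>\<^bsub>M\<^esub> x) \<oplus>\<^bsub>M\<^esub> (x \<ominus>\<^bsub>M\<^esub> y) \<in> N" using d submod_add[OF N] by simp
    also have "(z \<ominus>\<^bsub>M\<^esub> x) \<oplus>\<^bsub>M\<^esub> (x \<ominus>\<^bsub>M\<^esub> y) = z \<ominus>\<^bsub>M\<^esub> y" using x y z
      by (simp add: a_minus_def M.a_assoc M.r_neg1)
    finally show "z \<ominus>\<^bsub>M\<^esub> y \<in> N" .
  next
    assume "z \<ominus>\<^bsub>M\<^esub> y \<in> N"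
    moreover have "y \<ominus>\<^bsub>M\<^esub> x \<in> N"
      using submod_neg[OF N d] x y by (simp add: a_minus_def M.minus_add M.a_comm)
    ultimately have "(z \<ominus>\<^bsub>M\<^esub> y) \<oplus>\<^bsub>M\<^esub> (y \<ominus>\<^bsub>M\<^esub> x) \<in> N" by (rule submod_add[OF N])
    also have "(z \<ominus>\<^bsub>M\<^esub> y) \<oplus>\<^bsub>M\<^esub> (y \<ominus>\<^bsub>M\<^esub> x) = z \<ominus>\<^bsub>M\<^esub> x" using x y z
      by (simp add: a_minus_def M.a_assoc M.r_neg1)
    finally show "z \<ominus>\<^bsub>M\<^esub> x \<in> N" .
  qed
  then show "N +>\<^bsub>M\<^esub> x = N +>\<^bsub>M\<^esub> y"
    using coset_mem[OF N x] coset_mem[OF N y] coset_sub[OF N x] coset_sub[OF N y] by blast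
qed

lemma coset_add:
  assumes "submodule N R M" "x \<in> carrier M" "y \<in> carrier M"
  shows "set_add M (N +>\<^bsub>M\<^esub> x) (N +>\<^bsub>M\<^esub> y) = N +>\<^bsub>M\<^esub> (x \<oplus>\<^bsub>M\<^esub> y)"
  using normal.rcos_sum[OF submod_normal[OF assms(1)], of x y] assms(2,3)
  by (simp add: a_r_coset_def set_add_def)

text \<open>All cosets in the union coincide because \<open>N\<close> is closed under scalars; this
  is why the scalar multiplication of \<open>quotient_module\<close> is well defined.\<close>

lemma coset_smult:
  assumes N: "submodule N R M" and x: "x \<in> carrier M" and a: "a \<in> carrier R"
  shows "(\<Union>y\<in>N +>\<^bsub>M\<^esub> x. N +>\<^bsub>M\<^esub> (a \<odot>\<^bsub>M\<^esub> y)) = N +>\<^bsub>M\<^esub> (a \<odot>\<^bsub>M\<^esub> x)"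
proof -
  have "N +>\<^bsub>M\<^esub> (a \<odot>\<^bsub>M\<^esub> y) = N +>\<^bsub>M\<^esub> (a \<odot>\<^bsub>M\<^esub> x)" if "y \<in> N +>\<^bsub>M\<^esub> x" for y
  proof -
    have y: "y \<in> carrier M" "y \<ominus>\<^bsub>M\<^esub> x \<in> N" using that coset_sub[OF N x] coset_mem[OF N x] by auto
    have "a \<odot>\<^bsub>M\<^esub> y \<ominus>\<^bsub>M\<^esub> a \<odot>\<^bsub>M\<^esub> x = a \<odot>\<^bsub>M\<^esub> (y \<ominus>\<^bsub>M\<^esub> x)"
      using y x a by (simp add: a_minus_def smult_r_distr smult_r_minus)
    then show ?thesis using coset_eq[OF N] y x a submod_smult[OF N a y(2)] by simp
  qed
  then have "(\<Union>y\<in>N +>\<^bsub>M\<^esub> x. N +>\<^bsub>M\<^esub> (a \<odot>\<^bsub>M\<^esub> y)) = (\<Union>y\<in>N +>\<^bsub>M\<^esub> x. N +>\<^bsub>M\<^esub> (a \<odot>\<^bsub>M\<^esub> x))"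
    by (rule SUP_cong[OF refl])
  then show ?thesis using coset_self[OF N x] by force
qed

end

text \<open>The type of \<open>M\<close> is fixed to records without further fields, as
  \<open>quotient_module\<close> and \<open>module_length\<close> require.\<close>

locale plain_module = module R M for R :: "('a, 'm) ring_scheme" (structure) and M :: "('a, 'b) module"
begin

lemma quotient_carrier: "carrier (quotient_module M N) = (\<lambda>x. N +>\<^bsub>M\<^esub> x) ` carrier M"
  by (auto simp: quotient_module_def A_RCOSETS_def RCOSETS_def a_r_coset_def)

text \<open>Both records have the same carrier, operation and unit, and \<open>m_inv\<close> sees
  nothing else. This imports the inverses of factor groups.\<close>

lemma quotient_inv: "inv\<^bsub>add_monoid (quotient_module M N)\<^esub> c = inv\<^bsub>add_monoid M Mod N\<^esub> c"
  by (simp add: m_inv_def quotient_module_def FactGroup_def A_RCOSETS_def set_add_def)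

lemma coset_zero: "submodule N R M \<Longrightarrow> N +>\<^bsub>M\<^esub> \<zero>\<^bsub>M\<^esub> = N"
  using submod_carr by (force simp: a_r_coset_def r_coset_def)

lemma quotient_submodule_iff:
  assumes N: "submodule N R M"
  shows "submodule X R (quotient_module M N) \<longleftrightarrow>
    X \<subseteq> (\<lambda>x. N +>\<^bsub>M\<^esub> x) ` carrier M \<and> N \<in> X \<and>
    (\<forall>x\<in>carrier M. \<forall>y\<in>carrier M. N +>\<^bsub>M\<^esub> x \<in> X \<longrightarrow> N +>\<^bsub>M\<^esub> y \<in> X \<longrightarrow> N +>\<^bsub>M\<^esub> (x \<oplus>\<^bsub>M\<^esub> y) \<in> X) \<and>
    (\<forall>a\<in>carrier R. \<forall>x\<in>carrier M. N +>\<^bsub>M\<^esub> x \<in> X \<longrightarrow> N +>\<^bsub>M\<^esub> (a \<odot>\<^bsub>M\<^esub> x) \<in> X)" (is "_ \<longleftrightarrow> ?R")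
proof
  let ?Q = "quotient_module M N"
  assume X: "submodule X R ?Q"
  then have sg: "subgroup X (add_monoid ?Q)" by (simp add: submodule_def)
  have "X \<subseteq> carrier ?Q" using subgroup.subset[OF sg] by simp
  moreover have "N \<in> X" using subgroup.one_closed[OF sg] by (simp add: quotient_module_def)
  moreover have "N +>\<^bsub>M\<^esub> (x \<oplus>\<^bsub>M\<^esub> y) \<in> X"
    if "x \<in> carrier M" "y \<in> carrier M" "N +>\<^bsub>M\<^esub> x \<in> X" "N +>\<^bsub>M\<^esub> y \<in> X" for x y
    using subgroup.m_closed[OF sg that(3,4)] coset_add[OF N that(1,2)] by (simp add: quotient_module_def)
  moreover have "N +>\<^bsub>M\<^esub> (a \<odot>\<^bsub>M\<^esub> x) \<in> X" if "a \<in> carrier R" "x \<in> carrier M" "N +>\<^bsub>M\<^esub> x \<in> X" for a x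
    using submodule.smult_closed[OF X that(1,3)] coset_smult[OF N that(2,1)]
      by (simp add: quotient_module_def)
  ultimately show ?R unfolding quotient_carrier by blast
next
  let ?Q = "quotient_module M N"
  assume R: ?R
  have mono: "monoid.mult (add_monoid ?Q) = set_add M" by (simp add: quotient_module_def)
  have rep: "\<exists>x\<in>carrier M. c = N +>\<^bsub>M\<^esub> x" if "c \<in> X" for c using R that by auto
  show "submodule X R ?Q"
  proof (intro submodule.intro submodule_axioms.intro subgroup.intro)
    show "X \<subseteq> carrier (add_monoid ?Q)" using R quotient_carrier by simp
    show "\<one>\<^bsub>add_monoid ?Q\<^esub> \<in> X" using R by (simp add: quotient_module_def)
  next
    fix c d assume "c \<in> X" "d \<in> X"
    moreover then obtain x y where "x \<in> carrier M" "c = N +>\<^bsub>M\<^esub> x" "y \<in> carrier M" "d = N +>\<^bsub>M\<^esub> y" using rep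
      by metis
    ultimately show "c \<otimes>\<^bsub>add_monoid ?Q\<^esub> d \<in> X" unfolding mono using coset_add[OF N] R by auto
  next
    fix c assume c: "c \<in> X"
    then obtain x where x: "x \<in> carrier M" "c = N +>\<^bsub>M\<^esub> x" using rep by blast
    interpret nm: normal N "add_monoid M" by (rule submod_normal[OF N])
    have "c \<in> carrier (add_monoid M Mod N)" using x by (auto simp: FactGroup_def RCOSETS_def a_r_coset_def)
    then have "inv\<^bsub>add_monoid M Mod N\<^esub> c = set_inv\<^bsub>add_monoid M\<^esub> c" by (rule nm.inv_FactGroup)
    also have "\<dots> = N #>\<^bsub>add_monoid M\<^esub> (inv\<^bsub>add_monoid M\<^esub> x)" using nm.rcos_inv[of x] x
      by (simp add: a_r_coset_def)
    also have "\<dots> = N +>\<^bsub>M\<^esub> (\<ominus>\<^bsub>M\<^esub> x)" by (simp add: a_r_coset_def a_inv_def)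
    also have "\<ominus>\<^bsub>M\<^esub> x = (\<ominus> \<one>) \<odot>\<^bsub>M\<^esub> x" using smult_l_minus[of \<one> x] x by simp
    finally have "inv\<^bsub>add_monoid M Mod N\<^esub> c = N +>\<^bsub>M\<^esub> ((\<ominus> \<one>) \<odot>\<^bsub>M\<^esub> x)" .
    then show "inv\<^bsub>add_monoid ?Q\<^esub> c \<in> X" unfolding quotient_inv using R x c by auto
  next
    fix a c assume "a \<in> carrier R" "c \<in> X"
    moreover then obtain x where "x \<in> carrier M" "c = N +>\<^bsub>M\<^esub> x" using rep by blast
    ultimately show "a \<odot>\<^bsub>?Q\<^esub> c \<in> X" using coset_smult[OF N] R by (auto simp: quotient_module_def)
  qed
qed

text \<open>The correspondence theorem: preimage and image are strictly monotone between the
  submodules of the quotient and those of \<open>M\<close> above \<open>N\<close>. From here on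
  lengths of quotients are lengths of intervals.\<close>

lemma module_length_quotient:
  assumes N: "submodule N R M"
  shows "module_length R (quotient_module M N) = submods.len N (carrier M)"
proof (rule antisym)
  let ?Q = "quotient_module M N"
  show "module_length R ?Q \<le> submods.len N (carrier M)"
    unfolding module_length_def submods.len_def
  proof (rule chain_height_le_map[where f = "\<lambda>X. {x \<in> carrier M. N +>\<^bsub>M\<^esub> x \<in> X}"])
    fix X assume "X \<in> {X. submodule X R ?Q}"
    then have X: "N \<in> X" "\<And>x y. \<lbrakk>x \<in> carrier M; y \<in> carrier M; N +>\<^bsub>M\<^esub> x \<in> X; N +>\<^bsub>M\<^esub> y \<in> X\<rbrakk> \<Longrightarrow> N +>\<^bsub>M\<^esub> (x \<oplus>\<^bsub>M\<^esub> y) \<in> X"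
      "\<And>a x. \<lbrakk>a \<in> carrier R; x \<in> carrier M; N +>\<^bsub>M\<^esub> x \<in> X\<rbrakk> \<Longrightarrow> N +>\<^bsub>M\<^esub> (a \<odot>\<^bsub>M\<^esub> x) \<in> X"
      unfolding quotient_submodule_iff[OF N] by auto
    have "submodule {x \<in> carrier M. N +>\<^bsub>M\<^esub> x \<in> X} R M"
      by (rule submoduleI') (use X coset_zero[OF N] in auto)
    moreover have "N \<subseteq> {x \<in> carrier M. N +>\<^bsub>M\<^esub> x \<in> X}"
    proof
      fix x assume x: "x \<in> N"
      then have xc: "x \<in> carrier M" using submod_carr[OF N] by simp
      have "N +>\<^bsub>M\<^esub> x = N +>\<^bsub>M\<^esub> \<zero>\<^bsub>M\<^esub>" using coset_eq[OF N xc] x xc submod_diff[OF N x submod_zero[OF N]]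
        by simp
      then show "x \<in> {x \<in> carrier M. N +>\<^bsub>M\<^esub> x \<in> X}" using X(1) xc coset_zero[OF N] by simp
    qed
    ultimately show "{x \<in> carrier M. N +>\<^bsub>M\<^esub> x \<in> X} \<in> {Xa \<in> {N. submodule N R M}. N \<subseteq> Xa \<and> Xa \<subseteq> carrier M}"
      by auto
  next
    fix X Y assume "X \<in> {X. submodule X R ?Q}" "Y \<in> {X. submodule X R ?Q}" "X \<subset> Y"
    moreover then obtain c where "c \<in> Y" "c \<notin> X" by auto
    moreover then obtain x where "x \<in> carrier M" "c = N +>\<^bsub>M\<^esub> x"
      using \<open>Y \<in> _\<close> unfolding quotient_submodule_iff[OF N] by auto
    ultimately show "{x \<in> carrier M. N +>\<^bsub>M\<^esub> x \<in> X} \<subset> {x \<in> carrier M. N +>\<^bsub>M\<^esub> x \<in> Y}" by auto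
  qed
  show "submods.len N (carrier M) \<le> module_length R ?Q"
    unfolding module_length_def submods.len_def
  proof (rule chain_height_le_map[where f = "\<lambda>K. (\<lambda>x. N +>\<^bsub>M\<^esub> x) ` K"])
    have mem: "N +>\<^bsub>M\<^esub> x \<in> (\<lambda>x. N +>\<^bsub>M\<^esub> x) ` K \<longleftrightarrow> x \<in> K"
      if K: "submodule K R M" "N \<subseteq> K" and x: "x \<in> carrier M" for K x
    proof
      assume "N +>\<^bsub>M\<^esub> x \<in> (\<lambda>x. N +>\<^bsub>M\<^esub> x) ` K"
      then obtain y where y: "y \<in> K" "N +>\<^bsub>M\<^esub> x = N +>\<^bsub>M\<^esub> y" by auto
      have yc: "y \<in> carrier M" using submod_carr[OF K(1) y(1)] .
      have "x \<ominus>\<^bsub>M\<^esub> y \<in> K" using coset_eq[OF N x yc] y K by auto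
      then have "(x \<ominus>\<^bsub>M\<^esub> y) \<oplus>\<^bsub>M\<^esub> y \<in> K" using y submod_add[OF K(1)] by auto
      then show "x \<in> K" using x yc by (simp add: a_minus_def M.a_assoc M.l_neg)
    qed auto
    fix K assume "K \<in> {Xa \<in> {N. submodule N R M}. N \<subseteq> Xa \<and> Xa \<subseteq> carrier M}"
    then have K: "submodule K R M" "N \<subseteq> K" "K \<subseteq> carrier M" by auto
    have "N \<in> (\<lambda>x. N +>\<^bsub>M\<^esub> x) ` K" using mem[OF K(1,2), of "\<zero>\<^bsub>M\<^esub>"] submod_zero[OF K(1)] coset_zero[OF N]
      by simp
    then show "(\<lambda>x. N +>\<^bsub>M\<^esub> x) ` K \<in> {X. submodule X R ?Q}"
      unfolding quotient_submodule_iff[OF N] using mem[OF K(1,2)] K submod_add[OF K(1)] submod_smult[OF K(1)]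
        by auto
    fix K' assume "K' \<in> {Xa \<in> {N. submodule N R M}. N \<subseteq> Xa \<and> Xa \<subseteq> carrier M}" "K \<subset> K'"
    then have K': "submodule K' R M" "N \<subseteq> K'" "K' \<subseteq> carrier M" "K \<subset> K'" by auto
    then obtain x where "x \<in> K'" "x \<notin> K" by auto
    then have "N +>\<^bsub>M\<^esub> x \<notin> (\<lambda>x. N +>\<^bsub>M\<^esub> x) ` K" using mem[OF K(1,2)] K' by auto
    then show "(\<lambda>x. N +>\<^bsub>M\<^esub> x) ` K \<subset> (\<lambda>x. N +>\<^bsub>M\<^esub> x) ` K'" using \<open>x \<in> K'\<close> K'(4) by auto
  qed
qed

end

section \<open>The ring and its finite free modules as modules\<close>

context cring
begin

lemma ring_module_module: "module R (ring_module R)"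
  by (rule moduleI[OF is_cring], rule abelian_groupI)
    (auto simp: ideal_module_def a_ac l_distr r_distr m_assoc intro: exI[of _ "\<ominus> _"] bexI[of _ "\<ominus> _"] l_neg)

lemma ring_module_simps:
  "carrier (ideal_module R I) = I" "zero (ideal_module R I) = \<zero>" "add (ideal_module R I) = add R" "smult (ideal_module R I) = mult R"
  by (simp_all add: ideal_module_def)

lemma submodule_ring_module_iff: "submodule I R (ring_module R) \<longleftrightarrow> ideal I R"
proof
  interpret M: module R "ring_module R" by (rule ring_module_module)
  show "ideal I R" if "submodule I R (ring_module R)"
    by (rule idealI') (use M.submod_carr[OF that] M.submod_zero[OF that] M.submod_add[OF that] M.submod_smult[OF that] in
      \<open>auto simp: ring_module_simps\<close>)
  show "submodule I R (ring_module R)" if "ideal I R"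
    by (rule M.submoduleI') (use ideal_carr[OF that] ideal_zero[OF that] ideal_add[OF that] ideal_mult[OF that] in
      \<open>auto simp: ring_module_simps\<close>)
qed

lemma module_length_ring_quotient:
  assumes "ideal I R"
  shows "module_length R (quotient_module (ring_module R) I) = ilen I (carrier R)"
proof -
  interpret M: plain_module R "ring_module R" unfolding plain_module_def by (rule ring_module_module)
  show ?thesis using M.module_length_quotient[of I] assms
    by (simp add: submodule_ring_module_iff ring_module_simps)
qed

lemma free_module_simps:
  "carrier (free_module R n) = {..<n} \<rightarrow>\<^sub>E carrier R"
  "zero (free_module R n) = (\<lambda>i\<in>{..<n}. \<zero>)"
  "add (free_module R n) = (\<lambda>x y. \<lambda>i\<in>{..<n}. x i \<oplus> y i)"
  "smult (free_module R n) = (\<lambda>a x. \<lambda>i\<in>{..<n}. a \<otimes> x i)"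
  by (simp_all add: free_module_def)

lemma free_module_eqI:
  "\<lbrakk>x \<in> {..<n} \<rightarrow>\<^sub>E A; y \<in> {..<n} \<rightarrow>\<^sub>E B; \<And>i. i < n \<Longrightarrow> x i = y i\<rbrakk> \<Longrightarrow> x = y"
  by (rule extensionalityI[of _ "{..<n}"]) (auto simp: PiE_def)

lemma free_module_module: "module R (free_module R n)"
proof (rule moduleI[OF is_cring])
  show "abelian_group (free_module R n)"
  proof (rule abelian_groupI)
    fix x assume x: "x \<in> carrier (free_module R n)"
    show "\<exists>y\<in>carrier (free_module R n). y \<oplus>\<^bsub>free_module R n\<^esub> x = \<zero>\<^bsub>free_module R n\<^esub>"
      by (rule bexI[of _ "\<lambda>i\<in>{..<n}. \<ominus> x i"])
        (use x in \<open>auto simp: free_module_simps PiE_iff l_neg intro!: restrict_ext\<close>)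
    show "\<zero>\<^bsub>free_module R n\<^esub> \<oplus>\<^bsub>free_module R n\<^esub> x = x"
      by (rule free_module_eqI[of _ n "carrier R" _ "carrier R"]) (use x in \<open>auto simp: free_module_simps PiE_iff\<close>)
  qed (auto simp: free_module_simps PiE_iff a_ac intro!: restrict_ext)
  fix x assume x: "x \<in> carrier (free_module R n)"
  show "\<one> \<odot>\<^bsub>free_module R n\<^esub> x = x"
    by (rule free_module_eqI[of _ n "carrier R" _ "carrier R"]) (use x in \<open>auto simp: free_module_simps PiE_iff\<close>)
qed (auto simp: free_module_simps PiE_iff l_distr r_distr m_assoc intro!: restrict_ext)

end

section \<open>Numbers of generators and the multiplicity\<close>

context cring
begin

text \<open>The submodule \<open>X^n\<close> of \<open>R^n\<close>, also read as the polynomials of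
  degree below \<open>n\<close> with coefficients in \<open>X\<close>.\<close>

definition pw :: "nat \<Rightarrow> 'a set \<Rightarrow> (nat \<Rightarrow> 'a) set" where
  "pw n X = {..<n} \<rightarrow>\<^sub>E X"

text \<open>Written with the constant of the locale and not through an interpretation, so that free
  modules of different ranks can occur in one inequality.\<close>

abbreviation flen :: "nat \<Rightarrow> (nat \<Rightarrow> 'a) set \<Rightarrow> (nat \<Rightarrow> 'a) set \<Rightarrow> enat" where
  "flen n \<equiv> modular_family.len {N. submodule N R (free_module R n)}"

lemma pw_mono: "X \<subseteq> Y \<Longrightarrow> pw n X \<subseteq> pw n Y"
  by (auto simp: pw_def PiE_iff)

lemma free_submoduleI:
  assumes "K \<subseteq> {..<n} \<rightarrow>\<^sub>E carrier R" "(\<lambda>i\<in>{..<n}. \<zero>) \<in> K"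
    and "\<And>x y. \<lbrakk>x \<in> K; y \<in> K\<rbrakk> \<Longrightarrow> (\<lambda>i\<in>{..<n}. x i \<oplus> y i) \<in> K"
    and "\<And>r x. \<lbrakk>r \<in> carrier R; x \<in> K\<rbrakk> \<Longrightarrow> (\<lambda>i\<in>{..<n}. r \<otimes> x i) \<in> K"
  shows "submodule K R (free_module R n)"
proof -
  interpret F: module R "free_module R n" by (rule free_module_module)
  show ?thesis by (rule F.submoduleI') (use assms in \<open>auto simp: free_module_simps\<close>)
qed

lemma free_submoduleD:
  assumes "submodule K R (free_module R n)"
  shows "K \<subseteq> {..<n} \<rightarrow>\<^sub>E carrier R" "(\<lambda>i\<in>{..<n}. \<zero>) \<in> K"
    and "\<And>x y. \<lbrakk>x \<in> K; y \<in> K\<rbrakk> \<Longrightarrow> (\<lambda>i\<in>{..<n}. x i \<oplus> y i) \<in> K"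
    and "\<And>r x. \<lbrakk>r \<in> carrier R; x \<in> K\<rbrakk> \<Longrightarrow> (\<lambda>i\<in>{..<n}. r \<otimes> x i) \<in> K"
proof -
  interpret F: module R "free_module R n" by (rule free_module_module)
  show "K \<subseteq> {..<n} \<rightarrow>\<^sub>E carrier R" "(\<lambda>i\<in>{..<n}. \<zero>) \<in> K"
    "\<And>x y. \<lbrakk>x \<in> K; y \<in> K\<rbrakk> \<Longrightarrow> (\<lambda>i\<in>{..<n}. x i \<oplus> y i) \<in> K"
    "\<And>r x. \<lbrakk>r \<in> carrier R; x \<in> K\<rbrakk> \<Longrightarrow> (\<lambda>i\<in>{..<n}. r \<otimes> x i) \<in> K"
    using F.submod_carr[OF assms] F.submod_zero[OF assms] F.submod_add[OF assms] F.submod_smult[OF assms]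
    by (auto simp: free_module_simps)
qed

lemma pw_submodule: "ideal X R \<Longrightarrow> submodule (pw n X) R (free_module R n)"
  by (rule free_submoduleI)
    (use ideal_carr[of X] ideal_zero[of X] ideal_add[of X] ideal_mult[of X] in \<open>auto simp: pw_def PiE_iff\<close>)

lemma free_len_additive:
  assumes "submodule B R (free_module R n)" "submodule D R (free_module R n)" "submodule C R (free_module R n)" "B \<subseteq> D" "D \<subseteq> C"
  shows "flen n B C = flen n B D + flen n D C"
proof -
  interpret F: module R "free_module R n" by (rule free_module_module)
  show ?thesis by (rule F.submods.len_additive) (use assms in auto)
qed

lemma flen_mono: "\<lbrakk>B' \<subseteq> B; C \<subseteq> C'\<rbrakk> \<Longrightarrow> flen n B C \<le> flen n B' C'"
proof -
  assume *: "B' \<subseteq> B" "C \<subseteq> C'"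
  interpret F: module R "free_module R n" by (rule free_module_module)
  show ?thesis by (rule F.submods.len_mono) (use * in auto)
qed

lemma flen_def: "flen n B C = chain_height {X \<in> {N. submodule N R (free_module R n)}. B \<subseteq> X \<and> X \<subseteq> C}"
proof -
  interpret F: module R "free_module R n" by (rule free_module_module)
  show ?thesis by (rule F.submods.len_def)
qed

lemma flen_pw:
  assumes X: "ideal X R" and Y: "ideal Y R" and XY: "X \<subseteq> Y"
  shows "flen n (pw n X) (pw n Y) = of_nat n * ilen X Y"
proof -
  \<comment> \<open>The filtration from \<open>X^n\<close> to \<open>Y^n\<close> that frees one
    coordinate at a time; the \<open>i\<close>-th coordinate identifies each successive quotient
    with \<open>Y / X\<close>.\<close>
  define P where "P i = {x \<in> {..<n} \<rightarrow>\<^sub>E Y. \<forall>j. i \<le> j \<and> j < n \<longrightarrow> x j \<in> X}" for i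
  note Xf = ideal_carr[OF X] ideal_zero[OF X] ideal_add[OF X] ideal_mult[OF X]
  note Yf = ideal_carr[OF Y] ideal_zero[OF Y] ideal_add[OF Y] ideal_mult[OF Y]
  have P: "submodule (P i) R (free_module R n)" for i
    by (rule free_submoduleI) (use Xf Yf in \<open>auto simp: P_def PiE_iff extensional_def\<close>)
  have PS: "P i \<subseteq> P (Suc i)" for i by (auto simp: P_def)
  have P0: "P 0 = pw n X" using XY by (auto simp: P_def pw_def PiE_iff extensional_def)
  have "(\<forall>j. n \<le> j \<and> j < n \<longrightarrow> x j \<in> X) = True" for x :: "nat \<Rightarrow> 'a" by auto
  then have Pn: "P n = pw n Y" unfolding P_def pw_def by simp
  have step: "flen n (P i) (P (Suc i)) = ilen X Y" if i: "i < n" for i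
  proof (rule antisym)
    define \<delta> where "\<delta> z = (\<lambda>j\<in>{..<n}. if j = i then z else \<zero>)" for z
    have \<delta>P: "\<delta> z \<in> P (Suc i)" if "z \<in> Y" for z using that Xf(2) Yf(2) by (auto simp: P_def \<delta>_def PiE_iff)
    have \<delta>P0: "\<delta> z \<in> P i" if "z \<in> X" for z using that Xf(2) Yf(2) XY by (auto simp: P_def \<delta>_def PiE_iff)
    have \<delta>i: "\<delta> z i = z" for z using i by (simp add: \<delta>_def)
    show "flen n (P i) (P (Suc i)) \<le> ilen X Y"
      unfolding flen_def ideals.len_def
    proof (rule chain_height_le_map[where f = "\<lambda>K. (\<lambda>x. x i) ` K"])
      fix K assume "K \<in> {Xa \<in> {N. submodule N R (free_module R n)}. P i \<subseteq> Xa \<and> Xa \<subseteq> P (Suc i)}"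
      then have K: "submodule K R (free_module R n)" "P i \<subseteq> K" "K \<subseteq> P (Suc i)" by auto
      note Kf = free_submoduleD[OF K(1)]
      have KY: "x i \<in> Y" if "x \<in> K" for x using that K(3) i by (auto simp: P_def PiE_iff)
      have "ideal ((\<lambda>x. x i) ` K) R"
      proof (rule idealI')
        show "\<zero> \<in> (\<lambda>x. x i) ` K" using Kf(2) i by (intro image_eqI) auto
        fix u v assume "u \<in> (\<lambda>x. x i) ` K" "v \<in> (\<lambda>x. x i) ` K"
        then obtain x y where "x \<in> K" "y \<in> K" "u = x i" "v = y i" by auto
        then show "u \<oplus> v \<in> (\<lambda>x. x i) ` K" using Kf(3)[of x y] i
          by (intro image_eqI[where x = "\<lambda>j\<in>{..<n}. x j \<oplus> y j"]) auto
      next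
        fix r u assume r: "r \<in> carrier R" and "u \<in> (\<lambda>x. x i) ` K"
        then obtain x where "x \<in> K" "u = x i" by auto
        then show "r \<otimes> u \<in> (\<lambda>x. x i) ` K" using Kf(4)[OF r, of x] i
          by (intro image_eqI[where x = "\<lambda>j\<in>{..<n}. r \<otimes> x j"]) auto
      qed (use KY Yf in auto)
      moreover have "X \<subseteq> (\<lambda>x. x i) ` K"
      proof
        fix z assume "z \<in> X"
        then show "z \<in> (\<lambda>x. x i) ` K" using \<delta>P0 K(2) \<delta>i[of z] by (intro image_eqI[where x = "\<delta> z"]) auto
      qed
      ultimately show "(\<lambda>x. x i) ` K \<in> {Xa \<in> {I. ideal I R}. X \<subseteq> Xa \<and> Xa \<subseteq> Y}" using KY by auto
      fix K' assume "K' \<in> {Xa \<in> {N. submodule N R (free_module R n)}. P i \<subseteq> Xa \<and> Xa \<subseteq> P (Suc i)}" "K \<subset> K'"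
      then have K': "submodule K' R (free_module R n)" "K' \<subseteq> P (Suc i)" "K \<subset> K'" by auto
      then obtain x where x: "x \<in> K'" "x \<notin> K" by auto
      have "x i \<notin> (\<lambda>x. x i) ` K"
      proof
        assume "x i \<in> (\<lambda>x. x i) ` K"
        then obtain y where y: "y \<in> K" "x i = y i" by auto
        have xy: "x \<in> P (Suc i)" "y \<in> P (Suc i)" using x y K' by auto
        then have xyY: "\<And>j. j < n \<Longrightarrow> x j \<in> Y \<and> y j \<in> Y" by (auto simp: P_def PiE_iff)
        then have xyc: "\<And>j. j < n \<Longrightarrow> x j \<in> carrier R \<and> y j \<in> carrier R" using Yf by auto
        \<comment> \<open>The vectors \<open>x\<close> and \<open>y\<close> agree at position
          \<open>i\<close>, and beyond it both have entries in \<open>X\<close>. Their difference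
          thus lies in \<open>P i\<close>, which is part of \<open>K\<close>.\<close>
        define d where "d = (\<lambda>j\<in>{..<n}. x j \<ominus> y j)"
        have "d j \<in> X" if "i \<le> j" "j < n" for j
        proof (cases "j = i")
          case True
          then show ?thesis using y xyc[of i] that Xf(2) by (simp add: d_def a_minus_def r_neg)
        next
          case False
          then have "x j \<in> X" "y j \<in> X" using xy that by (auto simp: P_def)
          then show ?thesis using that ideal_diff[OF X] by (simp add: d_def)
        qed
        moreover have "d \<in> {..<n} \<rightarrow>\<^sub>E Y" using xyY ideal_diff[OF Y] by (auto simp: d_def)
        ultimately have "d \<in> K" using K(2) by (auto simp: P_def)
        then have "(\<lambda>j\<in>{..<n}. d j \<oplus> y j) \<in> K" using y Kf(3) by auto
        also have "(\<lambda>j\<in>{..<n}. d j \<oplus> y j) = x"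
        proof (rule free_module_eqI[of _ n UNIV _ Y])
          show "x \<in> {..<n} \<rightarrow>\<^sub>E Y" using xy by (auto simp: P_def)
          fix j assume "j < n"
          then show "(\<lambda>j\<in>{..<n}. d j \<oplus> y j) j = x j" using xyc[of j]
            by (simp add: d_def a_minus_def a_assoc l_neg)
        qed auto
        finally show False using x by simp
      qed
      then show "(\<lambda>x. x i) ` K \<subset> (\<lambda>x. x i) ` K'" using x K'(3) by blast
    qed
    show "ilen X Y \<le> flen n (P i) (P (Suc i))"
      unfolding flen_def ideals.len_def
    proof (rule chain_height_le_map[where f = "\<lambda>Z. {x \<in> P (Suc i). x i \<in> Z}"])
      fix Z assume "Z \<in> {Xa \<in> {I. ideal I R}. X \<subseteq> Xa \<and> Xa \<subseteq> Y}"
      then have Z: "ideal Z R" "X \<subseteq> Z" "Z \<subseteq> Y" by auto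
      note PSf = free_submoduleD[OF P[of "Suc i"]]
      have "submodule {x \<in> P (Suc i). x i \<in> Z} R (free_module R n)"
        by (rule free_submoduleI) (use PSf i ideal_zero[OF Z(1)] ideal_add[OF Z(1)] ideal_mult[OF Z(1)] in auto)
      moreover have "P i \<subseteq> {x \<in> P (Suc i). x i \<in> Z}" using Z i by (auto simp: P_def)
      ultimately show "{x \<in> P (Suc i). x i \<in> Z} \<in> {Xa \<in> {N. submodule N R (free_module R n)}. P i \<subseteq> Xa \<and> Xa \<subseteq> P (Suc i)}"
        by auto
      fix Z' assume Z': "Z' \<in> {Xa \<in> {I. ideal I R}. X \<subseteq> Xa \<and> Xa \<subseteq> Y}" "Z \<subset> Z'"
      then obtain z where z: "z \<in> Z'" "z \<notin> Z" by auto
      then have "z \<in> Y" using Z' by auto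
      then have "\<delta> z \<in> P (Suc i)" by (rule \<delta>P)
      then have "\<delta> z \<in> {x \<in> P (Suc i). x i \<in> Z'}" "\<delta> z \<notin> {x \<in> P (Suc i). x i \<in> Z}" using z \<delta>i by auto
      then show "{x \<in> P (Suc i). x i \<in> Z} \<subset> {x \<in> P (Suc i). x i \<in> Z'}" using Z'(2) by blast
    qed
  qed
  have "flen n (P 0) (P i) = of_nat i * ilen X Y" if "i \<le> n" for i
    using that
  proof (induction i)
    case 0
    interpret F: module R "free_module R n" by (rule free_module_module)
    show ?case using F.submods.len_self by simp
  next
    case (Suc i)
    have "P 0 \<subseteq> P i" by (auto simp: P_def)
    then have "flen n (P 0) (P (Suc i)) = flen n (P 0) (P i) + flen n (P i) (P (Suc i))"
      by (intro free_len_additive P PS)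
    then show ?case using Suc step[of i] by (simp add: algebra_simps)
  qed
  from this[OF order_refl] show ?thesis by (simp add: P0 Pn)
qed

section \<open>Multiplication by a fixed polynomial as a linear map of free modules\<close>

lemma conv_add_right:
  assumes "\<And>i. f i \<in> carrier R" "\<And>i. h i \<in> carrier R" "\<And>i. h' i \<in> carrier R"
  shows "conv f (\<lambda>j. h j \<oplus> h' j) p = conv f h p \<oplus> conv f h' p"
  unfolding conv_def using assms by (subst finsum_addf[symmetric]) (auto intro!: finsum_cong' simp: r_distr)

text \<open>Multiplication by the polynomial with coefficients \<open>a 0, \<dots>, a (g - 1)\<close>, as a linear map from
  polynomials of degree \<open>< N\<close> to polynomials of degree \<open>< N + g\<close>.\<close>

definition zext :: "nat \<Rightarrow> (nat \<Rightarrow> 'a) \<Rightarrow> nat \<Rightarrow> 'a" where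
  "zext N h = (\<lambda>j. if j < N then h j else \<zero>)"

definition polymult :: "(nat \<Rightarrow> 'a) \<Rightarrow> nat \<Rightarrow> nat \<Rightarrow> (nat \<Rightarrow> 'a) \<Rightarrow> nat \<Rightarrow> 'a" where
  "polymult a g N h = (\<lambda>p\<in>{..<N + g}. conv a (zext N h) p)"

lemma zext_carr: "h \<in> {..<N} \<rightarrow>\<^sub>E carrier R \<Longrightarrow> zext N h j \<in> carrier R"
  by (auto simp: zext_def)

lemma conv_in_ideal:
  assumes "ideal K R" "\<And>i j. f i \<otimes> h j \<in> K"
  shows "conv f h p \<in> K"
  unfolding conv_def using assms by (intro ideal_finsum) auto

lemma polymult_image_submodule:
  assumes a: "\<And>i. a i \<in> carrier R" and K: "submodule K R (free_module R N)"
  shows "submodule (polymult a g N ` K) R (free_module R (N + g))"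
proof -
  note Kf = free_submoduleD[OF K]
  have zc: "\<And>h j. h \<in> K \<Longrightarrow> zext N h j \<in> carrier R" using Kf(1) zext_carr by blast
  show ?thesis
  proof (rule free_submoduleI)
    show "polymult a g N ` K \<subseteq> {..<N + g} \<rightarrow>\<^sub>E carrier R"
      using conv_closed[OF a zc] by (auto simp: polymult_def extensional_def PiE_iff split: if_splits)
    have "zext N (\<lambda>i\<in>{..<N}. \<zero>) = (\<lambda>_. \<zero>)" by (auto simp: zext_def)
    moreover have "conv a (\<lambda>_. \<zero>) p = \<zero>" for p unfolding conv_def using a by (intro add.finprod_one_eqI) auto
    ultimately have "polymult a g N (\<lambda>i\<in>{..<N}. \<zero>) = (\<lambda>i\<in>{..<N + g}. \<zero>)" by (simp add: polymult_def)
    then show "(\<lambda>i\<in>{..<N + g}. \<zero>) \<in> polymult a g N ` K" using imageI[OF Kf(2), of "polymult a g N"] by simp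
  next
    fix x y assume "x \<in> polymult a g N ` K" "y \<in> polymult a g N ` K"
    then obtain h h' where h: "h \<in> K" "h' \<in> K" "x = polymult a g N h" "y = polymult a g N h'" by auto
    have "zext N (\<lambda>i\<in>{..<N}. h i \<oplus> h' i) = (\<lambda>j. zext N h j \<oplus> zext N h' j)" by (auto simp: zext_def)
    then have "polymult a g N (\<lambda>i\<in>{..<N}. h i \<oplus> h' i) = (\<lambda>i\<in>{..<N + g}. x i \<oplus> y i)"
      unfolding h polymult_def using a zc[OF h(1)] zc[OF h(2)]
        by (intro restrict_ext) (simp add: conv_add_right)
    then show "(\<lambda>i\<in>{..<N + g}. x i \<oplus> y i) \<in> polymult a g N ` K"
      using imageI[OF Kf(3)[OF h(1,2)], of "polymult a g N"] by simp
  next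
    fix r x assume r: "r \<in> carrier R" and "x \<in> polymult a g N ` K"
    then obtain h where h: "h \<in> K" "x = polymult a g N h" by auto
    have "zext N (\<lambda>i\<in>{..<N}. r \<otimes> h i) = (\<lambda>j. r \<otimes> zext N h j)" using r by (auto simp: zext_def)
    then have "polymult a g N (\<lambda>i\<in>{..<N}. r \<otimes> h i) = (\<lambda>i\<in>{..<N + g}. r \<otimes> x i)"
      unfolding h polymult_def using a zc[OF h(1)] r by (intro restrict_ext) (simp add: conv_scale_right)
    then show "(\<lambda>i\<in>{..<N + g}. r \<otimes> x i) \<in> polymult a g N ` K"
      using imageI[OF Kf(4)[OF r h(1)], of "polymult a g N"] by simp
  qed
qed

lemma polymult_diff:
  assumes a: "\<And>i. a i \<in> carrier R" and h: "h \<in> {..<N} \<rightarrow>\<^sub>E carrier R" "h' \<in> {..<N} \<rightarrow>\<^sub>E carrier R"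
    and p: "p < N + g"
  shows "conv a (zext N (\<lambda>i\<in>{..<N}. h i \<ominus> h' i)) p \<oplus> polymult a g N h' p = polymult a g N h p"
proof -
  let ?d = "\<lambda>i\<in>{..<N}. h i \<ominus> h' i"
  have d: "?d \<in> {..<N} \<rightarrow>\<^sub>E carrier R" using h by auto
  have "zext N h j = zext N ?d j \<oplus> zext N h' j" for j
    using h by (auto simp: zext_def PiE_iff a_minus_def a_assoc l_neg)
  then have "zext N h = (\<lambda>j. zext N ?d j \<oplus> zext N h' j)" by auto
  then show ?thesis
    using conv_add_right[where p = p, OF a zext_carr[OF d] zext_carr[OF h(2)]] p by (simp add: polymult_def)
qed

end

section \<open>Numbers of generators and the growth of lengths\<close>

context cm_local_one
begin

text \<open>Multiplication by the polynomial \<open>z\<close> whose coefficients generate \<open>\<mm>\<close> is a map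
  \<open>J\<^sup>N \<rightarrow> J\<^bsup>N+g\<^esup>\<close> with image in \<open>(\<mm> J)\<^bsup>N+g\<^esup>\<close>. By the Dedekind--Mertens lemma it induces an injection
  \<open>(J / \<mm>\<^sup>s J)\<^sup>N \<rightarrow> (J / \<mm>\<^bsup>s+1\<^esup> J)\<^bsup>N+g\<^esup>\<close> for large \<open>s\<close>. Compare lengths and let \<open>N \<rightarrow> \<infinity>\<close>.\<close>

lemma generators_bounded_by_hilbert:
  obtains n0 where "\<And>s J u. \<lbrakk>s \<ge> n0; ideal J R; mp u \<subseteq> J\<rbrakk> \<Longrightarrow> ilen (\<mm> \<cdot> J) J \<le> ilen (mp (Suc s) \<cdot> J) (mp s \<cdot> J)"
proof -
  obtain n0 where rr: "\<And>s J x N. \<lbrakk>s \<ge> n0; ideal J R; x \<in> carrier R; \<And>y. y \<in> mp N \<Longrightarrow> y \<otimes> x \<in> mp (N + s) \<cdot> J\<rbrakk>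
    \<Longrightarrow> x \<in> mp s \<cdot> J" using ratliff_rush by metis
  obtain A where A: "finite A" "A \<subseteq> \<mm>" "\<mm> = Idl A" using ideal_fin_gen[OF \<mm>_ideal] by auto
  obtain g and a0 :: "nat \<Rightarrow> 'a" where a0: "A = a0 ` {i. i < g}" using finite_imp_nat_seg_image_inj_on[OF A(1)]
    by metis
  define a where "a i = (if i < g then a0 i else \<zero>)" for i
  have aA: "a ` {..<g} = A" unfolding a0 a_def by (auto intro!: image_eqI)
  have am: "a i \<in> \<mm>" for i using A(2) ideal_zero[OF \<mm>_ideal] unfolding a0 a_def by auto
  have ac: "a i \<in> carrier R" for i using am \<mm>_carr by auto
  have "ilen (\<mm> \<cdot> J) J \<le> ilen (mp (Suc s) \<cdot> J) (mp s \<cdot> J)" if s: "s \<ge> n0" and J: "ideal J R"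
    and u: "mp u \<subseteq> J" for s J u
  proof -
    let ?L = "mp (Suc s) \<cdot> J" and ?L' = "mp s \<cdot> J" and ?mJ = "\<mm> \<cdot> J"
    have ids: "ideal ?L R" "ideal ?L' R" "ideal ?mJ R"
      using mp_ideal[of s] mp_ideal[of "Suc s"] \<mm>_ideal J by (auto intro: ideal_prod_is_ideal)
    have Leq: "?L = \<mm> \<cdot> ?L'" by (rule ipow_prod_Suc[OF J])
    have LL': "?L \<subseteq> ?L'" unfolding Leq by (rule ideal_prod_sub2[OF \<mm>_ideal ids(2)])
    have L'J: "?L' \<subseteq> J" by (rule ideal_prod_sub2[OF mp_ideal J])
    have LmJ: "?L \<subseteq> ?mJ" unfolding Leq using L'J by (intro ideal_prod_mono) auto
    have mJJ: "?mJ \<subseteq> J" by (rule ideal_prod_sub2[OF \<mm>_ideal J])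
    \<comment> \<open>Dedekind-Mertens multiplies a coefficient of \<open>h\<close> by
      \<open>\<mm>^N\<close> into \<open>\<mm>^(N-1) \<mm>^(s+1) J = \<mm>^(N+s) J\<close>, which is
      exactly the hypothesis of \<open>ratliff_rush\<close>.\<close>
    have inj: "h \<in> pw N ?L'" if h: "h \<in> pw N J" and z: "\<And>p. p < N + g \<Longrightarrow> conv a (zext N h) p \<in> ?L" for N h
    proof -
      have hc: "h \<in> {..<N} \<rightarrow>\<^sub>E carrier R" using h ideal_sub[OF J] by (auto simp: pw_def PiE_iff)
      have cv: "conv a (zext N h) p \<in> ?L" for p
      proof (cases "p < N + g")
        case True then show ?thesis by (rule z)
      next
        case False
        have "conv a (zext N h) p = \<zero>" unfolding conv_def
        proof (rule add.finprod_one_eqI)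
          fix i assume "i \<in> {..p}"
          then show "a i \<otimes> zext N h (p - i) = \<zero>" using False ac[of i] zext_carr[OF hc, of "p - i"]
            by (cases "i < g") (auto simp: a_def zext_def)
        qed
        then show ?thesis using ideal_zero[OF ids(1)] by simp
      qed
      have "zext N h j \<in> ?L'" for j
      \<comment> \<open>The case \<open>N = 0\<close> is separated because the exponent
        \<open>N - 1\<close> would be truncated; the polynomial is then zero.\<close>
      proof (cases "N = 0")
        case True then show ?thesis using ideal_zero[OF ids(2)] by (simp add: zext_def)
      next
        case False
        show ?thesis
        proof (rule rr[OF s J zext_carr[OF hc]])
          fix y assume "y \<in> mp N"
          then have y: "y \<in> ipow (Idl (a ` {..<g})) N" unfolding aA using A(3) by simp
          have "y \<otimes> zext N h j \<in> ipow (Idl (a ` {..<g})) (N - 1) \<cdot> ?L"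
            by (rule dedekind_mertens[OF ac _ zext_carr[OF hc] _ ids(1) cv y]) (auto simp: a_def zext_def)
          also have "ipow (Idl (a ` {..<g})) (N - 1) \<cdot> ?L = (mp (N - 1) \<cdot> mp (Suc s)) \<cdot> J"
            unfolding aA A(3)[symmetric] by (rule ideal_prod_assoc[symmetric, OF mp_ideal mp_ideal J])
          also have "mp (N - 1) \<cdot> mp (Suc s) = mp (N + s)" using mp_add[of "N - 1" "Suc s"] False by simp
          finally show "y \<otimes> zext N h j \<in> mp (N + s) \<cdot> J" .
        qed
      qed
      then have "h j \<in> ?L'" if "j < N" for j using that by (metis zext_def)
      then show ?thesis using hc by (auto simp: pw_def PiE_iff)
    qed
    \<comment> \<open>Let \<open>T = z J^N + L^(N+g)\<close>. By injectivity the first summand is at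
      most the length of \<open>T / L^(N+g)\<close>. The second is at most that of
      \<open>J^(N+g) / T\<close>, because \<open>T\<close> lies in
      \<open>(\<mm> J)^(N+g)\<close>.\<close>
    have key: "of_nat N * ilen ?L' J + of_nat (N + g) * ilen ?mJ J \<le> of_nat (N + g) * ilen ?L J" for N
    proof -
      let ?n = "N + g"
      interpret F: module R "free_module R ?n" by (rule free_module_module)
      interpret FN: module R "free_module R N" by (rule free_module_module)
      let ?Z = "polymult a g N"
      let ?T = "set_add (free_module R ?n) (?Z ` pw N J) (pw ?n ?L)"
      have Lp: "submodule (pw ?n ?L) R (free_module R ?n)" and Jp: "submodule (pw ?n J) R (free_module R ?n)"
        and mJp: "submodule (pw ?n ?mJ) R (free_module R ?n)" and JN: "submodule (pw N J) R (free_module R N)"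
        using ids J by (auto intro: pw_submodule)
      have ZJ: "submodule (?Z ` pw N J) R (free_module R ?n)" using polymult_image_submodule[of a, OF ac JN] .
      have T: "submodule ?T R (free_module R ?n)" using ZJ Lp by (rule F.submod_sum)
      have ZmJ: "?Z ` pw N J \<subseteq> pw ?n ?mJ"
      proof
        fix x assume "x \<in> ?Z ` pw N J"
        then obtain h where h: "h \<in> pw N J" "x = ?Z h" by auto
        have "conv a (zext N h) p \<in> ?mJ" for p
          by (rule conv_in_ideal[OF ids(3)]) (use h am ideal_zero[OF J] in \<open>auto simp: zext_def pw_def intro!: ideal_prod.prod\<close>)
        then show "x \<in> pw ?n ?mJ" unfolding h polymult_def by (auto simp: pw_def)
      qed
      have TmJ: "?T \<subseteq> pw ?n ?mJ" using ZmJ pw_mono[OF LmJ] by (intro F.submod_sum_least[OF mJp])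
      have TJ: "?T \<subseteq> pw ?n J" using TmJ pw_mono[OF mJJ] by blast
      have LT: "pw ?n ?L \<subseteq> ?T" by (rule F.submod_sum_upper2[OF ZJ Lp])
      have "flen N (pw N ?L') (pw N J) \<le> flen ?n (pw ?n ?L) ?T"
        unfolding flen_def
      proof (rule chain_height_le_map[where f = "\<lambda>K. set_add (free_module R ?n) (?Z ` K) (pw ?n ?L)"])
        fix K assume "K \<in> {X \<in> {N'. submodule N' R (free_module R N)}. pw N ?L' \<subseteq> X \<and> X \<subseteq> pw N J}"
        then have K: "submodule K R (free_module R N)" "pw N ?L' \<subseteq> K" "K \<subseteq> pw N J" by auto
        have ZK: "submodule (?Z ` K) R (free_module R ?n)" using polymult_image_submodule[of a, OF ac K(1)] .
        have "set_add (free_module R ?n) (?Z ` K) (pw ?n ?L) \<subseteq> ?T"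
          using F.submod_sum_upper1[OF ZJ Lp] K(3) LT by (intro F.submod_sum_least[OF T]) auto
        then show "set_add (free_module R ?n) (?Z ` K) (pw ?n ?L) \<in> {X \<in> {N. submodule N R (free_module R ?n)}. pw ?n ?L \<subseteq> X \<and> X \<subseteq> ?T}"
          using F.submod_sum[OF ZK Lp] F.submod_sum_upper2[OF ZK Lp] by auto
        fix K' assume "K' \<in> {X \<in> {N'. submodule N' R (free_module R N)}. pw N ?L' \<subseteq> X \<and> X \<subseteq> pw N J}" "K \<subset> K'"
        then have K': "submodule K' R (free_module R N)" "K' \<subseteq> pw N J" "K \<subset> K'" by auto
        have ZK': "submodule (?Z ` K') R (free_module R ?n)"
          using polymult_image_submodule[of a, OF ac K'(1)] .
        obtain x where x: "x \<in> K'" "x \<notin> K" using K' by auto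
        have "?Z x \<notin> set_add (free_module R ?n) (?Z ` K) (pw ?n ?L)"
        proof
          assume "?Z x \<in> set_add (free_module R ?n) (?Z ` K) (pw ?n ?L)"
          then obtain y l where yl: "y \<in> K" "l \<in> pw ?n ?L" "?Z x = (\<lambda>i\<in>{..<?n}. ?Z y i \<oplus> l i)"
            unfolding F.mem_msum free_module_simps by auto
          have xy: "x \<in> {..<N} \<rightarrow>\<^sub>E J" "y \<in> {..<N} \<rightarrow>\<^sub>E J" using x yl K K' by (auto simp: pw_def)
          then have xyc: "x \<in> {..<N} \<rightarrow>\<^sub>E carrier R" "y \<in> {..<N} \<rightarrow>\<^sub>E carrier R" using ideal_sub[OF J]
            by (auto simp: PiE_iff)
          define d where "d = (\<lambda>i\<in>{..<N}. x i \<ominus> y i)"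
          have dJ: "d \<in> pw N J" using xy ideal_diff[OF J] by (auto simp: pw_def d_def PiE_iff)
          then have dc: "d \<in> {..<N} \<rightarrow>\<^sub>E carrier R" using ideal_sub[OF J] by (auto simp: pw_def PiE_iff)
          have "conv a (zext N d) p \<in> ?L" if p: "p < ?n" for p
          proof -
            have c: "conv a (zext N d) p \<in> carrier R" "?Z y p \<in> carrier R" "l p \<in> carrier R"
              using conv_closed[OF ac zext_carr[OF dc]] conv_closed[OF ac zext_carr[OF xyc(2)]] yl(2) p ideal_sub[OF ids(1)]
              by (auto simp: polymult_def pw_def PiE_iff)
            have "conv a (zext N d) p \<oplus> ?Z y p = ?Z x p" unfolding d_def by (rule polymult_diff[OF ac xyc p])
            also have "\<dots> = l p \<oplus> ?Z y p" using yl(3) p c by (simp add: a_comm)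
            finally have "conv a (zext N d) p = l p" using c by simp
            then show ?thesis using yl(2) p by (auto simp: pw_def)
          qed
          then have "d \<in> pw N ?L'" by (rule inj[OF dJ])
          then have "(\<lambda>j\<in>{..<N}. d j \<oplus> y j) \<in> K" using K(2) yl(1) free_submoduleD(3)[OF K(1)] by blast
          also have "(\<lambda>j\<in>{..<N}. d j \<oplus> y j) = x"
          proof (rule free_module_eqI[of _ N UNIV _ "carrier R"])
            fix j assume "j < N"
            then show "(\<lambda>j\<in>{..<N}. d j \<oplus> y j) j = x j" using xyc
              by (simp add: d_def PiE_iff a_minus_def a_assoc l_neg)
          qed (use xyc in auto)
          finally show False using x by simp
        qed
        moreover have "?Z x \<in> set_add (free_module R ?n) (?Z ` K') (pw ?n ?L)"
          using F.submod_sum_upper1[OF ZK' Lp] x by auto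
        moreover have "set_add (free_module R ?n) (?Z ` K) (pw ?n ?L) \<subseteq> set_add (free_module R ?n) (?Z ` K') (pw ?n ?L)"
          using F.submod_sum_upper1[OF ZK' Lp] F.submod_sum_upper2[OF ZK' Lp] K'(3)
            by (intro F.submod_sum_least[OF F.submod_sum[OF ZK' Lp]]) auto
        ultimately show "set_add (free_module R ?n) (?Z ` K) (pw ?n ?L) \<subset> set_add (free_module R ?n) (?Z ` K') (pw ?n ?L)"
          by blast
      qed
      then have 1: "of_nat N * ilen ?L' J \<le> flen ?n (pw ?n ?L) ?T" using flen_pw[OF ids(2) J L'J, of N]
        by simp
      have "flen ?n (pw ?n ?mJ) (pw ?n J) \<le> flen ?n ?T (pw ?n J)" using TmJ by (intro flen_mono) auto
      then have 2: "of_nat ?n * ilen ?mJ J \<le> flen ?n ?T (pw ?n J)" using flen_pw[OF ids(3) J mJJ, of ?n]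
        by simp
      have "flen ?n (pw ?n ?L) (pw ?n J) = flen ?n (pw ?n ?L) ?T + flen ?n ?T (pw ?n J)"
        by (intro free_len_additive Lp T Jp LT TJ)
      then have "of_nat ?n * ilen ?L J = flen ?n (pw ?n ?L) ?T + flen ?n ?T (pw ?n J)"
        using flen_pw[OF ids(1) J, of ?n] LL' L'J by auto
      then show ?thesis using add_mono[OF 1 2] by simp
    qed
    have LJ: "ilen ?L J = ilen ?L ?L' + ilen ?L' J" using ids J LL' L'J by (intro ilen_add) auto
    have "ilen ?L J \<noteq> \<infinity>" by (rule ilen_ipow_prod_finite[OF J])
    then have fin: "ilen ?L ?L' \<noteq> \<infinity>" "ilen ?L' J \<noteq> \<infinity>" unfolding LJ by (auto simp: plus_eq_infty_iff_enat)
    have "ilen ?mJ J \<noteq> \<infinity>" by (rule ilen_\<mm>_prod_finite[OF J])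
    then obtain q where q: "ilen ?mJ J = enat q" by auto
    obtain h Q where hQ: "ilen ?L ?L' = enat h" "ilen ?L' J = enat Q" using fin by auto
    have k: "N * Q + (N + g) * q \<le> (N + g) * (h + Q)" for N
      using key[of N] unfolding LJ hQ q by (simp add: of_nat_eq_enat)
    \<comment> \<open>The inequality amounts to \<open>(N + g) * (q - h) \<le> g * Q\<close> for
      every \<open>N\<close>. If \<open>q > h\<close>, it fails at
      \<open>N = g * Q + 1\<close>.\<close>
    have "q \<le> h"
    proof (rule ccontr)
      assume "\<not> q \<le> h"
      then have "(N + g) * (h + 1) \<le> (N + g) * q" for N by (intro mult_le_mono) auto
      then have "N * Q + (N + g) * (h + 1) \<le> (N + g) * (h + Q)" for N using k[of N]
        by (meson add_left_mono order_trans)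
      from this[of "g * Q + 1"] show False by (simp add: algebra_simps)
    qed
    then show ?thesis unfolding hQ q by simp
  qed
  then show ?thesis using that by blast
qed

text \<open>The values are bounded, so a maximum is attained at some \<open>k\<close>. For
  \<open>J = \<mm>^k\<close> the comparison of generators says that no later value, from
  \<open>n0 + k\<close> on, is smaller. Hence \<open>e\<close> is both the eventual and the largest
  value.\<close>

lemma hilb_eventually_const:
  obtains e n1 where "\<And>n. n \<ge> n1 \<Longrightarrow> hilb n = enat e" "\<And>n. hilb n \<le> enat e"
proof -
  obtain N where N: "\<And>n. hilb n \<le> enat N" using hilb_bounded ilen_PIdl_b_finite by (metis not_infinity_eq)
  have bd: "the_enat (hilb n) < N + 1" for n using N[of n] by (cases "hilb n") auto
  have "\<exists>k. \<forall>n. the_enat (hilb n) \<le> the_enat (hilb k)"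
    using ex_has_greatest_nat[of "\<lambda>_. True" 0 "\<lambda>n. the_enat (hilb n)" "N + 1"] bd by auto
  then obtain k where k: "\<And>n. the_enat (hilb n) \<le> the_enat (hilb k)" by blast
  define e where "e = the_enat (hilb k)"
  have he: "hilb n = enat (the_enat (hilb n))" for n using N[of n] by (cases "hilb n") auto
  have le: "hilb n \<le> enat e" for n using k[of n] he[of n] unfolding e_def by (metis enat_ord_simps(1))
  obtain n0
    where n0: "\<And>s J u. \<lbrakk>s \<ge> n0; ideal J R; mp u \<subseteq> J\<rbrakk> \<Longrightarrow> ilen (\<mm> \<cdot> J) J \<le> ilen (mp (Suc s) \<cdot> J) (mp s \<cdot> J)"
    using generators_bounded_by_hilbert by metis
  have "hilb k \<le> hilb n" if "n \<ge> n0 + k" for n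
  proof -
    have "ilen (\<mm> \<cdot> mp k) (mp k) \<le> ilen (mp (Suc (n - k)) \<cdot> mp k) (mp (n - k) \<cdot> mp k)"
      using that by (intro n0[OF _ mp_ideal order_refl]) simp
    moreover have "\<mm> \<cdot> mp k = mp (Suc k)" by (simp add: ideal_prod_commute mp_ideal \<mm>_ideal)
    moreover have "mp (Suc (n - k)) \<cdot> mp k = mp (Suc n)" "mp (n - k) \<cdot> mp k = mp n"
      using mp_add[of "Suc (n - k)" k] mp_add[of "n - k" k] that by auto
    ultimately show ?thesis by (simp add: hilb_def del: Group.nat_pow_Suc)
  qed
  then have "hilb n = enat e" if "n \<ge> n0 + k" for n using le[of n] that he[of k] unfolding e_def
    by (metis antisym)
  then show ?thesis using that le by blast
qed

text \<open>The multiplicity as a natural number, ready for arithmetic in \<open>enat\<close>;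
  \<open>hs_multiplicity_eq\<close> identifies it with the limit.\<close>

definition mult_e :: nat where
  "mult_e = (THE e. \<exists>n1. \<forall>n\<ge>n1. hilb n = enat e)"

lemma mult_e: "\<exists>n1. \<forall>n\<ge>n1. hilb n = enat mult_e" "hilb n \<le> enat mult_e"
proof -
  obtain e n1 where e: "\<And>n. n \<ge> n1 \<Longrightarrow> hilb n = enat e" "\<And>n. hilb n \<le> enat e" using hilb_eventually_const
    by metis
  have "mult_e = e" unfolding mult_e_def
  proof (rule the_equality)
    show "\<exists>n1. \<forall>n\<ge>n1. hilb n = enat e" using e by blast
    fix e' assume "\<exists>n1. \<forall>n\<ge>n1. hilb n = enat e'"
    then obtain n2 where "\<And>n. n \<ge> n2 \<Longrightarrow> hilb n = enat e'" by blast
    then show "e' = e" using e(1)[of "max n1 n2"] by (metis enat.inject max.cobounded1 max.cobounded2)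
  qed
  then show "\<exists>n1. \<forall>n\<ge>n1. hilb n = enat mult_e" "hilb n \<le> enat mult_e" using e by blast+
qed

lemma ilen_mp_Suc: "ilen (mp (Suc n)) (carrier R) = hilb n + ilen (mp n) (carrier R)"
  unfolding hilb_def by (intro ilen_add mp_ideal oneideal mp_antimono mp_sub) simp

lemma ilen_mp_le: "ilen (mp n) (carrier R) \<le> enat (n * mult_e)"
proof (induction n)
  case 0 then show ?case using ideals.len_self by (simp add: zero_enat_def)
next
  case (Suc n)
  then show ?case using ilen_mp_Suc[of n] add_mono[OF mult_e(2)[of n] Suc] by (simp del: Group.nat_pow_Suc)
qed

lemma ilen_mp_eventually:
  obtains c n1 where "\<And>n. ilen (mp (n1 + n)) (carrier R) = enat (c + n * mult_e)"
proof -
  obtain n1 where n1: "\<And>n. n \<ge> n1 \<Longrightarrow> hilb n = enat mult_e" using mult_e(1) by blast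
  have "ilen (mp n1) (carrier R) \<noteq> \<infinity>" using ilen_mp_le[of n1] by (cases "ilen (mp n1) (carrier R)") auto
  then obtain c where c: "ilen (mp n1) (carrier R) = enat c" by auto
  have "ilen (mp (n1 + n)) (carrier R) = enat (c + n * mult_e)" for n
  proof (induction n)
    case (Suc n)
    then show ?case using ilen_mp_Suc[of "n1 + n"] n1[of "n1 + n"]
      by (simp add: ac_simps del: Group.nat_pow_Suc)
  qed (simp add: c)
  then show ?thesis using that by blast
qed

text \<open>From \<open>n0\<close> on, each further factor \<open>\<mm>\<close> adds at least
  \<open>q\<close>, the number of generators of \<open>J\<close>, to the length of
  \<open>J / \<mm>^s J\<close>. On the other hand \<open>\<mm>^(s+u)\<close> lies in
  \<open>\<mm>^s J\<close>, so this length is at most \<open>(s + u) * mult_e\<close>. Growth in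
  \<open>s\<close> forces \<open>q \<le> mult_e\<close>.\<close>

lemma generators_le_mult:
  assumes J: "ideal J R" and u: "mp u \<subseteq> J"
  shows "ilen (\<mm> \<cdot> J) J \<le> enat mult_e"
proof -
  obtain n0
    where n0: "\<And>s J u. \<lbrakk>s \<ge> n0; ideal J R; mp u \<subseteq> J\<rbrakk> \<Longrightarrow> ilen (\<mm> \<cdot> J) J \<le> ilen (mp (Suc s) \<cdot> J) (mp s \<cdot> J)"
    using generators_bounded_by_hilbert by metis
  have "ilen (\<mm> \<cdot> J) J \<noteq> \<infinity>" by (rule ilen_\<mm>_prod_finite[OF J])
  then obtain q where q: "ilen (\<mm> \<cdot> J) J = enat q" by auto
  have mJ: "ideal (mp n \<cdot> J) R" for n using mp_ideal J by (rule ideal_prod_is_ideal)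
  have lower: "enat (k * q) \<le> ilen (mp (n0 + k) \<cdot> J) J" for k
  proof (induction k)
    case 0 then show ?case by (simp add: zero_enat_def[symmetric])
  next
    case (Suc k)
    have "enat q \<le> ilen (mp (Suc (n0 + k)) \<cdot> J) (mp (n0 + k) \<cdot> J)" using n0[OF _ J u, of "n0 + k"] q by simp
    then have "enat (Suc k * q) \<le> ilen (mp (Suc (n0 + k)) \<cdot> J) (mp (n0 + k) \<cdot> J) + ilen (mp (n0 + k) \<cdot> J) J"
      using add_mono[OF _ Suc] by fastforce
    also have "\<dots> = ilen (mp (Suc (n0 + k)) \<cdot> J) J"
      by (intro ilen_add[symmetric] mJ J ideal_prod_sub2[OF mp_ideal J] ideal_prod_mono mp_antimono) auto
    finally show ?case by simp
  qed
  have "k * q \<le> (n0 + k + u) * mult_e" for k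
  proof -
    have "mp (n0 + k + u) \<subseteq> mp (n0 + k) \<cdot> J" unfolding mp_add[of "n0 + k" u] using u
      by (intro ideal_prod_mono) auto
    then have "ilen (mp (n0 + k) \<cdot> J) J \<le> ilen (mp (n0 + k + u)) (carrier R)" using ideal_sub[OF J]
      by (rule ideals.len_mono)
    then have "enat (k * q) \<le> enat ((n0 + k + u) * mult_e)" using lower[of k] ilen_mp_le[of "n0 + k + u"]
      by (meson order_trans)
    then show ?thesis by simp
  qed
  note k = this
  have "q \<le> mult_e"
  proof (rule ccontr)
    assume "\<not> q \<le> mult_e"
    then have "k * (mult_e + 1) \<le> k * q" for k by (intro mult_le_mono) auto
    then have "k * (mult_e + 1) \<le> (n0 + k + u) * mult_e" for k using k[of k] by (meson order_trans)
    from this[of "(n0 + u) * mult_e + 1"] show False by (simp add: algebra_simps)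
  qed
  then show ?thesis using q by simp
qed

text \<open>From some \<open>n1\<close> on the length of \<open>R / \<mm>^n\<close> is an affine
  function of \<open>n\<close> with slope \<open>mult_e\<close>; in dimension one the limit is this
  slope.\<close>

lemma hs_multiplicity_eq:
  assumes "krull_dim R = 1"
  shows "hs_multiplicity R = ereal (real mult_e)"
proof -
  obtain c n1 where c: "\<And>n. ilen (mp (n1 + n)) (carrier R) = enat (c + n * mult_e)" using ilen_mp_eventually
    by metis
  have d: "the_enat (krull_dim R) = 1" using assms by (simp add: one_enat_def)
  define F where "F n = ereal (fact 1) * ereal_of_enat (module_length R (quotient_module (ring_module R) (max_ideal R [^]\<^bsub>ideals_set R\<^esub> n))) / ereal (real n ^ 1)" for n
  have F: "F n = ereal_of_enat (ilen (mp n) (carrier R)) / ereal (real n)" for n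
    unfolding F_def using module_length_ring_quotient[OF mp_ideal] max_ideal_eq by simp
  have "(\<lambda>n. ((real c - real n1 * real mult_e) / real n) + real mult_e) \<longlonglongrightarrow> 0 + real mult_e"
    by (intro tendsto_add tendsto_const lim_const_over_n)
  then have "(\<lambda>n. ereal (((real c - real n1 * real mult_e) / real n) + real mult_e)) \<longlonglongrightarrow> ereal (real mult_e)"
    by simp
  moreover have "\<forall>\<^sub>F n in sequentially. ereal (((real c - real n1 * real mult_e) / real n) + real mult_e) = F n"
    unfolding eventually_sequentially
  proof (intro exI[of _ "n1 + 1"] allI impI)
    fix n assume n: "n1 + 1 \<le> n"
    have "ilen (mp n) (carrier R) = enat (c + (n - n1) * mult_e)" using c[of "n - n1"] n by simp
    then have "F n = ereal ((real c + (real n - real n1) * real mult_e) / real n)" using n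
      by (simp add: F of_nat_diff)
    also have "(real c + (real n - real n1) * real mult_e) / real n = ((real c - real n1 * real mult_e) / real n) + real mult_e"
      using n by (simp add: field_simps)
    finally show "ereal (((real c - real n1 * real mult_e) / real n) + real mult_e) = F n" by simp
  qed
  ultimately have "F \<longlonglongrightarrow> ereal (real mult_e)" by (rule Lim_transform_eventually)
  then show ?thesis unfolding hs_multiplicity_def Let_def d F_def[symmetric] by (rule limI)
qed

end

section \<open>Linear maps and free resolutions\<close>

context plain_module
begin

lemma quotient_module_module:
  assumes N: "submodule N R M"
  shows "module R (quotient_module M N)"
proof -
  let ?Q = "quotient_module M N"
  have rep: "\<exists>x\<in>carrier M. c = N +>\<^bsub>M\<^esub> x" if "c \<in> carrier ?Q" for c using that quotient_carrier by auto
  have s: "add ?Q = set_add M" "zero ?Q = N" "\<And>a x. x \<in> carrier M \<Longrightarrow> a \<in> carrier R \<Longrightarrow> a \<odot>\<^bsub>?Q\<^esub> (N +>\<^bsub>M\<^esub> x) = N +>\<^bsub>M\<^esub> (a \<odot>\<^bsub>M\<^esub> x)"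
    using coset_smult[OF N] by (auto simp: quotient_module_def)
  have cl: "N +>\<^bsub>M\<^esub> x \<in> carrier ?Q" if "x \<in> carrier M" for x using that quotient_carrier by auto
  show ?thesis
  proof (rule moduleI[OF R.is_cring])
    show "abelian_group ?Q"
    proof (rule abelian_groupI)
      fix c assume "c \<in> carrier ?Q"
      then obtain x where x: "x \<in> carrier M" "c = N +>\<^bsub>M\<^esub> x" using rep by blast
      have "set_add M (N +>\<^bsub>M\<^esub> \<zero>\<^bsub>M\<^esub>) c = c" unfolding x(2) using coset_add[OF N M.zero_closed x(1)] x by simp
      then show "\<zero>\<^bsub>?Q\<^esub> \<oplus>\<^bsub>?Q\<^esub> c = c" unfolding s coset_zero[OF N] .
      have "set_add M (N +>\<^bsub>M\<^esub> (\<ominus>\<^bsub>M\<^esub> x)) c = N" unfolding x(2)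
        using coset_add[OF N _ x(1), of "\<ominus>\<^bsub>M\<^esub> x"] x coset_zero[OF N] by (simp add: M.l_neg)
      then show "\<exists>y\<in>carrier ?Q. y \<oplus>\<^bsub>?Q\<^esub> c = \<zero>\<^bsub>?Q\<^esub>" unfolding s using cl[of "\<ominus>\<^bsub>M\<^esub> x"] x by auto
      fix d assume "d \<in> carrier ?Q"
      then obtain y where y: "y \<in> carrier M" "d = N +>\<^bsub>M\<^esub> y" using rep by blast
      show "c \<oplus>\<^bsub>?Q\<^esub> d \<in> carrier ?Q" unfolding s x(2) y(2) using coset_add[OF N x(1) y(1)] cl x y by simp
      show "c \<oplus>\<^bsub>?Q\<^esub> d = d \<oplus>\<^bsub>?Q\<^esub> c" unfolding s x(2) y(2)
        using coset_add[OF N x(1) y(1)] coset_add[OF N y(1) x(1)] x y by (simp add: M.a_comm)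
      fix e assume "e \<in> carrier ?Q"
      then obtain z where z: "z \<in> carrier M" "e = N +>\<^bsub>M\<^esub> z" using rep by blast
      show "c \<oplus>\<^bsub>?Q\<^esub> d \<oplus>\<^bsub>?Q\<^esub> e = c \<oplus>\<^bsub>?Q\<^esub> (d \<oplus>\<^bsub>?Q\<^esub> e)"
        unfolding s x(2) y(2) z(2) using x y z by (simp add: coset_add[OF N] M.a_assoc)
    next
      show "\<zero>\<^bsub>?Q\<^esub> \<in> carrier ?Q" unfolding s using cl[of "\<zero>\<^bsub>M\<^esub>"] coset_zero[OF N] by simp
    qed
  next
    fix a c assume a: "a \<in> carrier R" and "c \<in> carrier ?Q"
    then obtain x where x: "x \<in> carrier M" "c = N +>\<^bsub>M\<^esub> x" using rep by blast
    show "a \<odot>\<^bsub>?Q\<^esub> c \<in> carrier ?Q" unfolding x(2) using s(3)[OF x(1) a] cl x a by simp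
    fix b assume b: "b \<in> carrier R"
    show "(a \<oplus> b) \<odot>\<^bsub>?Q\<^esub> c = (a \<odot>\<^bsub>?Q\<^esub> c) \<oplus>\<^bsub>?Q\<^esub> (b \<odot>\<^bsub>?Q\<^esub> c)"
      unfolding x(2) using x a b by (simp add: s(3) smult_l_distr) (simp add: s(1) coset_add[OF N])
    show "(a \<otimes> b) \<odot>\<^bsub>?Q\<^esub> c = a \<odot>\<^bsub>?Q\<^esub> (b \<odot>\<^bsub>?Q\<^esub> c)"
      unfolding x(2) using x a b by (simp add: s(3) smult_assoc1)
  next
    fix a c d assume a: "a \<in> carrier R" and "c \<in> carrier ?Q" "d \<in> carrier ?Q"
    then obtain x y where x: "x \<in> carrier M" "c = N +>\<^bsub>M\<^esub> x" and y: "y \<in> carrier M" "d = N +>\<^bsub>M\<^esub> y" using rep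
      by blast
    have "a \<odot>\<^bsub>?Q\<^esub> (c \<oplus>\<^bsub>?Q\<^esub> d) = a \<odot>\<^bsub>?Q\<^esub> (N +>\<^bsub>M\<^esub> (x \<oplus>\<^bsub>M\<^esub> y))" unfolding x(2) y(2) s(1) using x y
      by (simp add: coset_add[OF N])
    also have "\<dots> = N +>\<^bsub>M\<^esub> (a \<odot>\<^bsub>M\<^esub> x \<oplus>\<^bsub>M\<^esub> a \<odot>\<^bsub>M\<^esub> y)" using a x y by (simp add: s(3) smult_r_distr)
    also have "\<dots> = (a \<odot>\<^bsub>?Q\<^esub> c) \<oplus>\<^bsub>?Q\<^esub> (a \<odot>\<^bsub>?Q\<^esub> d)" unfolding x(2) y(2) s(1) using a x y
      by (simp add: s(3) coset_add[OF N])
    finally show "a \<odot>\<^bsub>?Q\<^esub> (c \<oplus>\<^bsub>?Q\<^esub> d) = (a \<odot>\<^bsub>?Q\<^esub> c) \<oplus>\<^bsub>?Q\<^esub> (a \<odot>\<^bsub>?Q\<^esub> d)" .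
  next
    fix c assume "c \<in> carrier ?Q"
    then obtain x where x: "x \<in> carrier M" "c = N +>\<^bsub>M\<^esub> x" using rep by blast
    show "\<one> \<odot>\<^bsub>?Q\<^esub> c = c" unfolding x(2) using x by (simp add: s(3))
  qed
qed

end

locale linear_map = M: plain_module R M + N: plain_module R N
  for R :: "('a, 'm) ring_scheme" (structure) and M :: "('a, 'b) module" and N :: "('a, 'c) module" +
  fixes f assumes f_hom: "f \<in> module_homs R M N"
begin

lemma closed: "x \<in> carrier M \<Longrightarrow> f x \<in> carrier N"
  using f_hom by (auto simp: module_homs_def PiE_iff)

lemma add: "\<lbrakk>x \<in> carrier M; y \<in> carrier M\<rbrakk> \<Longrightarrow> f (x \<oplus>\<^bsub>M\<^esub> y) = f x \<oplus>\<^bsub>N\<^esub> f y"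
  using f_hom by (auto simp: module_homs_def)

lemma smult: "\<lbrakk>a \<in> carrier R; x \<in> carrier M\<rbrakk> \<Longrightarrow> f (a \<odot>\<^bsub>M\<^esub> x) = a \<odot>\<^bsub>N\<^esub> f x"
  using f_hom by (auto simp: module_homs_def)

lemma zero: "f \<zero>\<^bsub>M\<^esub> = \<zero>\<^bsub>N\<^esub>"
  using smult[of \<zero> "\<zero>\<^bsub>M\<^esub>"] closed[of "\<zero>\<^bsub>M\<^esub>"] by simp

lemma neg: "x \<in> carrier M \<Longrightarrow> f (\<ominus>\<^bsub>M\<^esub> x) = \<ominus>\<^bsub>N\<^esub> f x"
  using smult[of "\<ominus> \<one>" x] closed[of x] M.smult_l_minus[of \<one> x] N.smult_l_minus[of \<one> "f x"] by simp

lemma diff: "\<lbrakk>x \<in> carrier M; y \<in> carrier M\<rbrakk> \<Longrightarrow> f (x \<ominus>\<^bsub>M\<^esub> y) = f x \<ominus>\<^bsub>N\<^esub> f y"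
  by (simp add: a_minus_def add neg)

lemma kernel_submodule: "submodule {x \<in> carrier M. f x = \<zero>\<^bsub>N\<^esub>} R M"
  by (rule M.submoduleI') (auto simp: add smult zero)

lemma image_submodule:
  assumes K: "submodule K R M" shows "submodule (f ` K) R N"
proof (rule N.submoduleI')
  note c = M.submod_carr[OF K]
  show "f ` K \<subseteq> carrier N" using c closed by auto
  show "\<zero>\<^bsub>N\<^esub> \<in> f ` K" using M.submod_zero[OF K] zero by (metis image_eqI)
  fix a b assume "a \<in> f ` K" "b \<in> f ` K"
  then obtain x y where "x \<in> K" "y \<in> K" "a = f x" "b = f y" by auto
  then show "a \<oplus>\<^bsub>N\<^esub> b \<in> f ` K" using c add M.submod_add[OF K] by (intro image_eqI[of _ _ "x \<oplus>\<^bsub>M\<^esub> y"]) auto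
next
  note c = M.submod_carr[OF K]
  fix r a assume "r \<in> carrier R" "a \<in> f ` K"
  then obtain x where "x \<in> K" "a = f x" by auto
  then show "r \<odot>\<^bsub>N\<^esub> a \<in> f ` K" using c smult M.submod_smult[OF K] \<open>r \<in> carrier R\<close>
    by (intro image_eqI[of _ _ "r \<odot>\<^bsub>M\<^esub> x"]) auto
qed

end

lemma module_homsI:
  assumes "\<And>x. x \<in> carrier M \<Longrightarrow> f x \<in> carrier N"
    and "\<And>x y. \<lbrakk>x \<in> carrier M; y \<in> carrier M\<rbrakk> \<Longrightarrow> x \<oplus>\<^bsub>M\<^esub> y \<in> carrier M"
    and "\<And>a x. \<lbrakk>a \<in> carrier R; x \<in> carrier M\<rbrakk> \<Longrightarrow> a \<odot>\<^bsub>M\<^esub> x \<in> carrier M"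
    and "\<And>x y. \<lbrakk>x \<in> carrier M; y \<in> carrier M\<rbrakk> \<Longrightarrow> f (x \<oplus>\<^bsub>M\<^esub> y) = f x \<oplus>\<^bsub>N\<^esub> f y"
    and "\<And>a x. \<lbrakk>a \<in> carrier R; x \<in> carrier M\<rbrakk> \<Longrightarrow> f (a \<odot>\<^bsub>M\<^esub> x) = a \<odot>\<^bsub>N\<^esub> f x"
  shows "(\<lambda>x\<in>carrier M. f x) \<in> module_homs R M N"
  using assms by (auto simp: module_homs_def)

section \<open>Homomorphisms from free modules\<close>

context cring
begin

definition basis :: "nat \<Rightarrow> nat \<Rightarrow> nat \<Rightarrow> 'a" where
  "basis n i = (\<lambda>j\<in>{..<n}. if j = i then \<one> else \<zero>)"

lemma basis_carr: "basis n i \<in> carrier (free_module R n)"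
  by (auto simp: basis_def free_module_simps)

lemma free_plain: "plain_module R (free_module R n)"
  unfolding plain_module_def by (rule free_module_module)

lemma ring_plain: "plain_module R (ring_module R)"
  unfolding plain_module_def by (rule ring_module_module)

lemma hom_expand:
  assumes N: "plain_module R N" and f: "f \<in> module_homs R (free_module R n) N"
    and x: "x \<in> carrier (free_module R n)"
  shows "f x = (\<Oplus>\<^bsub>N\<^esub>i\<in>{..<n}. x i \<odot>\<^bsub>N\<^esub> f (basis n i))"
proof -
  interpret N: plain_module R N by fact
  interpret F: plain_module R "free_module R n" by (rule free_plain)
  interpret f: linear_map R "free_module R n" N f by unfold_locales (rule f)
  \<comment> \<open>Truncations of \<open>x\<close> to its first \<open>m\<close> coordinates, for
    an induction that adds one basis vector at a time.\<close>
  define tr where "tr m = (\<lambda>j\<in>{..<n}. if j < m then x j else \<zero>)" for m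
  have xc: "\<And>j. j < n \<Longrightarrow> x j \<in> carrier R" using x by (auto simp: free_module_simps)
  have trc: "tr m \<in> carrier (free_module R n)" for m using xc by (auto simp: tr_def free_module_simps)
  have bc: "f (basis n i) \<in> carrier N" for i by (rule f.closed[OF basis_carr])
  have "f (tr m) = (\<Oplus>\<^bsub>N\<^esub>i\<in>{..<m}. x i \<odot>\<^bsub>N\<^esub> f (basis n i))" if "m \<le> n" for m
    using that
  proof (induction m)
    case 0
    have "tr 0 = \<zero>\<^bsub>free_module R n\<^esub>" by (auto simp: tr_def free_module_simps)
    then show ?case using f.zero by simp
  next
    case (Suc m)
    then have m: "m < n" by simp
    have "tr (Suc m) = tr m \<oplus>\<^bsub>free_module R n\<^esub> (x m \<odot>\<^bsub>free_module R n\<^esub> basis n m)"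
      using xc xc[OF m] by (auto simp: tr_def basis_def free_module_simps less_Suc_eq intro!: restrict_ext)
    then have "f (tr (Suc m)) = f (tr m) \<oplus>\<^bsub>N\<^esub> x m \<odot>\<^bsub>N\<^esub> f (basis n m)"
      using trc basis_carr xc[OF m] F.smult_closed by (simp add: f.add f.smult)
    also have "\<dots> = (\<Oplus>\<^bsub>N\<^esub>i\<in>{..<Suc m}. x i \<odot>\<^bsub>N\<^esub> f (basis n i))"
    proof -
      have "(\<Oplus>\<^bsub>N\<^esub>i\<in>insert m {..<m}. x i \<odot>\<^bsub>N\<^esub> f (basis n i)) = x m \<odot>\<^bsub>N\<^esub> f (basis n m) \<oplus>\<^bsub>N\<^esub> (\<Oplus>\<^bsub>N\<^esub>i\<in>{..<m}. x i \<odot>\<^bsub>N\<^esub> f (basis n i))"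
        using bc xc m by (intro N.finsum_insert) auto
      moreover have "(\<Oplus>\<^bsub>N\<^esub>i\<in>{..<m}. x i \<odot>\<^bsub>N\<^esub> f (basis n i)) \<in> carrier N" using bc xc m
        by (intro N.finsum_closed) auto
      ultimately show ?thesis using Suc bc[of m] xc[OF m] by (simp add: lessThan_Suc N.a_comm)
    qed
    finally show ?case .
  qed
  moreover have "tr n = x"
    by (rule free_module_eqI[of _ n UNIV _ "carrier R"]) (use x in \<open>auto simp: tr_def free_module_simps\<close>)
  ultimately show ?thesis by (metis order_refl)
qed

lemma hom_of_basis:
  assumes N: "plain_module R N" and v: "\<And>i. i < n \<Longrightarrow> v i \<in> carrier N"
  defines "f \<equiv> \<lambda>x\<in>carrier (free_module R n). \<Oplus>\<^bsub>N\<^esub>i\<in>{..<n}. x i \<odot>\<^bsub>N\<^esub> v i"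
  shows "f \<in> module_homs R (free_module R n) N" and "\<And>i. i < n \<Longrightarrow> f (basis n i) = v i"
proof -
  interpret N: plain_module R N by fact
  interpret F: plain_module R "free_module R n" by (rule free_plain)
  show "f \<in> module_homs R (free_module R n) N" unfolding f_def
  proof (rule module_homsI)
    fix x y assume x: "x \<in> carrier (free_module R n)" and y: "y \<in> carrier (free_module R n)"
    have "(\<Oplus>\<^bsub>N\<^esub>i\<in>{..<n}. (x \<oplus>\<^bsub>free_module R n\<^esub> y) i \<odot>\<^bsub>N\<^esub> v i) = (\<Oplus>\<^bsub>N\<^esub>i\<in>{..<n}. x i \<odot>\<^bsub>N\<^esub> v i \<oplus>\<^bsub>N\<^esub> y i \<odot>\<^bsub>N\<^esub> v i)"
      using x y v by (intro N.finsum_cong') (auto simp: free_module_simps PiE_iff N.smult_l_distr)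
    also have "\<dots> = (\<Oplus>\<^bsub>N\<^esub>i\<in>{..<n}. x i \<odot>\<^bsub>N\<^esub> v i) \<oplus>\<^bsub>N\<^esub> (\<Oplus>\<^bsub>N\<^esub>i\<in>{..<n}. y i \<odot>\<^bsub>N\<^esub> v i)"
      using x y v by (intro N.finsum_addf) (auto simp: free_module_simps PiE_iff)
    finally show "(\<Oplus>\<^bsub>N\<^esub>i\<in>{..<n}. (x \<oplus>\<^bsub>free_module R n\<^esub> y) i \<odot>\<^bsub>N\<^esub> v i) = (\<Oplus>\<^bsub>N\<^esub>i\<in>{..<n}. x i \<odot>\<^bsub>N\<^esub> v i) \<oplus>\<^bsub>N\<^esub> (\<Oplus>\<^bsub>N\<^esub>i\<in>{..<n}. y i \<odot>\<^bsub>N\<^esub> v i)" .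
  next
    fix a x assume a: "a \<in> carrier R" and x: "x \<in> carrier (free_module R n)"
    have "a \<odot>\<^bsub>N\<^esub> (\<Oplus>\<^bsub>N\<^esub>i\<in>{..<n}. x i \<odot>\<^bsub>N\<^esub> v i) = (\<Oplus>\<^bsub>N\<^esub>i\<in>{..<n}. a \<odot>\<^bsub>N\<^esub> (x i \<odot>\<^bsub>N\<^esub> v i))"
      using x v a by (intro N.finsum_smult_ldistr) (auto simp: free_module_simps PiE_iff)
    also have "\<dots> = (\<Oplus>\<^bsub>N\<^esub>i\<in>{..<n}. (a \<odot>\<^bsub>free_module R n\<^esub> x) i \<odot>\<^bsub>N\<^esub> v i)"
      using x v a by (intro N.finsum_cong') (auto simp: free_module_simps PiE_iff N.smult_assoc1)
    finally show "(\<Oplus>\<^bsub>N\<^esub>i\<in>{..<n}. (a \<odot>\<^bsub>free_module R n\<^esub> x) i \<odot>\<^bsub>N\<^esub> v i) = a \<odot>\<^bsub>N\<^esub> (\<Oplus>\<^bsub>N\<^esub>i\<in>{..<n}. x i \<odot>\<^bsub>N\<^esub> v i)"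
      by simp
  next
    fix x assume "x \<in> carrier (free_module R n)"
    then show "(\<Oplus>\<^bsub>N\<^esub>i\<in>{..<n}. x i \<odot>\<^bsub>N\<^esub> v i) \<in> carrier N" using v
      by (intro N.finsum_closed) (auto simp: free_module_simps PiE_iff)
  qed auto
  fix i assume i: "i < n"
  have "f (basis n i) = (\<Oplus>\<^bsub>N\<^esub>j\<in>{..<n}. basis n i j \<odot>\<^bsub>N\<^esub> v j)" using basis_carr by (simp add: f_def)
  also have "\<dots> = (\<Oplus>\<^bsub>N\<^esub>j\<in>{..<n}. if i = j then v j else \<zero>\<^bsub>N\<^esub>)"
    using v i by (intro N.finsum_cong') (auto simp: basis_def)
  also have "\<dots> = v i" using i v by (intro N.add.finprod_singleton) auto
  finally show "f (basis n i) = v i" .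
qed

lemma hom_eq_on_basis:
  assumes N: "plain_module R N"
    and fg: "f \<in> module_homs R (free_module R n) N" "g \<in> module_homs R (free_module R n) N"
    and eq: "\<And>i. i < n \<Longrightarrow> f (basis n i) = g (basis n i)" and x: "x \<in> carrier (free_module R n)"
  shows "f x = g x"
proof -
  interpret N: plain_module R N by fact
  interpret g: linear_map R "free_module R n" N g
    using free_plain N fg by (simp add: linear_map_def linear_map_axioms_def)
  have "x i \<in> carrier R" if "i < n" for i using x that by (auto simp: free_module_simps)
  then show ?thesis
    unfolding hom_expand[OF N fg(1) x] hom_expand[OF N fg(2) x] using eq g.closed[OF basis_carr]
    by (intro N.finsum_cong') auto
qed

text \<open>Because \<open>c\<close> is a nonzerodivisor, the quotient of \<open>G x\<close> by
  \<open>c\<close> is unique, and uniqueness makes it linear in \<open>x\<close>.\<close>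

lemma hom_divide:
  assumes M: "plain_module R M" and G: "G \<in> module_homs R M (ring_module R)" and c: "nonzerodivisor c"
    and GI: "\<And>x. x \<in> carrier M \<Longrightarrow> G x \<in> PIdl c"
  shows "\<exists>g \<in> module_homs R M (ring_module R). \<forall>x\<in>carrier M. c \<otimes> g x = G x"
proof -
  interpret M: plain_module R M by fact
  interpret G: linear_map R M "ring_module R" G
    using ring_plain M G by (simp add: linear_map_def linear_map_axioms_def)
  have cc: "c \<in> carrier R" using c by (rule nonzerodivisor_carr)
  have "\<forall>x\<in>carrier M. \<exists>q\<in>carrier R. c \<otimes> q = G x" using GI cc by (metis mem_PIdl m_comm)
  then obtain q where q: "\<And>x. x \<in> carrier M \<Longrightarrow> q x \<in> carrier R \<and> c \<otimes> q x = G x" by metis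
  have "(\<lambda>x\<in>carrier M. q x) \<in> module_homs R M (ring_module R)"
  proof (rule module_homsI)
    fix x y assume xy: "x \<in> carrier M" "y \<in> carrier M"
    have "c \<otimes> q (x \<oplus>\<^bsub>M\<^esub> y) = c \<otimes> (q x \<oplus> q y)"
      using xy q cc G.add[of x y] by (simp add: r_distr ring_module_simps)
    then show "q (x \<oplus>\<^bsub>M\<^esub> y) = q x \<oplus>\<^bsub>ring_module R\<^esub> q y"
      using nonzerodivisor_cancel[OF c] xy q by (simp add: ring_module_simps)
  next
    fix a x assume ax: "a \<in> carrier R" "x \<in> carrier M"
    have "c \<otimes> q (a \<odot>\<^bsub>M\<^esub> x) = c \<otimes> (a \<otimes> q x)"
      using ax q cc G.smult[of a x] by (simp add: m_lcomm[of c a] ring_module_simps)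
    then show "q (a \<odot>\<^bsub>M\<^esub> x) = a \<odot>\<^bsub>ring_module R\<^esub> q x"
      using nonzerodivisor_cancel[OF c] ax q by (simp add: ring_module_simps)
  qed (use q in \<open>auto simp: ring_module_simps\<close>)
  then show ?thesis using q by (intro bexI[of _ "\<lambda>x\<in>carrier M. q x"]) auto
qed

end

section \<open>Resolutions by free modules of finite rank\<close>

context noetherian_cring
begin

text \<open>Induction on the number \<open>m\<close> of coordinates that may be nonzero. The last of
  them form a finitely generated ideal, whose generators are lifted to \<open>K\<close>; the
  elements with last coordinate zero are left to the induction.\<close>

lemma free_submodule_fin_gen:
  assumes K: "submodule K R (free_module R n)"
  shows "\<exists>S. finite S \<and> S \<subseteq> K \<and> (\<forall>L. submodule L R (free_module R n) \<longrightarrow> S \<subseteq> L \<longrightarrow> K \<subseteq> L)"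
proof -
  interpret F: plain_module R "free_module R n" by (rule free_plain)
  have "\<exists>S. finite S \<and> S \<subseteq> K \<and> (\<forall>L. submodule L R (free_module R n) \<longrightarrow> S \<subseteq> L \<longrightarrow> K \<subseteq> L)"
    if "m \<le> n" "submodule K R (free_module R n)" "\<And>x j. \<lbrakk>x \<in> K; m \<le> j; j < n\<rbrakk> \<Longrightarrow> x j = \<zero>" for m K
    using that
  proof (induction m arbitrary: K)
    case 0
    have "K \<subseteq> {\<zero>\<^bsub>free_module R n\<^esub>}"
    proof
      fix x assume x: "x \<in> K"
      have "x = \<zero>\<^bsub>free_module R n\<^esub>"
        by (rule free_module_eqI[of _ n "carrier R" _ UNIV])
          (use F.submod_carr[OF 0(2) x] 0(3)[OF x] in \<open>auto simp: free_module_simps\<close>)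
      then show "x \<in> {\<zero>\<^bsub>free_module R n\<^esub>}" by simp
    qed
    then show ?case using F.submod_zero by (intro exI[of _ "{}"]) blast
  next
    case (Suc m)
    note Kf = free_submoduleD[OF Suc.prems(2)]
    have m: "m < n" using Suc.prems by simp
    have mc: "x m \<in> carrier R" if "x \<in> K" for x using that Kf(1) m by (auto simp: PiE_iff)
    let ?I = "(\<lambda>x. x m) ` K"
    have I: "ideal ?I R"
    proof (rule idealI')
      show "?I \<subseteq> carrier R" using mc by auto
      show "\<zero> \<in> ?I" using imageI[OF Kf(2), of "\<lambda>x. x m"] m by simp
      fix u v assume "u \<in> ?I" "v \<in> ?I"
      then obtain x y where xy: "x \<in> K" "y \<in> K" "u = x m" "v = y m" by auto
      then show "u \<oplus> v \<in> ?I" using imageI[OF Kf(3)[OF xy(1,2)], of "\<lambda>x. x m"] m by simp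
    next
      fix r u assume r: "r \<in> carrier R" and "u \<in> ?I"
      then obtain x where x: "x \<in> K" "u = x m" by auto
      then show "r \<otimes> u \<in> ?I" using imageI[OF Kf(4)[OF r x(1)], of "\<lambda>x. x m"] m by simp
    qed
    obtain A where A: "finite A" "A \<subseteq> ?I" "?I = Idl A" using ideal_fin_gen[OF I] by auto
    then obtain S1 where S1: "S1 \<subseteq> K" "finite S1" "A = (\<lambda>x. x m) ` S1" by (metis finite_subset_image)
    let ?K0 = "{x \<in> K. x m = \<zero>}"
    have K0: "submodule ?K0 R (free_module R n)" by (rule free_submoduleI) (use Kf m in auto)
    have "\<exists>S. finite S \<and> S \<subseteq> ?K0 \<and> (\<forall>L. submodule L R (free_module R n) \<longrightarrow> S \<subseteq> L \<longrightarrow> ?K0 \<subseteq> L)"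
    proof (rule Suc.IH[OF _ K0])
      fix x j assume "x \<in> ?K0" "m \<le> j" "j < n"
      then show "x j = \<zero>" using Suc.prems(3)[of x j] by (cases "j = m") auto
    qed (use m in simp)
    then obtain S0 where S0: "finite S0" "S0 \<subseteq> ?K0" "\<And>L. submodule L R (free_module R n) \<Longrightarrow> S0 \<subseteq> L \<Longrightarrow> ?K0 \<subseteq> L"
      by blast
    show ?case
    proof (intro exI[of _ "S0 \<union> S1"] conjI allI impI)
      show "finite (S0 \<union> S1)" "S0 \<union> S1 \<subseteq> K" using S0 S1 by auto
      fix L assume L: "submodule L R (free_module R n)" "S0 \<union> S1 \<subseteq> L"
      let ?L = "L \<inter> K"
      have LK: "submodule ?L R (free_module R n)" using L Suc.prems(2) by (intro F.submod_inter)
      note Lf = free_submoduleD[OF LK]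
      have K0L: "?K0 \<subseteq> L" using S0(3)[OF L(1)] L(2) by auto
      have J: "ideal ((\<lambda>x. x m) ` ?L) R"
      proof (rule idealI')
        show "(\<lambda>x. x m) ` ?L \<subseteq> carrier R" using mc by auto
        show "\<zero> \<in> (\<lambda>x. x m) ` ?L" using imageI[OF Lf(2), of "\<lambda>x. x m"] m by simp
        fix u v assume "u \<in> (\<lambda>x. x m) ` ?L" "v \<in> (\<lambda>x. x m) ` ?L"
        then obtain x y where xy: "x \<in> ?L" "y \<in> ?L" "u = x m" "v = y m" by auto
        then show "u \<oplus> v \<in> (\<lambda>x. x m) ` ?L" using imageI[OF Lf(3)[OF xy(1,2)], of "\<lambda>x. x m"] m by simp
      next
        fix r u assume r: "r \<in> carrier R" and "u \<in> (\<lambda>x. x m) ` ?L"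
        then obtain x where x: "x \<in> ?L" "u = x m" by auto
        then show "r \<otimes> u \<in> (\<lambda>x. x m) ` ?L" using imageI[OF Lf(4)[OF r x(1)], of "\<lambda>x. x m"] m by simp
      qed
      have "A \<subseteq> (\<lambda>x. x m) ` ?L" using S1 L by auto
      then have IJ: "?I \<subseteq> (\<lambda>x. x m) ` ?L" unfolding A(3) by (rule genideal_minimal[OF J])
      show "K \<subseteq> L"
      proof
        fix x assume x: "x \<in> K"
        then obtain y where y: "y \<in> ?L" "x m = y m" using IJ by auto
        have xy: "x \<in> carrier (free_module R n)" "y \<in> carrier (free_module R n)"
          using x y F.submod_carr[OF Suc.prems(2)] by auto
        have dK: "x \<ominus>\<^bsub>free_module R n\<^esub> y \<in> K" using x y F.submod_diff[OF Suc.prems(2)] by auto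
        have xe: "x = (x \<ominus>\<^bsub>free_module R n\<^esub> y) \<oplus>\<^bsub>free_module R n\<^esub> y" using xy
          by (simp add: a_minus_def F.M.a_assoc F.M.l_neg)
        then have "x m = ((x \<ominus>\<^bsub>free_module R n\<^esub> y) \<oplus>\<^bsub>free_module R n\<^esub> y) m" by simp
        also have "\<dots> = (x \<ominus>\<^bsub>free_module R n\<^esub> y) m \<oplus> y m" using m by (simp add: free_module_simps)
        finally have "(x \<ominus>\<^bsub>free_module R n\<^esub> y) m = \<zero>" using y(2) mc[OF dK] mc[OF x]
          by (metis a_comm add.r_cancel_one' )
        then have "x \<ominus>\<^bsub>free_module R n\<^esub> y \<in> L" using dK K0L by auto
        then have "(x \<ominus>\<^bsub>free_module R n\<^esub> y) \<oplus>\<^bsub>free_module R n\<^esub> y \<in> L" using y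
          by (intro F.submod_add[OF L(1)]) auto
        then show "x \<in> L" using xe by simp
      qed
    qed
  qed
  from this[OF order_refl K] show ?thesis by auto
qed

lemma free_submodule_image:
  assumes K: "submodule K R (free_module R n)"
  shows "\<exists>m f. f \<in> module_homs R (free_module R m) (free_module R n) \<and> f ` carrier (free_module R m) = K"
proof -
  interpret F: plain_module R "free_module R n" by (rule free_plain)
  obtain S where S: "finite S" "S \<subseteq> K" "\<And>L. submodule L R (free_module R n) \<Longrightarrow> S \<subseteq> L \<Longrightarrow> K \<subseteq> L"
    using free_submodule_fin_gen[OF K] by blast
  obtain m and v :: "nat \<Rightarrow> nat \<Rightarrow> 'a" where v: "S = v ` {i. i < m}"
    using finite_imp_nat_seg_image_inj_on[OF S(1)] by metis
  have vc: "\<And>i. i < m \<Longrightarrow> v i \<in> carrier (free_module R n)" using v S(2) F.submod_carr[OF K] by auto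
  define f where "f = (\<lambda>x\<in>carrier (free_module R m). \<Oplus>\<^bsub>free_module R n\<^esub>i\<in>{..<m}. x i \<odot>\<^bsub>free_module R n\<^esub> v i)"
  have f: "f \<in> module_homs R (free_module R m) (free_module R n)" "\<And>i. i < m \<Longrightarrow> f (basis m i) = v i"
    unfolding f_def using hom_of_basis[OF free_plain vc] by auto
  have fx: "f x = (\<Oplus>\<^bsub>free_module R n\<^esub>i\<in>{..<m}. x i \<odot>\<^bsub>free_module R n\<^esub> v i)"
    if "x \<in> carrier (free_module R m)" for x
    using that by (simp add: f_def)
  interpret f: linear_map R "free_module R m" "free_module R n" f
    using free_plain f by (simp add: linear_map_def linear_map_axioms_def)
  have im: "submodule (f ` carrier (free_module R m)) R (free_module R n)"
    by (rule f.image_submodule[OF f.M.carrier_is_submodule])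
  have "S \<subseteq> f ` carrier (free_module R m)"
  proof
    fix y assume "y \<in> S"
    then obtain i where "i < m" "y = v i" using v by auto
    then have "y = f (basis m i)" using f(2) by simp
    then show "y \<in> f ` carrier (free_module R m)" using basis_carr by blast
  qed
  then have "K \<subseteq> f ` carrier (free_module R m)" by (rule S(3)[OF im])
  moreover have "f ` carrier (free_module R m) \<subseteq> K"
  proof
    fix y assume "y \<in> f ` carrier (free_module R m)"
    then obtain x where x: "x \<in> carrier (free_module R m)" "y = f x" by auto
    have xc: "x i \<in> carrier R" if "i < m" for i using x that by (auto simp: free_module_simps)
    have vK: "v i \<in> K" if "i < m" for i using v S(2) that by auto
    have "(\<Oplus>\<^bsub>free_module R n\<^esub>i\<in>{..<j}. x i \<odot>\<^bsub>free_module R n\<^esub> v i) \<in> K" if "j \<le> m" for j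
      using that
    proof (induction j)
      case 0 then show ?case using F.submod_zero[OF K] by simp
    next
      case (Suc j)
      have "(\<Oplus>\<^bsub>free_module R n\<^esub>i\<in>insert j {..<j}. x i \<odot>\<^bsub>free_module R n\<^esub> v i)
        = x j \<odot>\<^bsub>free_module R n\<^esub> v j \<oplus>\<^bsub>free_module R n\<^esub> (\<Oplus>\<^bsub>free_module R n\<^esub>i\<in>{..<j}. x i \<odot>\<^bsub>free_module R n\<^esub> v i)"
        using Suc xc vc by (intro F.M.finsum_insert) auto
      also have "\<dots> \<in> K" using Suc xc vK by (intro F.submod_add[OF K] F.submod_smult[OF K]) auto
      finally show ?case by (simp add: lessThan_Suc)
    qed
    then show "y \<in> K" using fx[OF x(1)] x(2) by simp
  qed
  ultimately show ?thesis using f(1) by blast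
qed

lemma free_resolution_exists:
  assumes N: "plain_module R N"
    and \<epsilon>: "\<epsilon> \<in> module_homs R (free_module R n) N" "\<epsilon> ` carrier (free_module R n) = carrier N"
  shows "\<exists>k d. free_resolution R N k d \<epsilon>"
proof -
  interpret \<epsilon>: linear_map R "free_module R n" N \<epsilon>
    using free_plain N \<epsilon> by (simp add: linear_map_def linear_map_axioms_def)
  \<comment> \<open>A state is one differential together with the ranks of its target and its
    source. \<open>Q\<close> says that consecutive differentials fit exactly, and the initial state
    takes care of the kernel of the augmentation.\<close>
  define P :: "nat \<Rightarrow> nat \<times> nat \<times> ((nat \<Rightarrow> 'a) \<Rightarrow> nat \<Rightarrow> 'a) \<Rightarrow> bool" where
    "P i s = (case s of (k, k', d) \<Rightarrow> d \<in> module_homs R (free_module R k') (free_module R k) \<and>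
      (i = 0 \<longrightarrow> k = n \<and> d ` carrier (free_module R k') = {x \<in> carrier (free_module R n). \<epsilon> x = \<zero>\<^bsub>N\<^esub>}))" for i s
  define Q :: "nat \<Rightarrow> nat \<times> nat \<times> ((nat \<Rightarrow> 'a) \<Rightarrow> nat \<Rightarrow> 'a) \<Rightarrow> nat \<times> nat \<times> ((nat \<Rightarrow> 'a) \<Rightarrow> nat \<Rightarrow> 'a) \<Rightarrow> bool" where
    "Q i s s' = (case s of (k, k', d) \<Rightarrow> case s' of (l, l', d') \<Rightarrow> l = k' \<and>
      d' ` carrier (free_module R l') = {x \<in> carrier (free_module R k'). d x = \<zero>\<^bsub>free_module R k\<^esub>})" for i s s'
  have "\<exists>s. \<forall>i. P i (s i) \<and> Q i (s i) (s (Suc i))"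
  proof (rule dependent_nat_choice)
    obtain m d where "d \<in> module_homs R (free_module R m) (free_module R n)"
      "d ` carrier (free_module R m) = {x \<in> carrier (free_module R n). \<epsilon> x = \<zero>\<^bsub>N\<^esub>}"
      using free_submodule_image[OF \<epsilon>.kernel_submodule] by blast
    then show "\<exists>s. P 0 s" by (intro exI[of _ "(n, m, d)"]) (simp add: P_def)
  next
    fix s i assume "P i s"
    then obtain k k' d where s: "s = (k, k', d)"
      and d: "d \<in> module_homs R (free_module R k') (free_module R k)"
      by (cases s) (auto simp: P_def)
    interpret d: linear_map R "free_module R k'" "free_module R k" d
      using free_plain d by (simp add: linear_map_def linear_map_axioms_def)
    obtain m d' where "d' \<in> module_homs R (free_module R m) (free_module R k')"
      "d' ` carrier (free_module R m) = {x \<in> carrier (free_module R k'). d x = \<zero>\<^bsub>free_module R k\<^esub>}"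
      using free_submodule_image[OF d.kernel_submodule] by blast
    then show "\<exists>s'. P (Suc i) s' \<and> Q i s s'" by (intro exI[of _ "(k', m, d')"]) (simp add: P_def Q_def s)
  qed
  then obtain s where s: "\<And>i. P i (s i)" "\<And>i. Q i (s i) (s (Suc i))" by blast
  define k where "k i = fst (s i)" for i
  define d where "d i = snd (snd (s i))" for i
  have se: "s i = (k i, k (Suc i), d i)" for i
    using s(2)[of i] by (cases "s i"; cases "s (Suc i)") (auto simp: Q_def k_def d_def)
  have "k 0 = n" using s(1)[of 0] by (simp add: P_def se)
  then have "free_resolution R N k d \<epsilon>"
    using s(1)[of 0] s(1) s(2) \<epsilon> unfolding free_resolution_def Let_def P_def Q_def se by auto
  then show ?thesis by blast
qed

end

section \<open>The first Ext module of the residue field\<close>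

context cring
begin

lemma hom_module_simps:
  "carrier (hom_module R M N) = module_homs R M N"
  "zero (hom_module R M N) = (\<lambda>x\<in>carrier M. \<zero>\<^bsub>N\<^esub>)"
  "add (hom_module R M N) = (\<lambda>f g. \<lambda>x\<in>carrier M. f x \<oplus>\<^bsub>N\<^esub> g x)"
  "smult (hom_module R M N) = (\<lambda>a f. \<lambda>x\<in>carrier M. a \<odot>\<^bsub>N\<^esub> f x)"
  by (simp_all add: hom_module_def)

lemma linear_mapI:
  "\<lbrakk>plain_module R M; plain_module R N; f \<in> module_homs R M N\<rbrakk> \<Longrightarrow> linear_map R M N f"
  by (simp add: linear_map_def linear_map_axioms_def)

lemma hom_module_module:
  fixes M :: "('a, 'c) module" and N :: "('a, 'd) module"
  assumes M: "plain_module R M" and N: "plain_module R N"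
  shows "module R (hom_module R M N)"
proof -
  interpret M: plain_module R M by fact
  interpret N: plain_module R N by fact
  have ext: "f = g"
    if "f \<in> extensional (carrier M)" "g \<in> extensional (carrier M)" "\<And>x. x \<in> carrier M \<Longrightarrow> f x = g x" for f g :: "'c \<Rightarrow> 'd"
    using that by (rule extensionalityI)
  have he: "f \<in> extensional (carrier M)" if "f \<in> module_homs R M N" for f
    using that by (auto simp: module_homs_def PiE_iff)
  have hc: "f x \<in> carrier N" if "f \<in> module_homs R M N" "x \<in> carrier M" for f x
    using that by (auto simp: module_homs_def PiE_iff)
  have ha: "f (x \<oplus>\<^bsub>M\<^esub> y) = f x \<oplus>\<^bsub>N\<^esub> f y" if "f \<in> module_homs R M N" "x \<in> carrier M" "y \<in> carrier M" for f x y
    using that by (auto simp: module_homs_def)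
  have hs: "f (a \<odot>\<^bsub>M\<^esub> x) = a \<odot>\<^bsub>N\<^esub> f x" if "f \<in> module_homs R M N" "x \<in> carrier M" "a \<in> carrier R" for f x a
    using that by (auto simp: module_homs_def)
  have zero: "(\<lambda>x\<in>carrier M. \<zero>\<^bsub>N\<^esub>) \<in> module_homs R M N" by (rule module_homsI) auto
  have add: "(\<lambda>x\<in>carrier M. f x \<oplus>\<^bsub>N\<^esub> g x) \<in> module_homs R M N"
    if "f \<in> module_homs R M N" "g \<in> module_homs R M N" for f g
    by (rule module_homsI) (use that in \<open>auto simp: hc ha hs N.M.a_ac N.smult_r_distr\<close>)
  have sm: "(\<lambda>x\<in>carrier M. a \<odot>\<^bsub>N\<^esub> f x) \<in> module_homs R M N" if "a \<in> carrier R" "f \<in> module_homs R M N" for a f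
    by (rule module_homsI)
      (use that in \<open>auto simp: hc ha hs N.smult_r_distr N.smult_assoc1[symmetric] m_comm\<close>)
  show ?thesis
  proof (rule moduleI[OF is_cring])
    show "abelian_group (hom_module R M N)"
    proof (rule abelian_groupI, unfold hom_module_simps)
      fix f assume f: "f \<in> module_homs R M N"
      show "(\<lambda>x\<in>carrier M. (\<lambda>x\<in>carrier M. \<zero>\<^bsub>N\<^esub>) x \<oplus>\<^bsub>N\<^esub> f x) = f"
        by (rule ext) (use f he hc in auto)
      have "(\<lambda>x\<in>carrier M. (\<lambda>x\<in>carrier M. (\<ominus> \<one>) \<odot>\<^bsub>N\<^esub> f x) x \<oplus>\<^bsub>N\<^esub> f x) = (\<lambda>x\<in>carrier M. \<zero>\<^bsub>N\<^esub>)"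
        by (rule restrict_ext) (use f hc in \<open>auto simp: N.smult_l_minus N.M.l_neg\<close>)
      then show "\<exists>g\<in>module_homs R M N. (\<lambda>x\<in>carrier M. g x \<oplus>\<^bsub>N\<^esub> f x) = (\<lambda>x\<in>carrier M. \<zero>\<^bsub>N\<^esub>)"
        using sm[OF _ f, of "\<ominus> \<one>"] by blast
    qed (use zero add in \<open>auto intro!: restrict_ext simp: hc N.M.a_ac\<close>)
  next
    fix f assume f: "f \<in> carrier (hom_module R M N)"
    show "\<one> \<odot>\<^bsub>hom_module R M N\<^esub> f = f"
      unfolding hom_module_simps by (rule ext) (use f he hc in \<open>auto simp: hom_module_simps\<close>)
  qed (use sm in \<open>auto intro!: restrict_ext simp: hom_module_simps hc N.smult_l_distr N.smult_r_distr N.smult_assoc1\<close>)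
qed

end

section \<open>The residue field and the socle modulo a parameter\<close>

context noetherian_local
begin

lemma residue_plain: "plain_module R (residue_module R)"
proof -
  interpret M: plain_module R "ring_module R" by (rule ring_plain)
  have "submodule \<mm> R (ring_module R)" using \<mm>_ideal submodule_ring_module_iff by simp
  then show ?thesis unfolding plain_module_def residue_module_def max_ideal_eq
    by (rule M.quotient_module_module)
qed

abbreviation residue_class :: "'a \<Rightarrow> 'a set" where "residue_class r \<equiv> \<mm> +>\<^bsub>ring_module R\<^esub> r"

lemma residue_carrier: "carrier (residue_module R) = residue_class ` carrier R"
  unfolding residue_module_def max_ideal_eq plain_module.quotient_carrier[OF ring_plain]
    by (simp add: ring_module_simps)

lemma residue_zero: "\<zero>\<^bsub>residue_module R\<^esub> = \<mm>"
  by (simp add: residue_module_def max_ideal_eq quotient_module_def)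

lemma \<mm>_submodule: "submodule \<mm> R (ring_module R)"
  using \<mm>_ideal submodule_ring_module_iff by simp

lemma ring_module_minus: "\<lbrakk>x \<in> carrier R; y \<in> carrier R\<rbrakk> \<Longrightarrow> x \<ominus>\<^bsub>ring_module R\<^esub> y = x \<ominus> y"
proof -
  interpret M: plain_module R "ring_module R" by (rule ring_plain)
  assume xy: "x \<in> carrier R" "y \<in> carrier R"
  have "\<ominus>\<^bsub>ring_module R\<^esub> y = (\<ominus> \<one>) \<otimes> y"
    using M.smult_l_minus[of \<one> y] xy by (simp add: ring_module_simps)
  then show ?thesis using xy by (simp add: a_minus_def ring_module_simps l_minus)
qed

lemma residue_class_eq: "\<lbrakk>x \<in> carrier R; y \<in> carrier R\<rbrakk> \<Longrightarrow> residue_class x = residue_class y \<longleftrightarrow> x \<ominus> y \<in> \<mm>"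
  using module.coset_eq[OF ring_module_module \<mm>_submodule, of x y]
    by (simp add: ring_module_simps ring_module_minus)

lemma residue_class_zero: "residue_class \<zero> = \<mm>"
  using plain_module.coset_zero[OF ring_plain \<mm>_submodule] by (simp add: ring_module_simps)

lemma residue_class_eq_zero: "x \<in> carrier R \<Longrightarrow> residue_class x = \<mm> \<longleftrightarrow> x \<in> \<mm>"
  using residue_class_eq[of x \<zero>] residue_class_zero by (simp add: a_minus_def)

lemma residue_class_smult: "\<lbrakk>a \<in> carrier R; x \<in> carrier R\<rbrakk> \<Longrightarrow> a \<odot>\<^bsub>residue_module R\<^esub> residue_class x = residue_class (a \<otimes> x)"
  using module.coset_smult[OF ring_module_module \<mm>_submodule, of x a]
  by (simp add: residue_module_def max_ideal_eq quotient_module_def ring_module_simps)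

lemma residue_class_add: "\<lbrakk>x \<in> carrier R; y \<in> carrier R\<rbrakk> \<Longrightarrow> residue_class x \<oplus>\<^bsub>residue_module R\<^esub> residue_class y = residue_class (x \<oplus> y)"
  using module.coset_add[OF ring_module_module \<mm>_submodule, of x y]
  by (simp add: residue_module_def max_ideal_eq quotient_module_def ring_module_simps)

lemma residue_resolution: "\<exists>k d \<epsilon>. free_resolution R (residue_module R) k d \<epsilon>"
proof -
  define \<epsilon> where "\<epsilon> = (\<lambda>x\<in>carrier (free_module R 1). residue_class (x 0))"
  interpret F: plain_module R "free_module R 1" by (rule free_plain)
  have "\<epsilon> \<in> module_homs R (free_module R 1) (residue_module R)" unfolding \<epsilon>_def
    by (rule module_homsI) (auto simp: free_module_simps residue_carrier residue_class_add residue_class_smult PiE_iff)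
  moreover have "\<epsilon> ` carrier (free_module R 1) = carrier (residue_module R)"
  proof
    show "\<epsilon> ` carrier (free_module R 1) \<subseteq> carrier (residue_module R)"
      by (auto simp: \<epsilon>_def residue_carrier free_module_simps PiE_iff)
    show "carrier (residue_module R) \<subseteq> \<epsilon> ` carrier (free_module R 1)"
    proof
      fix c assume "c \<in> carrier (residue_module R)"
      then obtain r where r: "r \<in> carrier R" "c = residue_class r" by (auto simp: residue_carrier)
      then have "(\<lambda>i\<in>{..<1}. r) \<in> carrier (free_module R 1)" "\<epsilon> (\<lambda>i\<in>{..<1}. r) = c"
        by (auto simp: \<epsilon>_def free_module_simps)
      then show "c \<in> \<epsilon> ` carrier (free_module R 1)" by blast
    qed
  qed
  ultimately have "\<exists>k d. free_resolution R (residue_module R) k d \<epsilon>"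
    by (rule free_resolution_exists[OF residue_plain])
  then show ?thesis by (elim exE) (intro exI)
qed

text \<open>The socle of \<open>R / cR\<close>, as an ideal of \<open>R\<close> containing \<open>c\<close>.\<close>

definition socle :: "'a \<Rightarrow> 'a set" where
  "socle c = {s \<in> carrier R. \<forall>t\<in>\<mm>. t \<otimes> s \<in> PIdl c}"

lemma socle_ideal: "c \<in> carrier R \<Longrightarrow> ideal (socle c) R"
  unfolding socle_def by (rule colon_ideal[OF cgenideal_ideal ideal_sub[OF \<mm>_ideal]])

lemma PIdl_sub_socle: "c \<in> carrier R \<Longrightarrow> PIdl c \<subseteq> socle c"
  using ideal_mult[OF cgenideal_ideal, of c] ideal_carr[OF cgenideal_ideal, of c] \<mm>_carr unfolding socle_def
    by auto

text \<open>A cocycle \<open>f\<close> is determined modulo coboundaries by \<open>f w\<close> modulo \<open>c\<close>, where \<open>w\<close> is a lift of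
  \<open>c x\<^sub>0\<close> and \<open>x\<^sub>0 \<in> F\<^sub>0\<close> is a lift of \<open>1\<close>. This identifies \<open>Ext\<^sup>1\<close> of the residue field with the
  socle of \<open>R / cR\<close> for an arbitrary, not necessarily minimal, resolution.\<close>

lemma length_Ext_of_resolution:
  assumes res: "free_resolution R (residue_module R) k d \<epsilon>" and c: "c \<in> \<mm>" "nonzerodivisor c"
  shows "module_length R (hom_cohomology R k d (ring_module R) 1) = ilen (PIdl c) (socle c)"
proof -
  \<comment> \<open>Keeps the index \<open>1\<close> from being rewritten to \<open>Suc 0\<close> in
    the terms \<open>F 1\<close> and \<open>d 1\<close>.\<close>
  note One_nat_def [simp del]
  define N where "N = ring_module R"
  define F where "F i = free_module R (k i)" for i
  define Z where "Z = hom_cocycles R k d N 1"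
  define B where "B = hom_coboundaries R k d N 1"
  define H where "H = hom_module R (F 1) N"
  have cc: "c \<in> carrier R" using c \<mm>_carr by simp
  have \<epsilon>h: "\<epsilon> \<in> module_homs R (F 0) (residue_module R)" and dh: "\<And>i. d i \<in> module_homs R (F (Suc i)) (F i)"
    and \<epsilon>s: "\<epsilon> ` carrier (F 0) = carrier (residue_module R)"
    and ex0: "d 0 ` carrier (F 1) = {x \<in> carrier (F 0). \<epsilon> x = \<zero>\<^bsub>residue_module R\<^esub>}"
    and ex: "\<And>i. d (Suc i) ` carrier (F (Suc (Suc i))) = {x \<in> carrier (F (Suc i)). d i x = \<zero>\<^bsub>F i\<^esub>}"
    using res unfolding free_resolution_def Let_def F_def by auto
  have ex1: "d 1 ` carrier (F 2) = {x \<in> carrier (F 1). d 0 x = \<zero>\<^bsub>F 0\<^esub>}"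
    using ex[of 0] by (simp add: numeral_2_eq_2 One_nat_def)
  have Fp: "plain_module R (F i)" for i unfolding F_def by (rule free_plain)
  have Np: "plain_module R N" unfolding N_def by (rule ring_plain)
  interpret N: plain_module R N by (rule Np)
  interpret F0: plain_module R "F 0" by (rule Fp)
  interpret F1: plain_module R "F 1" by (rule Fp)
  interpret Q: plain_module R "residue_module R" by (rule residue_plain)
  interpret \<epsilon>: linear_map R "F 0" "residue_module R" \<epsilon> using Fp residue_plain \<epsilon>h by (rule linear_mapI)
  interpret d0: linear_map R "F 1" "F 0" "d 0" using linear_mapI[OF Fp Fp dh[of 0]] by (simp add: One_nat_def)
  have Ns: "carrier N = carrier R" "\<zero>\<^bsub>N\<^esub> = \<zero>" "add N = add R" "smult N = mult R"
    unfolding N_def by (simp_all add: ring_module_simps)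
  have Hm: "module R H" unfolding H_def by (rule hom_module_module[OF Fp Np])
  then interpret H: plain_module R H unfolding plain_module_def .
  have Hs: "carrier H = module_homs R (F 1) N" "zero H = (\<lambda>x\<in>carrier (F 1). \<zero>)"
    "add H = (\<lambda>f g. \<lambda>x\<in>carrier (F 1). f x \<oplus> g x)" "smult H = (\<lambda>a f. \<lambda>x\<in>carrier (F 1). a \<otimes> f x)"
    unfolding H_def by (simp_all add: hom_module_simps Ns)
  have Zdef: "Z = {f \<in> module_homs R (F 1) N. \<forall>x\<in>carrier (F 2). f (d 1 x) = \<zero>}"
    unfolding Z_def hom_cocycles_def F_def by (simp add: Ns numeral_2_eq_2 One_nat_def)
  have Bdef: "B = (\<lambda>g. \<lambda>x\<in>carrier (F 1). g (d 0 x)) ` module_homs R (F 0) N"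
    unfolding B_def hom_coboundaries_def F_def by (simp add: One_nat_def)
  have d1c: "d 1 x \<in> carrier (F 1)" and d01: "d 0 (d 1 x) = \<zero>\<^bsub>F 0\<^esub>" if "x \<in> carrier (F 2)" for x
    using ex1 that by auto
  have fc: "f x \<in> carrier R" if "f \<in> module_homs R (F i) N" "x \<in> carrier (F i)" for f x i
    using that by (auto simp: module_homs_def PiE_iff Ns)
  have fadd: "f (x \<oplus>\<^bsub>F i\<^esub> y) = f x \<oplus> f y"
    if "f \<in> module_homs R (F i) N" "x \<in> carrier (F i)" "y \<in> carrier (F i)" for f x y i
    using that by (auto simp: module_homs_def Ns)
  have fsm: "f (a \<odot>\<^bsub>F i\<^esub> x) = a \<otimes> f x"
    if "f \<in> module_homs R (F i) N" "a \<in> carrier R" "x \<in> carrier (F i)" for f x a i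
    using that by (auto simp: module_homs_def Ns)
  have fz: "f \<zero>\<^bsub>F i\<^esub> = \<zero>" if "f \<in> module_homs R (F i) N" for f i
    using linear_map.zero[OF linear_mapI[OF Fp Np that]] by (simp add: Ns)
  have Zh: "f \<in> module_homs R (F 1) N" if "f \<in> Z" for f using that Zdef by auto
  have Zsub: "submodule Z R H"
  proof (rule H.submoduleI')
    show "\<zero>\<^bsub>H\<^esub> \<in> Z" using H.M.zero_closed d1c unfolding Zdef Hs by auto
    fix f g assume "f \<in> Z" "g \<in> Z"
    then show "f \<oplus>\<^bsub>H\<^esub> g \<in> Z" using H.M.add.m_closed[of f g] d1c unfolding Zdef Hs by (auto simp: Hs)
  next
    fix a f assume "a \<in> carrier R" "f \<in> Z"
    then show "a \<odot>\<^bsub>H\<^esub> f \<in> Z" using H.smult_closed[of a f] d1c unfolding Zdef Hs by (auto simp: Hs)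
  qed (use Zh Hs in auto)
  define HZ where "HZ = H\<lparr>carrier := Z\<rparr>"
  have HZm: "module R HZ" unfolding HZ_def by (rule submodule.submodule_is_module[OF Zsub Hm])
  then interpret HZ: plain_module R HZ unfolding plain_module_def .
  have HZs: "carrier HZ = Z" "zero HZ = (\<lambda>x\<in>carrier (F 1). \<zero>)"
    "add HZ = (\<lambda>f g. \<lambda>x\<in>carrier (F 1). f x \<oplus> g x)" "smult HZ = (\<lambda>a f. \<lambda>x\<in>carrier (F 1). a \<otimes> f x)"
    unfolding HZ_def using Hs by simp_all
  \<comment> \<open>A cocycle vanishes on the image of \<open>d 1\<close>, which is the kernel of
    \<open>d 0\<close>. So it is a functional on the first syzygy, the kernel of the
    augmentation.\<close>
  have cong: "f x = f y" if f: "f \<in> Z" and xy: "x \<in> carrier (F 1)" "y \<in> carrier (F 1)"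
    and e: "d 0 x = d 0 y" for f x y
  proof -
    interpret f: linear_map R "F 1" N f using Fp Np Zh[OF f] by (rule linear_mapI)
    have "d 0 (x \<ominus>\<^bsub>F 1\<^esub> y) = \<zero>\<^bsub>F 0\<^esub>"
      unfolding d0.diff[OF xy] e using d0.closed[OF xy(2)] by (simp add: a_minus_def F0.M.r_neg)
    moreover have "x \<ominus>\<^bsub>F 1\<^esub> y \<in> carrier (F 1)" using xy by simp
    ultimately have "x \<ominus>\<^bsub>F 1\<^esub> y \<in> d 1 ` carrier (F 2)" unfolding ex1 by simp
    then obtain z where z: "z \<in> carrier (F 2)" "d 1 z = x \<ominus>\<^bsub>F 1\<^esub> y" by auto
    then have "f (x \<ominus>\<^bsub>F 1\<^esub> y) = \<zero>" using f Zdef by auto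
    then have "f x \<ominus>\<^bsub>N\<^esub> f y = \<zero>\<^bsub>N\<^esub>" using xy by (simp add: f.diff Ns)
    then have "f x \<ominus> f y = \<zero>" using ring_module_minus[OF fc[OF Zh[OF f] xy(1)] fc[OF Zh[OF f] xy(2)]]
      by (simp add: N_def ring_module_simps)
    then show ?thesis using fc[OF Zh[OF f] xy(1)] fc[OF Zh[OF f] xy(2)] by simp
  qed
  have one: "\<one> \<in> carrier R" by simp
  have lift: "\<exists>v\<in>carrier (F 1). d 0 v = x" if "x \<in> carrier (F 0)" "\<epsilon> x = \<mm>" for x
  proof -
    have "x \<in> d 0 ` carrier (F 1)" unfolding ex0 residue_zero using that by simp
    then show ?thesis by auto
  qed
  have \<epsilon>d0: "\<epsilon> (d 0 y) = \<mm>" if "y \<in> carrier (F 1)" for y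
    using that ex0 residue_zero by blast
  have \<epsilon>sm: "\<epsilon> (t \<odot>\<^bsub>F 0\<^esub> x) = \<mm>" if tx: "t \<in> \<mm>" "x \<in> carrier (F 0)" for t x
  proof -
    obtain r where r: "r \<in> carrier R" "\<epsilon> x = residue_class r" using \<epsilon>.closed[OF tx(2)]
      by (auto simp: residue_carrier)
    have "\<epsilon> (t \<odot>\<^bsub>F 0\<^esub> x) = residue_class (t \<otimes> r)" using that r \<mm>_carr
      by (simp add: \<epsilon>.smult residue_class_smult)
    then show ?thesis using residue_class_eq_zero[of "t \<otimes> r"] that r \<mm>_carr ideal_mult'[OF \<mm>_ideal] by simp
  qed
  obtain x0 where x0: "x0 \<in> carrier (F 0)" "\<epsilon> x0 = residue_class \<one>" using \<epsilon>s residue_carrier one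
    by (metis (no_types, lifting) imageE imageI)
  obtain w where w: "w \<in> carrier (F 1)" "d 0 w = c \<odot>\<^bsub>F 0\<^esub> x0" using lift[OF _ \<epsilon>sm[OF c(1) x0(1)]] x0 cc
    by auto
  \<comment> \<open>If \<open>v\<close> lifts \<open>t x0\<close>, then \<open>t w\<close> and
    \<open>c v\<close> both lift \<open>t c x0\<close>, and therefore
    \<open>t * f w = c * f v\<close>.\<close>
  have F1: "f w \<in> socle c" if f: "f \<in> Z" for f
  proof -
    have "t \<otimes> f w \<in> PIdl c" if t: "t \<in> \<mm>" for t
    proof -
      have tc: "t \<in> carrier R" using t \<mm>_carr by simp
      obtain v where v: "v \<in> carrier (F 1)" "d 0 v = t \<odot>\<^bsub>F 0\<^esub> x0" using lift[OF _ \<epsilon>sm[OF t x0(1)]] x0 tc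
        by auto
      have "d 0 (t \<odot>\<^bsub>F 1\<^esub> w) = d 0 (c \<odot>\<^bsub>F 1\<^esub> v)"
        using v w x0 tc cc by (simp add: d0.smult F0.smult_assoc1[symmetric] m_comm)
      then have "f (t \<odot>\<^bsub>F 1\<^esub> w) = f (c \<odot>\<^bsub>F 1\<^esub> v)" using f v w tc cc by (intro cong) auto
      then have "t \<otimes> f w = f v \<otimes> c" using fsm[OF Zh[OF f]] fc[OF Zh[OF f]] v w tc cc by (simp add: m_comm)
      then show ?thesis using fc[OF Zh[OF f] v(1)] by (auto simp: mem_PIdl)
    qed
    then show ?thesis using fc[OF Zh[OF f] w(1)] by (simp add: socle_def)
  qed
  have BZ: "B \<subseteq> Z"
  proof
    fix f assume "f \<in> B"
    then obtain g where g: "g \<in> module_homs R (F 0) N" "f = (\<lambda>x\<in>carrier (F 1). g (d 0 x))" unfolding Bdef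
      by auto
    have "f \<in> module_homs R (F 1) N" unfolding g(2)
      by (rule module_homsI) (use d0.closed fc[OF g(1)] fadd[OF g(1)] fsm[OF g(1)] in \<open>auto simp: d0.add d0.smult Ns\<close>)
    then show "f \<in> Z" unfolding Zdef using d1c d01 fz[OF g(1)] by (auto simp: g(2))
  qed
  have Bsub: "submodule B R HZ"
  proof (rule HZ.submoduleI')
    interpret H0: module R "hom_module R (F 0) N" by (rule hom_module_module[OF Fp Np])
    show "B \<subseteq> carrier HZ" using BZ HZs by simp
    have "(\<lambda>x\<in>carrier (F 1). (\<lambda>x\<in>carrier (F 0). \<zero>) (d 0 x)) = (\<lambda>x\<in>carrier (F 1). \<zero>)"
      by (rule restrict_ext) (use d0.closed in auto)
    moreover have "(\<lambda>x\<in>carrier (F 0). \<zero>) \<in> module_homs R (F 0) N" using H0.M.zero_closed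
      by (simp add: hom_module_simps Ns)
    ultimately show "\<zero>\<^bsub>HZ\<^esub> \<in> B" unfolding Bdef HZs
      by (intro image_eqI[where x = "\<lambda>x\<in>carrier (F 0). \<zero>"]) simp_all
    fix f f' assume "f \<in> B" "f' \<in> B"
    then obtain g g' where g: "g \<in> module_homs R (F 0) N" "f = (\<lambda>x\<in>carrier (F 1). g (d 0 x))"
      "g' \<in> module_homs R (F 0) N" "f' = (\<lambda>x\<in>carrier (F 1). g' (d 0 x))" unfolding Bdef by auto
    have "f \<oplus>\<^bsub>HZ\<^esub> f' = (\<lambda>x\<in>carrier (F 1). (\<lambda>x\<in>carrier (F 0). g x \<oplus> g' x) (d 0 x))"
      unfolding HZs g(2,4) by (rule restrict_ext) (use d0.closed in auto)
    moreover have "(\<lambda>x\<in>carrier (F 0). g x \<oplus> g' x) \<in> module_homs R (F 0) N"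
      using H0.M.add.m_closed[of g g'] g by (simp add: hom_module_simps Ns)
    ultimately show "f \<oplus>\<^bsub>HZ\<^esub> f' \<in> B" unfolding Bdef
      by (rule image_eqI[where x = "\<lambda>x\<in>carrier (F 0). g x \<oplus> g' x"])
  next
    interpret H0: module R "hom_module R (F 0) N" by (rule hom_module_module[OF Fp Np])
    fix a f assume a: "a \<in> carrier R" and "f \<in> B"
    then obtain g where g: "g \<in> module_homs R (F 0) N" "f = (\<lambda>x\<in>carrier (F 1). g (d 0 x))" unfolding Bdef
      by auto
    have "a \<odot>\<^bsub>HZ\<^esub> f = (\<lambda>x\<in>carrier (F 1). (\<lambda>x\<in>carrier (F 0). a \<otimes> g x) (d 0 x))"
      unfolding HZs g(2) by (rule restrict_ext) (use d0.closed in auto)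
    moreover have "(\<lambda>x\<in>carrier (F 0). a \<otimes> g x) \<in> module_homs R (F 0) N"
      using H0.smult_closed[of a g] g a by (simp add: hom_module_simps Ns)
    ultimately show "a \<odot>\<^bsub>HZ\<^esub> f \<in> B" unfolding Bdef
      by (rule image_eqI[where x = "\<lambda>x\<in>carrier (F 0). a \<otimes> g x"])
  qed
  have F2a: "f w \<in> PIdl c" if fB: "f \<in> B" for f
  proof -
    obtain g where g: "g \<in> module_homs R (F 0) N" "f = (\<lambda>x\<in>carrier (F 1). g (d 0 x))" using fB unfolding Bdef
      by auto
    have "f w = c \<otimes> g x0" using g w x0 fsm[OF g(1) cc x0(1)] by simp
    then show ?thesis using fc[OF g(1) x0(1)] cc m_comm[of c "g x0"] by (auto simp: mem_PIdl)
  qed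
  \<comment> \<open>The functional \<open>f\<close> extends from the syzygy to \<open>F 0\<close> by
    sending \<open>x\<close> to \<open>f\<close> of a lift of \<open>c x\<close>, divided by
    \<open>c\<close>. Divisibility has to be tested only on \<open>x0\<close> and on the syzygy,
    which together generate \<open>F 0\<close>; on \<open>x0\<close> it is the assumption on
    \<open>f w\<close>.\<close>
  have F2b: "f \<in> B" if f: "f \<in> Z" and fw: "f w \<in> PIdl c" for f
  proof -
    have "\<forall>x\<in>carrier (F 0). \<exists>y. y \<in> carrier (F 1) \<and> d 0 y = c \<odot>\<^bsub>F 0\<^esub> x"
      using lift \<epsilon>sm[OF c(1)] cc by (metis F0.smult_closed)
    then obtain Y where Y: "\<And>x. x \<in> carrier (F 0) \<Longrightarrow> Y x \<in> carrier (F 1) \<and> d 0 (Y x) = c \<odot>\<^bsub>F 0\<^esub> x" by metis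
    have fY: "f (Y x) = f y" if "x \<in> carrier (F 0)" "y \<in> carrier (F 1)" "d 0 y = c \<odot>\<^bsub>F 0\<^esub> x" for x y
      using Y[OF that(1)] that by (intro cong[OF f]) auto
    define G where "G = (\<lambda>x\<in>carrier (F 0). f (Y x))"
    have G: "G \<in> module_homs R (F 0) (ring_module R)" unfolding G_def
    proof (rule module_homsI)
      fix x y assume xy: "x \<in> carrier (F 0)" "y \<in> carrier (F 0)"
      have "f (Y (x \<oplus>\<^bsub>F 0\<^esub> y)) = f (Y x \<oplus>\<^bsub>F 1\<^esub> Y y)"
        using xy Y cc by (intro fY) (auto simp: d0.add F0.smult_r_distr)
      then show "f (Y (x \<oplus>\<^bsub>F 0\<^esub> y)) = f (Y x) \<oplus>\<^bsub>ring_module R\<^esub> f (Y y)"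
        using fadd[OF Zh[OF f]] Y xy by (simp add: ring_module_simps)
    next
      fix a x assume ax: "a \<in> carrier R" "x \<in> carrier (F 0)"
      have "f (Y (a \<odot>\<^bsub>F 0\<^esub> x)) = f (a \<odot>\<^bsub>F 1\<^esub> Y x)"
        using ax Y cc by (intro fY) (auto simp: d0.smult F0.smult_assoc1[symmetric] m_comm)
      then show "f (Y (a \<odot>\<^bsub>F 0\<^esub> x)) = a \<odot>\<^bsub>ring_module R\<^esub> f (Y x)"
        using fsm[OF Zh[OF f]] Y ax by (simp add: ring_module_simps)
    qed (use Y fc[OF Zh[OF f]] in \<open>auto simp: ring_module_simps\<close>)
    have "G x \<in> PIdl c" if x: "x \<in> carrier (F 0)" for x
    proof -
      obtain r where r: "r \<in> carrier R" "\<epsilon> x = residue_class r" using \<epsilon>.closed[OF x]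
        by (auto simp: residue_carrier)
      define \<kappa> where "\<kappa> = x \<ominus>\<^bsub>F 0\<^esub> r \<odot>\<^bsub>F 0\<^esub> x0"
      have \<kappa>c: "\<kappa> \<in> carrier (F 0)" using x x0 r by (simp add: \<kappa>_def)
      have "\<epsilon> \<kappa> = \<epsilon> x \<ominus>\<^bsub>residue_module R\<^esub> \<epsilon> (r \<odot>\<^bsub>F 0\<^esub> x0)" unfolding \<kappa>_def using x x0 r by (simp add: \<epsilon>.diff)
      also have "\<epsilon> (r \<odot>\<^bsub>F 0\<^esub> x0) = \<epsilon> x" using x0 r by (simp add: \<epsilon>.smult residue_class_smult)
      finally have "\<epsilon> \<kappa> = \<mm>" using \<epsilon>.closed[OF x] by (simp add: a_minus_def Q.M.r_neg residue_zero)
      then obtain v where v: "v \<in> carrier (F 1)" "d 0 v = \<kappa>" using lift \<kappa>c by blast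
      have xe: "x = r \<odot>\<^bsub>F 0\<^esub> x0 \<oplus>\<^bsub>F 0\<^esub> \<kappa>" unfolding \<kappa>_def using x x0 r
        by (simp add: a_minus_def F0.M.a_lcomm F0.M.r_neg)
      have "G x = f (Y x)" using x by (simp add: G_def)
      also have "\<dots> = f (r \<odot>\<^bsub>F 1\<^esub> w \<oplus>\<^bsub>F 1\<^esub> c \<odot>\<^bsub>F 1\<^esub> v)"
      proof (rule fY[OF x])
        have "d 0 (r \<odot>\<^bsub>F 1\<^esub> w \<oplus>\<^bsub>F 1\<^esub> c \<odot>\<^bsub>F 1\<^esub> v) = r \<odot>\<^bsub>F 0\<^esub> (c \<odot>\<^bsub>F 0\<^esub> x0) \<oplus>\<^bsub>F 0\<^esub> c \<odot>\<^bsub>F 0\<^esub> \<kappa>"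
          using r w v cc by (simp add: d0.add d0.smult)
        also have "\<dots> = c \<odot>\<^bsub>F 0\<^esub> (r \<odot>\<^bsub>F 0\<^esub> x0 \<oplus>\<^bsub>F 0\<^esub> \<kappa>)"
          using r x0 cc \<kappa>c by (simp add: F0.smult_r_distr F0.smult_assoc1[symmetric] m_comm)
        finally show "d 0 (r \<odot>\<^bsub>F 1\<^esub> w \<oplus>\<^bsub>F 1\<^esub> c \<odot>\<^bsub>F 1\<^esub> v) = c \<odot>\<^bsub>F 0\<^esub> x" using xe by simp
      qed (use r w v cc in auto)
      also have "\<dots> = r \<otimes> f w \<oplus> f v \<otimes> c"
        using fadd[OF Zh[OF f]] fsm[OF Zh[OF f]] fc[OF Zh[OF f]] r w v cc by (simp add: m_comm)
      also have "\<dots> \<in> PIdl c"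
        using ideal_add[OF cgenideal_ideal[OF cc]] ideal_mult[OF cgenideal_ideal[OF cc] r(1) fw] fc[OF Zh[OF f] v(1)]
          by (auto simp: mem_PIdl)
      finally show ?thesis .
    qed
    then obtain g where g: "g \<in> module_homs R (F 0) N" "\<And>x. x \<in> carrier (F 0) \<Longrightarrow> c \<otimes> g x = G x"
      using hom_divide[OF Fp G c(2)] unfolding N_def by blast
    have gf: "g (d 0 y) = f y" if y: "y \<in> carrier (F 1)" for y
    proof -
      have "c \<otimes> g (d 0 y) = f (Y (d 0 y))" using g(2)[of "d 0 y"] d0.closed[OF y] by (simp add: G_def)
      also have "\<dots> = f (c \<odot>\<^bsub>F 1\<^esub> y)" using y d0.closed[OF y] cc by (intro fY) (auto simp: d0.smult)
      also have "\<dots> = c \<otimes> f y" using fsm[OF Zh[OF f] cc y] .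
      finally show ?thesis using nonzerodivisor_cancel[OF c(2)] fc[OF g(1) d0.closed[OF y]] fc[OF Zh[OF f] y]
        by simp
    qed
    have "f = (\<lambda>x\<in>carrier (F 1). g (d 0 x))"
      by (rule extensionalityI[of _ "carrier (F 1)"]) (use Zh[OF f] gf in \<open>auto simp: module_homs_def PiE_iff\<close>)
    then show ?thesis unfolding Bdef using g by blast
  qed
  \<comment> \<open>The augmentation lifts to a functional \<open>lam\<close> on \<open>F 0\<close>
    with values in \<open>R\<close>, which maps the syzygy into \<open>\<mm>\<close>. There
    \<open>lam\<close> times the socle element \<open>s\<close> is divisible by \<open>c\<close>,
    and the quotient is the cocycle \<open>f\<close>. Its value is \<open>f w = lam x0 * s\<close>,
    congruent to \<open>s\<close> modulo \<open>c\<close> because \<open>lam x0\<close> is congruent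
    to \<open>1\<close> modulo \<open>\<mm>\<close>.\<close>
  have F3: "\<exists>f\<in>Z. \<exists>r\<in>carrier R. s = f w \<oplus> r \<otimes> c" if s: "s \<in> socle c" for s
  proof -
    have sc: "s \<in> carrier R" using s by (simp add: socle_def)
    have "\<forall>i. \<exists>r\<in>carrier R. \<epsilon> (basis (k 0) i) = residue_class r"
      using \<epsilon>.closed basis_carr residue_carrier unfolding F_def by blast
    then obtain \<rho> where \<rho>: "\<And>i. \<rho> i \<in> carrier R" "\<And>i. \<epsilon> (basis (k 0) i) = residue_class (\<rho> i)" by metis
    define lam where "lam = (\<lambda>x\<in>carrier (free_module R (k 0)). \<Oplus>\<^bsub>N\<^esub>i\<in>{..<k 0}. x i \<odot>\<^bsub>N\<^esub> \<rho> i)"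
    have lam: "lam \<in> module_homs R (F 0) N" "\<And>i. i < k 0 \<Longrightarrow> lam (basis (k 0) i) = \<rho> i"
      unfolding lam_def F_def using hom_of_basis[OF Np, of "k 0" \<rho>] \<rho>(1) Ns by auto
    have \<pi>: "(\<lambda>x\<in>carrier (F 0). residue_class (lam x)) \<in> module_homs R (F 0) (residue_module R)"
      by (rule module_homsI) (use fc[OF lam(1)] fadd[OF lam(1)] fsm[OF lam(1)] in \<open>auto simp: residue_carrier residue_class_add residue_class_smult\<close>)
    have \<epsilon>lam: "\<epsilon> x = residue_class (lam x)" if "x \<in> carrier (F 0)" for x
      using hom_eq_on_basis[OF residue_plain \<epsilon>h[unfolded F_def] \<pi>[unfolded F_def], of x] that \<rho>(2) lam(2) basis_carr
      by (simp add: F_def)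
    define G where "G = (\<lambda>y\<in>carrier (F 1). lam (d 0 y) \<otimes> s)"
    have G: "G \<in> module_homs R (F 1) (ring_module R)" unfolding G_def
      by (rule module_homsI) (use d0.closed fc[OF lam(1)] fadd[OF lam(1)] fsm[OF lam(1)] sc in
        \<open>auto simp: ring_module_simps d0.add d0.smult l_distr m_assoc\<close>)
    have "G y \<in> PIdl c" if y: "y \<in> carrier (F 1)" for y
    proof -
      have "lam (d 0 y) \<in> \<mm>"
        using \<epsilon>lam[OF d0.closed[OF y]] \<epsilon>d0[OF y] residue_class_eq_zero[OF fc[OF lam(1) d0.closed[OF y]]]
          by metis
      then show ?thesis using s y by (simp add: G_def socle_def)
    qed
    then obtain f where f: "f \<in> module_homs R (F 1) N" "\<And>x. x \<in> carrier (F 1) \<Longrightarrow> c \<otimes> f x = G x"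
      using hom_divide[OF Fp G c(2)] unfolding N_def by blast
    have fZ: "f \<in> Z" unfolding Zdef
    proof (intro CollectI conjI ballI f(1))
      fix z assume z: "z \<in> carrier (F 2)"
      have "c \<otimes> f (d 1 z) = \<zero>" using f(2)[OF d1c[OF z]] d1c[OF z] d01[OF z] fz[OF lam(1)] sc
        by (simp add: G_def)
      then show "f (d 1 z) = \<zero>" using c(2) fc[OF f(1) d1c[OF z]] unfolding nonzerodivisor_def by blast
    qed
    define l where "l = lam x0"
    have lc: "l \<in> carrier R" unfolding l_def by (rule fc[OF lam(1) x0(1)])
    have "c \<otimes> f w = c \<otimes> (l \<otimes> s)" using f(2)[OF w(1)] w fsm[OF lam(1) cc x0(1)] lc sc cc
      by (simp add: G_def l_def m_assoc)
    then have fw: "f w = l \<otimes> s" using nonzerodivisor_cancel[OF c(2)] fc[OF f(1) w(1)] lc sc by simp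
    have "residue_class \<one> = residue_class l" using \<epsilon>lam[OF x0(1)] x0(2) by (simp add: l_def)
    then have "\<one> \<ominus> l \<in> \<mm>" using residue_class_eq lc by simp
    then have "(\<one> \<ominus> l) \<otimes> s \<in> PIdl c" using s by (simp add: socle_def)
    then obtain r where r: "r \<in> carrier R" "(\<one> \<ominus> l) \<otimes> s = r \<otimes> c" by (auto simp: mem_PIdl)
    have "s = l \<otimes> s \<oplus> (\<one> \<ominus> l) \<otimes> s" using lc sc by algebra
    then have "s = f w \<oplus> r \<otimes> c" using r fw by simp
    then show ?thesis using fZ r by blast
  qed
  have fwadd: "(f \<oplus>\<^bsub>HZ\<^esub> g) w = f w \<oplus> g w" and fwsm: "(a \<odot>\<^bsub>HZ\<^esub> f) w = a \<otimes> f w" for f g a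
    using w by (simp_all add: HZs)
  have fwc: "f w \<in> carrier R" if "f \<in> Z" for f using fc[OF Zh[OF that] w(1)] .
  have fwdiff: "(f \<ominus>\<^bsub>HZ\<^esub> g) w = f w \<ominus> g w" if "f \<in> Z" "g \<in> Z" for f g
  proof -
    have "f \<ominus>\<^bsub>HZ\<^esub> g = f \<oplus>\<^bsub>HZ\<^esub> (\<ominus> \<one>) \<odot>\<^bsub>HZ\<^esub> g"
      using that HZ.smult_l_minus[of \<one> g] by (simp add: a_minus_def HZs(1))
    then show ?thesis using that fwc by (simp add: fwadd fwsm a_minus_def l_minus)
  qed
  have Pc: "ideal (PIdl c) R" by (rule cgenideal_ideal[OF cc])
  have "module_length R (hom_cohomology R k d (ring_module R) 1) = module_length R (quotient_module HZ B)"
    by (simp add: hom_cohomology_def HZ_def H_def Z_def B_def N_def F_def)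
  also have "\<dots> = HZ.submods.len B Z" using HZ.module_length_quotient[OF Bsub] HZs by simp
  \<comment> \<open>By \<open>F1\<close>, \<open>F2a\<close>, \<open>F2b\<close> and
    \<open>F3\<close>, evaluation at \<open>w\<close> is an isomorphism from cocycles modulo
    coboundaries onto \<open>socle c\<close> modulo \<open>c\<close>. The two maps below are image
    and preimage under it.\<close>
  also have "\<dots> = ilen (PIdl c) (socle c)"
  proof (rule antisym)
    show "HZ.submods.len B Z \<le> ilen (PIdl c) (socle c)"
      unfolding HZ.submods.len_def ideals.len_def
    proof (rule chain_height_le_map[where f = "\<lambda>X. {s \<in> carrier R. \<exists>f\<in>X. \<exists>r\<in>carrier R. s = f w \<oplus> r \<otimes> c}"])
      fix X assume "X \<in> {X \<in> {N. submodule N R HZ}. B \<subseteq> X \<and> X \<subseteq> Z}"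
      then have X: "submodule X R HZ" "B \<subseteq> X" "X \<subseteq> Z" by auto
      let ?S = "\<lambda>X. {s \<in> carrier R. \<exists>f\<in>X. \<exists>r\<in>carrier R. s = f w \<oplus> r \<otimes> c}"
      have Xc: "f w \<in> carrier R" if "f \<in> X" for f using that X fwc by auto
      have "ideal (?S X) R"
      proof (rule idealI')
        have "\<zero>\<^bsub>HZ\<^esub> w = \<zero>" using w by (simp add: HZs)
        then show "\<zero> \<in> ?S X" using HZ.submod_zero[OF X(1)] cc
          by (auto intro!: bexI[of _ "\<zero>\<^bsub>HZ\<^esub>"] bexI[of _ "\<zero>"])
        fix s s' assume "s \<in> ?S X" "s' \<in> ?S X"
        then obtain f r f' r'
          where *: "f \<in> X" "r \<in> carrier R" "s = f w \<oplus> r \<otimes> c" "f' \<in> X" "r' \<in> carrier R" "s' = f' w \<oplus> r' \<otimes> c"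
            by auto
        have "s \<oplus> s' = (f \<oplus>\<^bsub>HZ\<^esub> f') w \<oplus> (r \<oplus> r') \<otimes> c" using * Xc cc by (simp add: fwadd l_distr a_ac)
        then show "s \<oplus> s' \<in> ?S X" using * Xc cc HZ.submod_add[OF X(1) *(1,4)] by blast
      next
        fix a s assume a: "a \<in> carrier R" and "s \<in> ?S X"
        then obtain f r where *: "f \<in> X" "r \<in> carrier R" "s = f w \<oplus> r \<otimes> c" by auto
        have "a \<otimes> s = (a \<odot>\<^bsub>HZ\<^esub> f) w \<oplus> (a \<otimes> r) \<otimes> c" using * a Xc cc by (simp add: fwsm r_distr m_assoc)
        moreover have "a \<otimes> s \<in> carrier R" using * a Xc cc by simp
        ultimately show "a \<otimes> s \<in> ?S X" using *(2) a HZ.submod_smult[OF X(1) a *(1)] by blast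
      qed auto
      moreover have "PIdl c \<subseteq> ?S X"
      proof
        fix s assume "s \<in> PIdl c"
        then obtain r where r: "r \<in> carrier R" "s = r \<otimes> c" by (auto simp: mem_PIdl)
        then have "s = \<zero>\<^bsub>HZ\<^esub> w \<oplus> r \<otimes> c" using w cc by (simp add: HZs)
        moreover have "s \<in> carrier R" using r cc by simp
        ultimately show "s \<in> ?S X" using HZ.submod_zero[OF X(1)] r(1) by blast
      qed
      moreover have "?S X \<subseteq> socle c"
      proof
        fix s assume "s \<in> ?S X"
        then obtain f r where *: "f \<in> X" "r \<in> carrier R" "s = f w \<oplus> r \<otimes> c" by auto
        have "r \<otimes> c \<in> PIdl c" using *(2) by (auto simp: mem_PIdl)
        then have "r \<otimes> c \<in> socle c" using PIdl_sub_socle[OF cc] by blast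
        then show "s \<in> socle c" unfolding * using F1 * X by (intro ideal_add[OF socle_ideal[OF cc]]) auto
      qed
      ultimately show "?S X \<in> {Xa \<in> {I. ideal I R}. PIdl c \<subseteq> Xa \<and> Xa \<subseteq> socle c}" by auto
      fix X' assume "X' \<in> {X \<in> {N. submodule N R HZ}. B \<subseteq> X \<and> X \<subseteq> Z}" "X \<subset> X'"
      then have X': "X' \<subseteq> Z" "X \<subset> X'" by auto
      then obtain f where f: "f \<in> X'" "f \<notin> X" by auto
      have fZ: "f \<in> Z" using f X' by auto
      have "f w = f w \<oplus> \<zero> \<otimes> c" using fwc[OF fZ] cc by simp
      then have in': "f w \<in> ?S X'" using f fwc[OF fZ] by blast
      have notin: "f w \<notin> ?S X"
      proof
        assume "f w \<in> ?S X"
        then obtain g r where g: "g \<in> X" "r \<in> carrier R" "f w = g w \<oplus> r \<otimes> c" by auto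
        have gZ: "g \<in> Z" using g X by auto
        have "(f \<ominus>\<^bsub>HZ\<^esub> g) w = (g w \<oplus> r \<otimes> c) \<ominus> g w" using fwdiff[OF fZ gZ] g(3) by simp
        also have "\<dots> = r \<otimes> c" using fwc[OF gZ] g(2) cc by algebra
        finally have "(f \<ominus>\<^bsub>HZ\<^esub> g) w = r \<otimes> c" .
        then have "(f \<ominus>\<^bsub>HZ\<^esub> g) w \<in> PIdl c" using g by (auto simp: mem_PIdl)
        then have "f \<ominus>\<^bsub>HZ\<^esub> g \<in> B" using fZ gZ by (intro F2b) (auto simp: HZs(1)[symmetric])
        then have "(f \<ominus>\<^bsub>HZ\<^esub> g) \<oplus>\<^bsub>HZ\<^esub> g \<in> X" using X g by (intro HZ.submod_add[OF X(1)]) auto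
        moreover have "(f \<ominus>\<^bsub>HZ\<^esub> g) \<oplus>\<^bsub>HZ\<^esub> g = f" using fZ gZ unfolding HZs(1)[symmetric]
          by (simp add: a_minus_def HZ.M.a_assoc HZ.M.l_neg)
        ultimately show False using f by simp
      qed
      show "?S X \<subset> ?S X'" using in' notin X'(2) by blast
    qed
    show "ilen (PIdl c) (socle c) \<le> HZ.submods.len B Z"
      unfolding HZ.submods.len_def ideals.len_def
    proof (rule chain_height_le_map[where f = "\<lambda>K. {f \<in> Z. f w \<in> K}"])
      fix K assume "K \<in> {Xa \<in> {I. ideal I R}. PIdl c \<subseteq> Xa \<and> Xa \<subseteq> socle c}"
      then have K: "ideal K R" "PIdl c \<subseteq> K" "K \<subseteq> socle c" by auto
      have "submodule {f \<in> Z. f w \<in> K} R HZ"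
      proof (rule HZ.submoduleI')
        show "\<zero>\<^bsub>HZ\<^esub> \<in> {f \<in> Z. f w \<in> K}" using HZ.M.zero_closed ideal_zero[OF K(1)] w by (auto simp: HZs)
        fix f g assume "f \<in> {f \<in> Z. f w \<in> K}" "g \<in> {f \<in> Z. f w \<in> K}"
        then show "f \<oplus>\<^bsub>HZ\<^esub> g \<in> {f \<in> Z. f w \<in> K}" using HZ.M.add.m_closed[of f g] ideal_add[OF K(1)] fwadd
          by (auto simp: HZs(1))
      next
        fix a f assume "a \<in> carrier R" "f \<in> {f \<in> Z. f w \<in> K}"
        then show "a \<odot>\<^bsub>HZ\<^esub> f \<in> {f \<in> Z. f w \<in> K}" using HZ.smult_closed[of a f] ideal_mult[OF K(1)] fwsm
          by (auto simp: HZs(1))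
      qed (auto simp: HZs)
      then show "{f \<in> Z. f w \<in> K} \<in> {X \<in> {N. submodule N R HZ}. B \<subseteq> X \<and> X \<subseteq> Z}" using BZ F2a K by auto
      fix K' assume "K' \<in> {Xa \<in> {I. ideal I R}. PIdl c \<subseteq> Xa \<and> Xa \<subseteq> socle c}" "K \<subset> K'"
      then have K': "ideal K' R" "PIdl c \<subseteq> K'" "K' \<subseteq> socle c" "K \<subset> K'" by auto
      then obtain s where s: "s \<in> K'" "s \<notin> K" by auto
      then obtain f r where f: "f \<in> Z" "r \<in> carrier R" "s = f w \<oplus> r \<otimes> c" using F3 K' by blast
      have rc: "r \<otimes> c \<in> PIdl c" using f by (auto simp: mem_PIdl)
      have "f w \<in> K'" using ideal_add_cancel[OF K'(1) fwc[OF f(1)], of "r \<otimes> c"] s f rc K' by auto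
      moreover have "f w \<notin> K" using ideal_add[OF K(1), of "f w" "r \<otimes> c"] s f rc K by auto
      ultimately show "{f \<in> Z. f w \<in> K} \<subset> {f \<in> Z. f w \<in> K'}" using f K'(4) by blast
    qed
  qed
  finally show ?thesis .
qed

lemma length_Ext_one:
  assumes c: "c \<in> \<mm>" "nonzerodivisor c"
  shows "module_length R (Ext R 1 (residue_module R) (ring_module R)) = ilen (PIdl c) (socle c)"
proof -
  obtain k d \<epsilon> where some: "(SOME (k, d, \<epsilon>). free_resolution R (residue_module R) k d \<epsilon>) = (k, d, \<epsilon>)"
    by (metis prod_cases3)
  have "\<exists>t. case t of (k, d, \<epsilon>) \<Rightarrow> free_resolution R (residue_module R) k d \<epsilon>"
    using residue_resolution by auto
  then have "case (SOME (k, d, \<epsilon>). free_resolution R (residue_module R) k d \<epsilon>) of (k, d, \<epsilon>) \<Rightarrow> free_resolution R (residue_module R) k d \<epsilon>"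
    by (rule someI_ex)
  then have "free_resolution R (residue_module R) k d \<epsilon>" unfolding some by simp
  then show ?thesis unfolding Ext_def some using length_Ext_of_resolution[OF _ c] by simp
qed

text \<open>Valid for every nonzerodivisor \<open>c\<close> in the maximal ideal; in the
  idealization of an ideal this freedom allows the choice of an element
  \<open>(c, 0)\<close>.\<close>

lemma cm_type_eq:
  assumes "krull_dim R = 1" "c \<in> \<mm>" "nonzerodivisor c"
  shows "cm_type R = ilen (PIdl c) (socle c)"
  unfolding cm_type_def using length_Ext_one[OF assms(2,3)] assms(1) by (simp add: one_enat_def)

end

section \<open>Cohen--Macaulay local rings of dimension one\<close>

lemma (in cring) Idl_empty: "Idl {} = {\<zero>}"
  using genideal_minimal[OF zeroideal, of "{}"] ideal_zero[OF genideal_ideal[of "{}"]] by auto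

context noetherian_local
begin

lemma \<mm>_prime: "primeideal \<mm> R"
  using \<mm>_maximal maximalideal_prime by simp

text \<open>A prime \<open>P\<close> containing a nonzerodivisor \<open>b\<close> is not minimal: a prime avoiding all \<open>b\<^sup>n t\<close> with
  \<open>t \<notin> P\<close> is strictly smaller.\<close>

lemma parameter_primary:
  assumes dim: "krull_dim R \<le> 1" and b: "b \<in> \<mm>" "nonzerodivisor b"
  shows "\<exists>u. ipow \<mm> u \<subseteq> PIdl b"
proof (rule ipow_subset_of_radical[OF \<mm>_ideal])
  have bc: "b \<in> carrier R" using b \<mm>_carr by simp
  show Pb: "ideal (PIdl b) R" by (rule cgenideal_ideal[OF bc])
  fix x assume x: "x \<in> \<mm>"
  have xc: "x \<in> carrier R" using x \<mm>_carr by simp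
  show "\<exists>n::nat. x [^] n \<in> PIdl b"
  proof (rule ccontr)
    assume neg: "\<not> ?thesis"
    obtain P where P: "primeideal P R" "PIdl b \<subseteq> P" "P \<inter> range (\<lambda>n::nat. x [^] n) = {}"
    proof (rule prime_avoiding[OF Pb])
      show "range (\<lambda>n::nat. x [^] n) \<subseteq> carrier R" using xc by auto
      show "\<one> \<in> range (\<lambda>n::nat. x [^] n)" by (rule range_eqI[of _ _ 0]) simp
      show "s \<otimes> t \<in> range (\<lambda>n::nat. x [^] n)"
        if "s \<in> range (\<lambda>n::nat. x [^] n)" "t \<in> range (\<lambda>n::nat. x [^] n)" for s t
        using that xc by (auto simp: nat_pow_mult)
      show "PIdl b \<inter> range (\<lambda>n::nat. x [^] n) = {}" using neg by auto
    qed
    interpret P: primeideal P R by (rule P(1))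
    have "x [^] (1::nat) \<in> range (\<lambda>n::nat. x [^] n)" by (rule rangeI)
    then have xP: "x \<notin> P" using P(3) xc by (auto simp: disjoint_iff)
    have bP: "b \<in> P" using P(2) cgenideal_self[OF bc] by auto
    have oneP: "\<one> \<notin> P" using P.I_notcarr P.one_imp_carrier by auto
    define S where "S = {s. \<exists>n::nat. \<exists>t\<in>carrier R - P. s = b [^] n \<otimes> t}"
    obtain P' where P': "primeideal P' R" "P' \<inter> S = {}"
    proof (rule prime_avoiding[OF zeroideal])
      show "S \<subseteq> carrier R" using bc by (auto simp: S_def)
      show "\<one> \<in> S" unfolding S_def using oneP by (auto intro!: exI[of _ "0::nat"] bexI[of _ \<one>])
      show "s \<otimes> s' \<in> S" if s: "s \<in> S" "s' \<in> S" for s s'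
      proof -
        obtain n t n' t'
          where t: "t \<in> carrier R - P" "s = b [^] (n::nat) \<otimes> t" "t' \<in> carrier R - P" "s' = b [^] (n'::nat) \<otimes> t'"
          using s unfolding S_def by blast
        have "s \<otimes> s' = (b [^] n \<otimes> b [^] n') \<otimes> (t \<otimes> t')" using t bc by (simp add: m_ac)
        also have "b [^] n \<otimes> b [^] n' = b [^] (n + n')" using bc by (simp add: nat_pow_mult)
        finally have "s \<otimes> s' = b [^] (n + n') \<otimes> (t \<otimes> t')" .
        moreover have "t \<otimes> t' \<in> carrier R - P" using t P.I_prime by auto
        ultimately show ?thesis unfolding S_def by blast
      qed
      show "{\<zero>} \<inter> S = {}"
      proof (rule ccontr)
        assume "{\<zero>} \<inter> S \<noteq> {}"
        then obtain n t where t: "t \<in> carrier R - P" "\<zero> = b [^] (n::nat) \<otimes> t" unfolding S_def by auto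
        then have "t = \<zero>" using nonzerodivisor_pow[OF b(2), of n] unfolding nonzerodivisor_def by auto
        then show False using t ideal_zero[OF P.is_ideal] by simp
      qed
    qed
    interpret P': primeideal P' R by (rule P'(1))
    have "P' \<subseteq> P"
    proof
      fix t assume t: "t \<in> P'"
      have tc: "t \<in> carrier R" using t P'.Icarr by simp
      show "t \<in> P"
      proof (rule ccontr)
        assume "t \<notin> P"
        then have "t \<in> S" unfolding S_def using tc by (auto intro!: exI[of _ "0::nat"] bexI[of _ t])
        then show False using t P'(2) by auto
      qed
    qed
    moreover have "b \<notin> P'"
    proof -
      have "b \<in> S" unfolding S_def using bc oneP by (auto intro!: exI[of _ "1::nat"] bexI[of _ \<one>])
      then show ?thesis using P'(2) by auto
    qed
    ultimately have "P' \<subset> P" using bP by auto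
    moreover have "P \<subset> \<mm>" using proper_ideal_sub[OF P.is_ideal] P.I_notcarr x xP by auto
    \<comment> \<open>The element \<open>b\<close> separates \<open>P'\<close> from
      \<open>P\<close>, and \<open>x\<close> separates \<open>P\<close> from \<open>\<mm>\<close>: a
      chain of primes of length two.\<close>
    ultimately have "enat 2 \<le> krull_dim R"
      unfolding krull_dim_def using P(1) P'(1) \<mm>_prime
      by (intro chain_height_geI[of 2 "\<lambda>i. if i = 0 then P' else if i = 1 then P else \<mm>"]) auto
    then have "enat 2 \<le> 1" using dim by (rule order_trans)
    then show False by (simp add: one_enat_def)
  qed
qed

end

text \<open>Positive depth yields a nonempty regular sequence in the maximal ideal. Its first
  element is regular modulo the ideal generated by the empty set, which is zero.\<close>

lemma cohen_macaulay_cm_local_one: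
  assumes "cohen_macaulay_local_ring R" "krull_dim R = 1"
  shows "\<exists>b. cm_local_one R (max_ideal R) b"
proof -
  interpret cohen_macaulay_local_ring R by fact
  interpret noetherian_local R "max_ideal R" by (rule noetherian_localI[OF noetherian_ring_axioms])
  have "0 < depth R" using depth_eq_dim assms(2) by simp
  then obtain xs where xs: "regular_sequence R xs" "set xs \<subseteq> max_ideal R" "0 < enat (length xs)"
    unfolding depth_def less_SUP_iff by auto
  have len: "0 < length xs" using xs(3) by (simp add: zero_enat_def)
  define b where "b = xs ! 0"
  have bm: "b \<in> max_ideal R" using xs(2) len by (auto simp: b_def)
  have "\<forall>a\<in>carrier R. b \<otimes>\<^bsub>R\<^esub> a \<in> genideal R {} \<longrightarrow> a \<in> genideal R {}"
    using xs(1) len unfolding regular_sequence_def b_def by force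
  then have bn: "nonzerodivisor b" unfolding nonzerodivisor_def Idl_empty using \<mm>_carr[OF bm] by auto
  have "cm_local_one R (max_ideal R) b"
    by unfold_locales (use bm bn parameter_primary[of b] assms(2) in auto)
  then show ?thesis by blast
qed

section \<open>Discrete valuation rings\<close>

context noetherian_local
begin

text \<open>The intersection \<open>K\<close> of all powers of \<open>xR\<close> satisfies
  \<open>K \<subseteq> \<mm> K\<close> and vanishes by Nakayama's lemma. Every nonzero element is
  therefore a unit times a power of \<open>x\<close>, which gives both integrality and
  principality.\<close>

lemma principal_max_ideal_DVR:
  assumes m: "\<mm> = PIdl x" and x: "nonzerodivisor x"
  shows "discrete_valuation_ring R"
proof -
  have xc: "x \<in> carrier R" using x by (rule nonzerodivisor_carr)
  have xm: "x \<in> \<mm>" using m cgenideal_self[OF xc] by simp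
  have pc: "x [^] n \<in> carrier R" for n :: nat using xc by simp
  have pid: "ideal (PIdl (x [^] n)) R" for n :: nat by (rule cgenideal_ideal[OF pc])
  define K where "K = {r \<in> carrier R. \<forall>n::nat. r \<in> PIdl (x [^] n)}"
  have K: "ideal K R" unfolding K_def
    by (rule idealI') (use pid ideal_zero ideal_add ideal_mult in auto)
  have "K \<subseteq> \<mm> \<cdot> K"
  proof
    fix k assume k: "k \<in> K"
    then have "k \<in> PIdl (x [^] (1::nat))" unfolding K_def by blast
    then obtain s where s: "s \<in> carrier R" "k = s \<otimes> x" using xc by (auto simp: mem_PIdl)
    have "s \<in> PIdl (x [^] n)" for n :: nat
    proof -
      have "k \<in> PIdl (x [^] Suc n)" using k unfolding K_def by blast
      then obtain c where c: "c \<in> carrier R" "k = c \<otimes> (x [^] n \<otimes> x)" by (auto simp: mem_PIdl)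
      then have "x \<otimes> s = x \<otimes> (c \<otimes> x [^] n)" using s xc by (simp add: m_ac)
      then have "s = c \<otimes> x [^] n" using nonzerodivisor_cancel[OF x] s c xc by simp
      then show ?thesis using c by (auto simp: mem_PIdl)
    qed
    then have "s \<in> K" using s by (simp add: K_def)
    then have "x \<otimes> s \<in> \<mm> \<cdot> K" using xm by (intro ideal_prod.prod)
    then show "k \<in> \<mm> \<cdot> K" using s xc by (simp add: m_comm)
  qed
  then have "K \<subseteq> {\<zero>} <+> \<mm> \<cdot> K"
    using set_add_upper2[OF zeroideal ideal_prod_is_ideal[OF \<mm>_ideal K]] by blast
  then have K0: "K \<subseteq> {\<zero>}" by (rule nakayama[OF zeroideal K])
  have rep: "\<exists>u\<in>Units R. \<exists>n::nat. r = u \<otimes> x [^] n" if r: "r \<in> carrier R" "r \<noteq> \<zero>" for r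
  proof -
    have "\<exists>n::nat. r \<notin> PIdl (x [^] n)" using K0 r by (auto simp: K_def)
    then obtain n where n: "r \<notin> PIdl (x [^] (n::nat))" "\<And>k. k < n \<Longrightarrow> r \<in> PIdl (x [^] k)"
      using exists_least_iff[of "\<lambda>n::nat. r \<notin> PIdl (x [^] n)"] by blast
    have "n \<noteq> 0"
    proof
      assume "n = 0"
      moreover have "r \<in> PIdl \<one>" unfolding mem_PIdl using r by (intro bexI[of _ r]) auto
      ultimately show False using n(1) by simp
    qed
    then obtain k where k: "n = Suc k" by (cases n) auto
    then have "r \<in> PIdl (x [^] k)" using n(2) by simp
    then obtain u where u: "u \<in> carrier R" "r = u \<otimes> x [^] k" by (auto simp: mem_PIdl)
    have "u \<notin> \<mm>"
    proof
      assume "u \<in> \<mm>"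
      then obtain c where "c \<in> carrier R" "u = c \<otimes> x" using m by (auto simp: mem_PIdl)
      then have "r = c \<otimes> x [^] n" using u xc k by (simp add: m_ac)
      then show False using n(1) \<open>c \<in> carrier R\<close> by (auto simp: mem_PIdl)
    qed
    then show ?thesis using u notin_\<mm>_Units by blast
  qed
  have one: "\<one> \<noteq> \<zero>" using one_notin_\<mm> ideal_zero[OF \<mm>_ideal] by auto
  have dom: "domain R"
  proof (rule domain.intro[OF is_cring], unfold_locales)
    show "\<one> \<noteq> \<zero>" by (rule one)
    fix r s assume rs: "r \<otimes> s = \<zero>" "r \<in> carrier R" "s \<in> carrier R"
    show "r = \<zero> \<or> s = \<zero>"
    proof (rule ccontr)
      assume "\<not> (r = \<zero> \<or> s = \<zero>)"
      then obtain u n v l where u: "u \<in> Units R" "r = u \<otimes> x [^] (n::nat)"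
        and v: "v \<in> Units R" "s = v \<otimes> x [^] (l::nat)"
        using rep rs by metis
      have uv: "u \<otimes> v \<in> Units R" "u \<otimes> v \<in> carrier R" using u v by auto
      have "(x [^] n \<otimes> x [^] l) \<otimes> (u \<otimes> v) = r \<otimes> s" using u v xc by (simp add: m_ac Units_closed)
      then have "u \<otimes> v = \<zero>"
        using nonzerodivisor_mult[OF nonzerodivisor_pow[OF x, of n] nonzerodivisor_pow[OF x, of l]] rs uv
        unfolding nonzerodivisor_def by auto
      then have "inv (u \<otimes> v) \<otimes> \<zero> = \<one>" using uv Units_l_inv by metis
      then show False using one uv by simp
    qed
  qed
  have "principal_domain R"
  proof (rule principal_domain.intro[OF dom], unfold_locales)
    fix I assume I: "ideal I R"
    show "\<exists>a\<in>carrier R. I = PIdl a"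
    proof (cases "I \<subseteq> {\<zero>}")
      case True
      then have "I = {\<zero>}" using ideal_zero[OF I] by auto
      moreover have "PIdl \<zero> = {\<zero>}" using zero_closed by (force simp: mem_PIdl)
      ultimately show ?thesis by (intro bexI[of _ \<zero>]) auto
    next
      case False
      have unit: "\<exists>n::nat. x [^] n \<in> I \<and> r \<in> PIdl (x [^] n)" if r: "r \<in> I" "r \<noteq> \<zero>" for r
      proof -
        obtain u n where u: "u \<in> Units R" "r = u \<otimes> x [^] (n::nat)" using rep r ideal_carr[OF I] by metis
        have "inv u \<otimes> r = x [^] n" using u pc[of n] by (simp add: m_assoc[symmetric] Units_closed)
        then have "x [^] n \<in> I" using ideal_mult[OF I, of "inv u" r] u r by auto
        moreover have "r \<in> PIdl (x [^] n)" using u by (auto simp: mem_PIdl)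
        ultimately show ?thesis by blast
      qed
      have "\<exists>n::nat. x [^] n \<in> I" using unit False by blast
      then obtain n where n: "x [^] (n::nat) \<in> I" "\<And>k. k < n \<Longrightarrow> x [^] k \<notin> I"
        using exists_least_iff[of "\<lambda>n::nat. x [^] n \<in> I"] by blast
      have "I \<subseteq> PIdl (x [^] n)"
      proof
        fix r assume r: "r \<in> I"
        show "r \<in> PIdl (x [^] n)"
        proof (cases "r = \<zero>")
          case True then show ?thesis using ideal_zero[OF pid] by simp
        next
          case False
          then obtain k where k: "x [^] (k::nat) \<in> I" "r \<in> PIdl (x [^] k)" using unit r by blast
          then have "n \<le> k" using n(2) not_le by blast
          then have "x [^] k = x [^] (k - n) \<otimes> x [^] n" using xc by (simp add: nat_pow_mult)
          then have "x [^] k \<in> PIdl (x [^] n)" using pc by (auto simp: mem_PIdl)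
          then show ?thesis using k(2) cgenideal_minimal[OF pid] by blast
        qed
      qed
      then have "I = PIdl (x [^] n)" using cgenideal_minimal[OF I n(1)] by auto
      then show ?thesis using pc by blast
    qed
  qed
  moreover have "\<not> field R"
  proof
    assume "field R"
    then have U: "Units R = carrier R - {\<zero>}" by (rule field.field_Units)
    have "x \<noteq> \<zero>" using x one unfolding nonzerodivisor_def by auto
    then have "x \<in> Units R" using U xc by auto
    then have "\<mm> = carrier R" using unit_in_ideal[OF \<mm>_ideal xm] by simp
    then show False using one_notin_\<mm> by simp
  qed
  ultimately show ?thesis unfolding discrete_valuation_ring_def using is_local_ring by simp
qed

text \<open>A zero generator of \<open>\<mm>\<close> would make every nonzero element a unit, so
  \<open>R\<close> would be a field.\<close>

lemma DVR_uniformizer: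
  assumes "discrete_valuation_ring R"
  obtains x where "\<mm> = PIdl x" "nonzerodivisor x"
proof -
  interpret pd: principal_domain R using assms by (simp add: discrete_valuation_ring_def)
  obtain x where x: "x \<in> carrier R" "\<mm> = PIdl x" using pd.exists_gen[OF \<mm>_ideal] by blast
  have "x \<noteq> \<zero>"
  proof
    assume "x = \<zero>"
    then have "\<mm> = {\<zero>}" using x by (force simp: mem_PIdl)
    then have "carrier R - {\<zero>} \<subseteq> Units R" using notin_\<mm>_Units by auto
    moreover have "\<zero> \<notin> Units R"
      using unit_in_ideal[OF zeroideal, of \<zero>] one_closed one_notin_\<mm> unfolding \<open>\<mm> = {\<zero>}\<close> by (metis singletonI)
    ultimately have "Units R = carrier R - {\<zero>}" by auto
    then have "field R" using pd.domain_axioms by (simp add: field_def field_axioms_def)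
    then show False using assms by (simp add: discrete_valuation_ring_def)
  qed
  then have "nonzerodivisor x" unfolding nonzerodivisor_def using x pd.integral by blast
  then show ?thesis using that x by blast
qed

text \<open>Suppose \<open>s t = b r\<close> with a unit \<open>r\<close>. Then \<open>s\<close> and
  \<open>t\<close> are nonzerodivisors. For \<open>y\<close> in \<open>\<mm>\<close>, the product
  \<open>s y\<close> is a multiple of \<open>b\<close>, hence of \<open>s t\<close>, and cancelling
  \<open>s\<close> puts \<open>y\<close> into \<open>tR\<close>. So \<open>t\<close> generates
  \<open>\<mm>\<close>, and \<open>R\<close> is a DVR.\<close>

lemma socle_mult_\<mm>:
  assumes b: "b \<in> \<mm>" "nonzerodivisor b" and nd: "\<not> discrete_valuation_ring R"
    and s: "s \<in> socle b" and t: "t \<in> \<mm>"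
  shows "\<exists>r\<in>\<mm>. s \<otimes> t = b \<otimes> r"
proof -
  have c: "b \<in> carrier R" "t \<in> carrier R" "s \<in> carrier R" using b t s \<mm>_carr by (auto simp: socle_def)
  have sm: "\<exists>r\<in>carrier R. s \<otimes> y = b \<otimes> r" if y: "y \<in> \<mm>" for y
  proof -
    have "y \<otimes> s \<in> PIdl b" using s y by (simp add: socle_def)
    then obtain r where "r \<in> carrier R" "y \<otimes> s = r \<otimes> b" by (auto simp: mem_PIdl)
    then show ?thesis using c y \<mm>_carr by (intro bexI[of _ r]) (auto simp: m_comm)
  qed
  obtain r where r: "r \<in> carrier R" "s \<otimes> t = b \<otimes> r" using sm[OF t] by blast
  have "r \<in> \<mm>"
  proof (rule ccontr)
    assume "r \<notin> \<mm>"
    then have u: "r \<in> Units R" using r notin_\<mm>_Units by simp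
    have "nonzerodivisor r" unfolding nonzerodivisor_def
    proof (intro conjI ballI impI r)
      fix y assume y: "y \<in> carrier R" "r \<otimes> y = \<zero>"
      have "y = (inv r \<otimes> r) \<otimes> y" using u y by simp
      also have "\<dots> = inv r \<otimes> (r \<otimes> y)" using u y r by (intro m_assoc) auto
      finally show "y = \<zero>" using y u by simp
    qed
    then have st: "nonzerodivisor (s \<otimes> t)" unfolding r(2) using b nonzerodivisor_mult by blast
    have sn: "nonzerodivisor s" using nonzerodivisor_factor[OF st] c by simp
    have tn: "nonzerodivisor t" using nonzerodivisor_factor[of t s] st c by (simp add: m_comm)
    have "\<mm> \<subseteq> PIdl t"
    proof
      fix y assume y: "y \<in> \<mm>"
      have yc: "y \<in> carrier R" using y \<mm>_carr by simp
      obtain r' where r': "r' \<in> carrier R" "s \<otimes> y = b \<otimes> r'" using sm[OF y] by blast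
      define q where "q = inv r \<otimes> r'"
      have q: "q \<in> carrier R" using u r' by (simp add: q_def)
      have "r \<otimes> q = (r \<otimes> inv r) \<otimes> r'" unfolding q_def using u r r' by (intro m_assoc[symmetric]) auto
      then have rq: "r \<otimes> q = r'" using u r' by simp
      have "s \<otimes> (t \<otimes> q) = (s \<otimes> t) \<otimes> q" using c q by (simp add: m_assoc)
      also have "\<dots> = b \<otimes> (r \<otimes> q)" unfolding r(2) using c r q by (simp add: m_assoc)
      also have "\<dots> = s \<otimes> y" using rq r' by simp
      finally have "t \<otimes> q = y" using nonzerodivisor_cancel[OF sn] c q yc by simp
      then have "y = q \<otimes> t" using c q by (simp add: m_comm)
      then show "y \<in> PIdl t" using q by (auto simp: mem_PIdl)
    qed
    then have "\<mm> = PIdl t" using cgenideal_minimal[OF \<mm>_ideal t] by auto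
    then show False using principal_max_ideal_DVR[OF _ tn] nd by blast
  qed
  then show ?thesis using r by blast
qed

end

section \<open>Idealizations of ideals\<close>

locale ring_with_ideal = cring R for R :: "('a, 'm) ring_scheme" (structure) +
  fixes I assumes I: "ideal I R"
begin

abbreviation A :: "('a \<times> 'a) ring" where "A \<equiv> idealization R (ideal_module R I)"

lemma idealization_simps:
  "carrier A = carrier R \<times> I"
  "(a, x) \<otimes>\<^bsub>A\<^esub> (b, y) = (a \<otimes> b, a \<otimes> y \<oplus> b \<otimes> x)"
  "(a, x) \<oplus>\<^bsub>A\<^esub> (b, y) = (a \<oplus> b, x \<oplus> y)"
  "\<one>\<^bsub>A\<^esub> = (\<one>, \<zero>)" "\<zero>\<^bsub>A\<^esub> = (\<zero>, \<zero>)"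
  by (simp_all add: idealization_def ring_module_simps)

lemma I_carr: "x \<in> I \<Longrightarrow> x \<in> carrier R" by (rule ideal_carr[OF I])

lemma idealization_cring: "cring A"
proof (rule cringI)
  note If = ideal_zero[OF I] ideal_add[OF I] ideal_mult[OF I] ideal_mult'[OF I] ideal_neg[OF I]
  show "abelian_group A"
  proof (rule abelian_groupI)
    fix p assume "p \<in> carrier A"
    then obtain a x where "p = (a, x)" "a \<in> carrier R" "x \<in> I" by (auto simp: idealization_simps)
    then show "\<exists>q\<in>carrier A. q \<oplus>\<^bsub>A\<^esub> p = \<zero>\<^bsub>A\<^esub>"
      using If I_carr by (intro bexI[of _ "(\<ominus> a, \<ominus> x)"]) (auto simp: idealization_simps l_neg)
  qed (use If I_carr in \<open>auto simp: idealization_simps a_ac\<close>)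
  show "comm_monoid A"
  proof (rule comm_monoidI)
    show "p \<otimes>\<^bsub>A\<^esub> q \<in> carrier A" if "p \<in> carrier A" "q \<in> carrier A" for p q
      using that If by (auto simp: idealization_simps)
  qed (use If I_carr in \<open>auto simp: idealization_simps m_ac r_distr l_distr a_ac\<close>)
qed (use I_carr in \<open>auto simp: idealization_simps r_distr l_distr m_ac a_ac\<close>)

sublocale A: cring A by (rule idealization_cring)

text \<open>Ideals of the idealization need not be products of ideals. This ideal and those of the
  next two lemmas, the trace on \<open>0 \<times> I\<close>, the projection to \<open>R\<close> and
  the trace on \<open>R \<times> 0\<close>, replace the missing factors.\<close>

lemma idealization_ideal_snd:
  assumes K: "ideal K A" shows "ideal {y \<in> I. (\<zero>, y) \<in> K} R"
proof (rule idealI')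
  show "\<zero> \<in> {y \<in> I. (\<zero>, y) \<in> K}" using A.ideal_zero[OF K] ideal_zero[OF I] by (simp add: idealization_simps)
  fix x y assume "x \<in> {y \<in> I. (\<zero>, y) \<in> K}" "y \<in> {y \<in> I. (\<zero>, y) \<in> K}"
  then show "x \<oplus> y \<in> {y \<in> I. (\<zero>, y) \<in> K}" using A.ideal_add[OF K, of "(\<zero>, x)" "(\<zero>, y)"] ideal_add[OF I]
    by (simp add: idealization_simps)
next
  fix r x assume "r \<in> carrier R" "x \<in> {y \<in> I. (\<zero>, y) \<in> K}"
  then show "r \<otimes> x \<in> {y \<in> I. (\<zero>, y) \<in> K}"
    using A.ideal_mult[OF K, of "(r, \<zero>)" "(\<zero>, x)"] ideal_mult[OF I] ideal_zero[OF I] I_carr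
      by (simp add: idealization_simps)
qed (use I_carr in auto)

lemma idealization_ideal_fst:
  assumes K: "ideal K A" shows "ideal {r. \<exists>x. (r, x) \<in> K} R"
proof (rule idealI')
  have Kc: "p \<in> K \<Longrightarrow> p \<in> carrier R \<times> I" for p using A.ideal_carr[OF K] by (simp add: idealization_simps)
  show "{r. \<exists>x. (r, x) \<in> K} \<subseteq> carrier R" using Kc by auto
  show "\<zero> \<in> {r. \<exists>x. (r, x) \<in> K}" using A.ideal_zero[OF K] by (auto simp: idealization_simps)
  fix r s assume "r \<in> {r. \<exists>x. (r, x) \<in> K}" "s \<in> {r. \<exists>x. (r, x) \<in> K}"
  then obtain x y where "(r, x) \<in> K" "(s, y) \<in> K" by auto
  then have "(r \<oplus> s, x \<oplus> y) \<in> K" using A.ideal_add[OF K, of "(r, x)" "(s, y)"]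
    by (simp add: idealization_simps)
  then show "r \<oplus> s \<in> {r. \<exists>x. (r, x) \<in> K}" by auto
next
  fix a r assume a: "a \<in> carrier R" and "r \<in> {r. \<exists>x. (r, x) \<in> K}"
  then obtain x where "(r, x) \<in> K" by auto
  then have "(a, \<zero>) \<otimes>\<^bsub>A\<^esub> (r, x) \<in> K" using a ideal_zero[OF I]
    by (intro A.ideal_mult[OF K]) (simp add: idealization_simps)
  then show "a \<otimes> r \<in> {r. \<exists>x. (r, x) \<in> K}" by (auto simp: idealization_simps)
qed

lemma idealization_ideal_fst0:
  assumes K: "ideal K A" shows "ideal {r \<in> carrier R. (r, \<zero>) \<in> K} R"
proof (rule idealI')
  show "\<zero> \<in> {r \<in> carrier R. (r, \<zero>) \<in> K}" using A.ideal_zero[OF K] by (auto simp: idealization_simps)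
  fix r s assume "r \<in> {r \<in> carrier R. (r, \<zero>) \<in> K}" "s \<in> {r \<in> carrier R. (r, \<zero>) \<in> K}"
  then show "r \<oplus> s \<in> {r \<in> carrier R. (r, \<zero>) \<in> K}" using A.ideal_add[OF K, of "(r, \<zero>)" "(s, \<zero>)"]
    by (simp add: idealization_simps)
next
  fix a r assume a: "a \<in> carrier R" and r: "r \<in> {r \<in> carrier R. (r, \<zero>) \<in> K}"
  then show "a \<otimes> r \<in> {r \<in> carrier R. (r, \<zero>) \<in> K}"
    using A.ideal_mult[OF K, of "(a, \<zero>)" "(r, \<zero>)"] ideal_zero[OF I] by (simp add: idealization_simps)
qed auto

lemma idealization_ideal_split:
  assumes K: "ideal K A" and x: "(\<zero>, x) \<in> K" and r: "r \<in> carrier R" "y \<in> I" "x \<in> I"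
  shows "(r, y \<oplus> x) \<in> K \<longleftrightarrow> (r, y) \<in> K"
proof
  assume "(r, y) \<in> K"
  then show "(r, y \<oplus> x) \<in> K" using A.ideal_add[OF K, of "(r, y)" "(\<zero>, x)"] x r
    by (simp add: idealization_simps)
next
  assume "(r, y \<oplus> x) \<in> K"
  moreover have "(r, y) \<oplus>\<^bsub>A\<^esub> (\<zero>, x) = (r, y \<oplus> x)" using r by (simp add: idealization_simps)
  ultimately show "(r, y) \<in> K" using A.ideal_add_cancel[OF K, of "(r, y)" "(\<zero>, x)"] x r
    by (simp add: idealization_simps)
qed

text \<open>The condition on \<open>V\<close> and \<open>T\<close> comes from the mixed term
  \<open>v x\<close> in \<open>(a, x) (v, t) = (a v, a t + v x)\<close>.\<close>

lemma idealization_prod_ideal: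
  assumes V: "ideal V R" and T: "ideal T R" "T \<subseteq> I" and VT: "\<And>v z. \<lbrakk>v \<in> V; z \<in> I\<rbrakk> \<Longrightarrow> v \<otimes> z \<in> T"
  shows "ideal (V \<times> T) A"
proof (rule A.idealI')
  show "V \<times> T \<subseteq> carrier A" using ideal_carr[OF V] T by (auto simp: idealization_simps)
  show "\<zero>\<^bsub>A\<^esub> \<in> V \<times> T" using ideal_zero[OF V] ideal_zero[OF T(1)] by (simp add: idealization_simps)
  fix p q assume "p \<in> V \<times> T" "q \<in> V \<times> T"
  then show "p \<oplus>\<^bsub>A\<^esub> q \<in> V \<times> T" using ideal_add[OF V] ideal_add[OF T(1)] by (auto simp: idealization_simps)
next
  fix p q assume "p \<in> carrier A" "q \<in> V \<times> T"
  then show "p \<otimes>\<^bsub>A\<^esub> q \<in> V \<times> T"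
    using ideal_mult[OF V] ideal_add[OF T(1)] ideal_mult[OF T(1)] VT by (auto simp: idealization_simps)
qed

text \<open>Generators of the projection of \<open>J\<close> to \<open>R\<close> are lifted to
  \<open>J\<close>, and generators of the trace on \<open>0 \<times> I\<close> are added. Two
  elements of \<open>J\<close> with the same first component differ by an element of that
  trace.\<close>

lemma idealization_noetherian:
  assumes "noetherian_ring R" shows "noetherian_ring A"
proof (rule A.noetherian_ringI)
  interpret noetherian_cring R using assms is_cring by (simp add: noetherian_cring_def)
  fix J assume J: "ideal J A"
  have Jc: "p \<in> J \<Longrightarrow> p \<in> carrier R \<times> I" for p using A.ideal_carr[OF J] by (simp add: idealization_simps)
  obtain S where S: "finite S" "S \<subseteq> {r. \<exists>x. (r, x) \<in> J}" "{r. \<exists>x. (r, x) \<in> J} = Idl S"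
    using ideal_fin_gen[OF idealization_ideal_fst[OF J]] by blast
  obtain T where T: "finite T" "T \<subseteq> {y \<in> I. (\<zero>, y) \<in> J}" "{y \<in> I. (\<zero>, y) \<in> J} = Idl T"
    using ideal_fin_gen[OF idealization_ideal_snd[OF J]] by blast
  have "\<forall>r\<in>S. \<exists>x. (r, x) \<in> J" using S(2) by blast
  then obtain g where g: "\<And>r. r \<in> S \<Longrightarrow> (r, g r) \<in> J" by metis
  define G where "G = (\<lambda>r. (r, g r)) ` S \<union> (\<lambda>y. (\<zero>, y)) ` T"
  have GJ: "G \<subseteq> J" unfolding G_def using g T(2) by auto
  have Gc: "G \<subseteq> carrier A" using GJ Jc by (auto simp: idealization_simps)
  let ?K = "Idl\<^bsub>A\<^esub> G"
  have K: "ideal ?K A" by (rule A.genideal_ideal[OF Gc])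
  have GK: "G \<subseteq> ?K" by (rule A.genideal_self[OF Gc])
  have KJ: "?K \<subseteq> J" by (rule A.genideal_minimal[OF J GJ])
  have "J \<subseteq> ?K"
  proof
    fix p assume p: "p \<in> J"
    then obtain r x where rx: "p = (r, x)" "r \<in> carrier R" "x \<in> I" using Jc by fastforce
    have "S \<subseteq> {r. \<exists>x. (r, x) \<in> ?K}" using GK unfolding G_def by auto
    then have "Idl S \<subseteq> {r. \<exists>x. (r, x) \<in> ?K}" by (rule genideal_minimal[OF idealization_ideal_fst[OF K]])
    moreover have "r \<in> Idl S" using p rx S(3) by blast
    ultimately obtain y where y: "(r, y) \<in> ?K" by blast
    have yI: "y \<in> I" using y KJ Jc by auto
    have "T \<subseteq> {y \<in> I. (\<zero>, y) \<in> ?K}" using GK T(2) unfolding G_def by auto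
    then have T': "Idl T \<subseteq> {y \<in> I. (\<zero>, y) \<in> ?K}" by (rule genideal_minimal[OF idealization_ideal_snd[OF K]])
    define d where "d = x \<ominus> y"
    have d: "d \<in> I" using rx yI ideal_diff[OF I] by (simp add: d_def)
    have xe: "x = y \<oplus> d" unfolding d_def using I_carr[OF rx(3)] I_carr[OF yI] by algebra
    have "(r, d \<oplus> y) \<in> J \<and> (r, y) \<in> J" using p rx xe y KJ I_carr[OF d] I_carr[OF yI] by (auto simp: a_comm)
    then have "(\<zero>, d) \<in> J"
      using A.ideal_diff[OF J, of "(r, d \<oplus> y)" "(r, y)"] A.ideal_add_cancel[OF J, of "(\<zero>, d)" "(r, y)"] rx d yI
        by (simp add: idealization_simps)
    then have "(\<zero>, d) \<in> ?K" using T' T(3) d by blast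
    then show "p \<in> ?K" using idealization_ideal_split[OF K _ rx(2) yI d] y rx xe by simp
  qed
  then have "J = ?K" using KJ by auto
  then show "\<exists>G\<subseteq>carrier A. finite G \<and> J = Idl\<^bsub>A\<^esub> G" using Gc S(1) T(1)
    by (intro exI[of _ G]) (auto simp: G_def)
qed

lemma idealization_prime_snd:
  assumes P: "primeideal P A" and x: "x \<in> I" shows "(\<zero>, x) \<in> P"
proof -
  interpret P: primeideal P A by fact
  have "(\<zero>, x) \<otimes>\<^bsub>A\<^esub> (\<zero>, x) = \<zero>\<^bsub>A\<^esub>" using I_carr[OF x] by (simp add: idealization_simps)
  then show ?thesis using P.I_prime[of "(\<zero>, x)" "(\<zero>, x)"] A.ideal_zero[OF P.is_ideal] x
    by (auto simp: idealization_simps)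
qed

text \<open>Elements of \<open>0 \<times> I\<close> have square zero and so lie in every prime
  ideal. The primes of the idealization are thus the ideals \<open>P \<times> I\<close> with
  \<open>P\<close> prime in \<open>R\<close>.\<close>

lemma idealization_krull_dim: "krull_dim A = krull_dim R"
proof (rule antisym)
  note z = ideal_zero[OF I]
  show "krull_dim A \<le> krull_dim R" unfolding krull_dim_def
  proof (rule chain_height_le_map[where f = "\<lambda>P. {r \<in> carrier R. (r, \<zero>) \<in> P}"])
    fix P assume "P \<in> {P. primeideal P A}"
    then interpret P: primeideal P A by simp
    have "primeideal {r \<in> carrier R. (r, \<zero>) \<in> P} R"
    proof (rule primeidealI[OF idealization_ideal_fst0[OF P.is_ideal] is_cring])
      have "(\<one>, \<zero>) \<notin> P" using P.one_imp_carrier P.I_notcarr by (auto simp: idealization_simps)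
      then show "carrier R \<noteq> {r \<in> carrier R. (r, \<zero>) \<in> P}" by auto
      fix a b assume "a \<in> carrier R" "b \<in> carrier R" "a \<otimes> b \<in> {r \<in> carrier R. (r, \<zero>) \<in> P}"
      then show "a \<in> {r \<in> carrier R. (r, \<zero>) \<in> P} \<or> b \<in> {r \<in> carrier R. (r, \<zero>) \<in> P}"
        using P.I_prime[of "(a, \<zero>)" "(b, \<zero>)"] z by (auto simp: idealization_simps)
    qed
    then show "{r \<in> carrier R. (r, \<zero>) \<in> P} \<in> {P. primeideal P R}" by simp
    fix P' assume "P' \<in> {P. primeideal P A}" and lt: "P \<subset> P'"
    then interpret P': primeideal P' A by simp
    obtain r x where rx: "(r, x) \<in> P'" "(r, x) \<notin> P" using lt by auto
    have c: "r \<in> carrier R" "x \<in> I" using P'.Icarr[OF rx(1)] by (auto simp: idealization_simps)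
    have "(r, \<zero>) \<in> P'"
      using idealization_ideal_split[OF P'.is_ideal idealization_prime_snd[OF P'.primeideal c(2)] c(1) z c(2)] rx(1) I_carr[OF c(2)]
        by simp
    moreover have "(r, \<zero>) \<notin> P"
      using idealization_ideal_split[OF P.is_ideal idealization_prime_snd[OF P.primeideal c(2)] c(1) z c(2)] rx(2) I_carr[OF c(2)]
        by simp
    ultimately show "{r \<in> carrier R. (r, \<zero>) \<in> P} \<subset> {r \<in> carrier R. (r, \<zero>) \<in> P'}" using lt c by blast
  qed
  show "krull_dim R \<le> krull_dim A" unfolding krull_dim_def
  proof (rule chain_height_le_map[where f = "\<lambda>P. P \<times> I"])
    fix P assume "P \<in> {P. primeideal P R}"
    then interpret P: primeideal P R by simp
    have id: "ideal (P \<times> I) A"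
      by (rule idealization_prod_ideal[OF P.is_ideal I order_refl]) (use ideal_mult[OF I] P.Icarr in auto)
    have "primeideal (P \<times> I) A"
    proof (rule primeidealI[OF id idealization_cring])
      show "carrier A \<noteq> P \<times> I" using P.I_notcarr z by (auto simp: idealization_simps)
      fix p q assume "p \<in> carrier A" "q \<in> carrier A" "p \<otimes>\<^bsub>A\<^esub> q \<in> P \<times> I"
      moreover then obtain a x b y
        where "p = (a, x)" "q = (b, y)" "a \<in> carrier R" "b \<in> carrier R" "x \<in> I" "y \<in> I"
        by (auto simp: idealization_simps)
      ultimately show "p \<in> P \<times> I \<or> q \<in> P \<times> I" using P.I_prime[of a b] by (auto simp: idealization_simps)
    qed
    then show "P \<times> I \<in> {P. primeideal P A}" by simp
    fix P' assume "P \<subset> P'"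
    then show "P \<times> I \<subset> P' \<times> I" using z by auto
  qed
qed

text \<open>An intermediate ideal contains \<open>V \<times> 0\<close> and is determined by its
  trace on \<open>0 \<times> I\<close>. The next lemma is the counterpart with the second factor
  fixed.\<close>

lemma idealization_ilen_snd:
  assumes V: "ideal V R" and T: "ideal T0 R" "ideal T1 R" "T1 \<subseteq> I" and VT: "\<And>v z. \<lbrakk>v \<in> V; z \<in> I\<rbrakk> \<Longrightarrow> v \<otimes> z \<in> T0"
  shows "A.ilen (V \<times> T0) (V \<times> T1) = ilen T0 T1"
proof (rule antisym)
  show "A.ilen (V \<times> T0) (V \<times> T1) \<le> ilen T0 T1" unfolding A.ideals.len_def ideals.len_def
  proof (rule chain_height_le_map[where f = "\<lambda>K. {y \<in> I. (\<zero>, y) \<in> K}"])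
    fix K assume "K \<in> {X \<in> {I. ideal I A}. V \<times> T0 \<subseteq> X \<and> X \<subseteq> V \<times> T1}"
    then have K: "ideal K A" "V \<times> T0 \<subseteq> K" "K \<subseteq> V \<times> T1" by auto
    have T0: "T0 \<subseteq> T1" using K ideal_zero[OF V] by blast
    show "{y \<in> I. (\<zero>, y) \<in> K} \<in> {X \<in> {I. ideal I R}. T0 \<subseteq> X \<and> X \<subseteq> T1}"
      using idealization_ideal_snd[OF K(1)] K T(3) T0 ideal_zero[OF V] by auto
    fix K' assume "K' \<in> {X \<in> {I. ideal I A}. V \<times> T0 \<subseteq> X \<and> X \<subseteq> V \<times> T1}" and lt: "K \<subset> K'"
    then have K': "ideal K' A" "V \<times> T0 \<subseteq> K'" "K' \<subseteq> V \<times> T1" by auto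
    obtain v y where vy: "(v, y) \<in> K'" "(v, y) \<notin> K" using lt by auto
    have c: "v \<in> V" "y \<in> T1" using vy K' by auto
    have c': "v \<in> carrier R" "y \<in> I" "y \<in> carrier R" using c ideal_carr[OF V] T(3) I_carr by auto
    have v0: "(v, \<zero>) \<in> K" using K(2) c ideal_zero[OF T(1)] by auto
    have "(\<zero>, y) \<in> K'"
      using A.ideal_add_cancel[OF K'(1), of "(\<zero>, y)" "(v, \<zero>)"] v0 lt vy c' by (auto simp: idealization_simps)
    moreover have "(\<zero>, y) \<notin> K"
      using A.ideal_add[OF K(1), of "(\<zero>, y)" "(v, \<zero>)"] v0 vy c' by (auto simp: idealization_simps)
    ultimately show "{y \<in> I. (\<zero>, y) \<in> K} \<subset> {y \<in> I. (\<zero>, y) \<in> K'}" using lt c' by blast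
  qed
  show "ilen T0 T1 \<le> A.ilen (V \<times> T0) (V \<times> T1)" unfolding A.ideals.len_def ideals.len_def
  proof (rule chain_height_le_map[where f = "\<lambda>T. V \<times> T"])
    fix X assume X: "X \<in> {X \<in> {I. ideal I R}. T0 \<subseteq> X \<and> X \<subseteq> T1}"
    have "ideal (V \<times> X) A" by (rule idealization_prod_ideal[OF V]) (use X T VT in auto)
    then show "V \<times> X \<in> {X \<in> {I. ideal I A}. V \<times> T0 \<subseteq> X \<and> X \<subseteq> V \<times> T1}" using X by auto
    fix Y assume "X \<subset> Y"
    then show "V \<times> X \<subset> V \<times> Y" using ideal_zero[OF V] by auto
  qed
qed

lemma idealization_ilen_fst:
  assumes V: "ideal V0 R" "ideal V1 R" and T: "ideal T R" "T \<subseteq> I" and VT: "\<And>v z. \<lbrakk>v \<in> V1; z \<in> I\<rbrakk> \<Longrightarrow> v \<otimes> z \<in> T"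
  shows "A.ilen (V0 \<times> T) (V1 \<times> T) = ilen V0 V1"
proof (rule antisym)
  note z = ideal_zero[OF I]
  show "A.ilen (V0 \<times> T) (V1 \<times> T) \<le> ilen V0 V1" unfolding A.ideals.len_def ideals.len_def
  proof (rule chain_height_le_map[where f = "\<lambda>K. {r \<in> carrier R. (r, \<zero>) \<in> K}"])
    fix K assume "K \<in> {X \<in> {I. ideal I A}. V0 \<times> T \<subseteq> X \<and> X \<subseteq> V1 \<times> T}"
    then have K: "ideal K A" "V0 \<times> T \<subseteq> K" "K \<subseteq> V1 \<times> T" by auto
    show "{r \<in> carrier R. (r, \<zero>) \<in> K} \<in> {X \<in> {I. ideal I R}. V0 \<subseteq> X \<and> X \<subseteq> V1}"
      using idealization_ideal_fst0[OF K(1)] K ideal_zero[OF T(1)] ideal_carr[OF V(1)] by auto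
    fix K' assume "K' \<in> {X \<in> {I. ideal I A}. V0 \<times> T \<subseteq> X \<and> X \<subseteq> V1 \<times> T}" and lt: "K \<subset> K'"
    then have K': "ideal K' A" "V0 \<times> T \<subseteq> K'" "K' \<subseteq> V1 \<times> T" by auto
    obtain v y where vy: "(v, y) \<in> K'" "(v, y) \<notin> K" using lt by auto
    have c: "v \<in> V1" "y \<in> T" using vy K' by auto
    have c': "v \<in> carrier R" "y \<in> I" "y \<in> carrier R" using c ideal_carr[OF V(2)] T(2) I_carr by auto
    have y0: "(\<zero>, y) \<in> K" using K(2) c ideal_zero[OF V(1)] by auto
    have "(v, \<zero>) \<in> K'" using idealization_ideal_split[OF K'(1) _ c'(1) z c'(2)] y0 lt vy c' by auto
    moreover have "(v, \<zero>) \<notin> K" using idealization_ideal_split[OF K(1) y0 c'(1) z c'(2)] vy c' by auto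
    ultimately show "{r \<in> carrier R. (r, \<zero>) \<in> K} \<subset> {r \<in> carrier R. (r, \<zero>) \<in> K'}" using lt c' by blast
  qed
  show "ilen V0 V1 \<le> A.ilen (V0 \<times> T) (V1 \<times> T)" unfolding A.ideals.len_def ideals.len_def
  proof (rule chain_height_le_map[where f = "\<lambda>V. V \<times> T"])
    fix X assume X: "X \<in> {X \<in> {I. ideal I R}. V0 \<subseteq> X \<and> X \<subseteq> V1}"
    have "ideal (X \<times> T) A" by (rule idealization_prod_ideal) (use X T VT in auto)
    then show "X \<times> T \<in> {X \<in> {I. ideal I A}. V0 \<times> T \<subseteq> X \<and> X \<subseteq> V1 \<times> T}" using X by auto
    fix Y assume "X \<subset> Y"
    then show "X \<times> T \<subset> Y \<times> T" using ideal_zero[OF T(1)] by auto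
  qed
qed

lemma idealization_nonzerodivisor:
  assumes "nonzerodivisor c" shows "A.nonzerodivisor (c, \<zero>)"
  unfolding A.nonzerodivisor_def
proof (intro conjI ballI impI)
  have cc: "c \<in> carrier R" using assms by (rule nonzerodivisor_carr)
  show "(c, \<zero>) \<in> carrier A" using cc ideal_zero[OF I] by (simp add: idealization_simps)
  fix p assume "p \<in> carrier A" "(c, \<zero>) \<otimes>\<^bsub>A\<^esub> p = \<zero>\<^bsub>A\<^esub>"
  then show "p = \<zero>\<^bsub>A\<^esub>" using assms cc I_carr by (auto simp: idealization_simps nonzerodivisor_def)
qed

end

section \<open>The type of the idealization of an ideal\<close>

context noetherian_local
begin

lemma idealization_noetherian_local:
  assumes I: "ideal I R"
  shows "noetherian_local (idealization R (ideal_module R I)) (\<mm> \<times> I)"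
proof -
  interpret E: ring_with_ideal R I by (intro ring_with_ideal.intro ring_with_ideal_axioms.intro is_cring I)
  have mI: "ideal (\<mm> \<times> I) E.A"
    by (rule E.idealization_prod_ideal[OF \<mm>_ideal I order_refl]) (use ideal_mult[OF I] \<mm>_carr in auto)
  show ?thesis
  proof (intro noetherian_local.intro noetherian_cring.intro noetherian_local_axioms.intro E.idealization_cring E.idealization_noetherian noetherian_ring_axioms mI)
    show "\<one>\<^bsub>E.A\<^esub> \<notin> \<mm> \<times> I" using one_notin_\<mm> by (simp add: E.idealization_simps)
    fix p assume "p \<in> carrier E.A" "p \<notin> \<mm> \<times> I"
    then obtain a x where p: "p = (a, x)" "a \<in> carrier R" "x \<in> I" "a \<notin> \<mm>" by (auto simp: E.idealization_simps)
    then have u: "a \<in> Units R" using notin_\<mm>_Units by simp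
    have xc: "x \<in> carrier R" using p E.I_carr by simp
    define i where "i = inv a"
    have i: "i \<in> carrier R" "a \<otimes> i = \<one>" using u by (auto simp: i_def)
    \<comment> \<open>The inverse of \<open>(a, x)\<close> is
      \<open>(a^-1, - a^-2 x)\<close>.\<close>
    define q where "q = (i, \<ominus> (i \<otimes> (i \<otimes> x)))"
    have qc: "q \<in> carrier E.A" using i p ideal_mult[OF I] ideal_neg[OF I]
      by (simp add: q_def E.idealization_simps)
    have "a \<otimes> (i \<otimes> (i \<otimes> x)) = (a \<otimes> i) \<otimes> (i \<otimes> x)" using i p xc by (intro m_assoc[symmetric]) auto
    then have "a \<otimes> \<ominus> (i \<otimes> (i \<otimes> x)) \<oplus> i \<otimes> x = \<zero>" using i p xc by (simp add: r_minus l_neg)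
    then have pq: "p \<otimes>\<^bsub>E.A\<^esub> q = \<one>\<^bsub>E.A\<^esub>" using i p by (simp add: q_def E.idealization_simps)
    then have "q \<otimes>\<^bsub>E.A\<^esub> p = \<one>\<^bsub>E.A\<^esub>" using E.A.m_comm qc p by (simp add: E.idealization_simps)
    moreover have "p \<in> carrier E.A" using p by (simp add: E.idealization_simps)
    ultimately show "p \<in> Units E.A" unfolding Units_def using pq qc by blast
  qed
qed

text \<open>The type is computed with \<open>(c, 0)\<close>, which generates
  \<open>cR \<times> cI\<close>. From \<open>(t, z) (s, y) = (t s, t y + s z)\<close>, with
  \<open>z = 0\<close> and with \<open>t = 0\<close>, the conditions on \<open>s\<close> and on
  \<open>y\<close> separate, so the socle is a product \<open>?U \<times> ?S\<close>. The
  intermediate ideal \<open>cR \<times> ?S\<close> splits the length into the two summands.\<close>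

lemma cm_type_idealization:
  assumes dim: "krull_dim R = 1" and c: "c \<in> \<mm>" "nonzerodivisor c" and I: "ideal I R"
  shows "cm_type (idealization R (ideal_module R I)) =
    ilen (scale c I) {y \<in> I. \<forall>t\<in>\<mm>. t \<otimes> y \<in> scale c I} +
    ilen (PIdl c) {s \<in> socle c. \<forall>z\<in>I. s \<otimes> z \<in> scale c I}"
proof -
  interpret E: ring_with_ideal R I by (intro ring_with_ideal.intro ring_with_ideal_axioms.intro is_cring I)
  interpret A: noetherian_local E.A "\<mm> \<times> I" by (rule idealization_noetherian_local[OF I])
  have cc: "c \<in> carrier R" using c \<mm>_carr by simp
  let ?S = "{y \<in> I. \<forall>t\<in>\<mm>. t \<otimes> y \<in> scale c I}" and ?U = "{s \<in> socle c. \<forall>z\<in>I. s \<otimes> z \<in> scale c I}"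
  note If = ideal_zero[OF I] ideal_add[OF I] ideal_mult[OF I]
  have cI: "ideal (scale c I) R" by (rule scale_ideal[OF cc I])
  have cIS: "scale c I \<subseteq> ?S" using scale_subset[OF I cc] ideal_mult[OF cI] \<mm>_carr by auto
  have S: "ideal ?S R"
  proof -
    have "?S = I \<inter> {d \<in> carrier R. \<forall>y\<in>\<mm>. y \<otimes> d \<in> scale c I}" using E.I_carr by auto
    then show ?thesis using ideal_inter[OF I colon_ideal[OF cI ideal_sub[OF \<mm>_ideal]]] by simp
  qed
  have sc: "s \<in> carrier R" if "s \<in> socle c" for s using that by (simp add: socle_def)
  have U: "ideal ?U R"
  proof -
    have "?U = socle c \<inter> {d \<in> carrier R. \<forall>y\<in>I. y \<otimes> d \<in> scale c I}" using E.I_carr sc by (auto simp: m_comm)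
    then show ?thesis using ideal_inter[OF socle_ideal[OF cc] colon_ideal[OF cI ideal_sub[OF I]]] by simp
  qed
  have P: "ideal (PIdl c) R" by (rule cgenideal_ideal[OF cc])
  have PcI: "v \<otimes> z \<in> scale c I" if "v \<in> PIdl c" "z \<in> I" for v z
    using that scale_eq_prod[OF cc I] by (auto intro: ideal_prod.prod)
  have PU: "PIdl c \<subseteq> ?U" using PIdl_sub_socle[OF cc] PcI by auto
  have PA: "PIdl\<^bsub>E.A\<^esub> (c, \<zero>) = (PIdl c) \<times> scale c I"
  proof
    show "PIdl\<^bsub>E.A\<^esub> (c, \<zero>) \<subseteq> (PIdl c) \<times> scale c I"
    proof
      fix p assume "p \<in> PIdl\<^bsub>E.A\<^esub> (c, \<zero>)"
      then obtain r x where "r \<in> carrier R" "x \<in> I" "p = (r, x) \<otimes>\<^bsub>E.A\<^esub> (c, \<zero>)" unfolding E.A.mem_PIdl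
        by (auto simp: E.idealization_simps)
      then show "p \<in> (PIdl c) \<times> scale c I" using cc E.I_carr
        by (auto simp: E.idealization_simps mem_PIdl scale_def)
    qed
    show "(PIdl c) \<times> scale c I \<subseteq> PIdl\<^bsub>E.A\<^esub> (c, \<zero>)"
    proof
      fix p assume "p \<in> (PIdl c) \<times> scale c I"
      then obtain r x where rx: "r \<in> carrier R" "x \<in> I" "p = (r \<otimes> c, c \<otimes> x)"
        by (auto simp: mem_PIdl scale_def)
      then have "p = (r, x) \<otimes>\<^bsub>E.A\<^esub> (c, \<zero>)" using cc E.I_carr[OF rx(2)] by (simp add: E.idealization_simps)
      then show "p \<in> PIdl\<^bsub>E.A\<^esub> (c, \<zero>)" unfolding E.A.mem_PIdl using rx
        by (intro bexI[of _ "(r, x)"]) (auto simp: E.idealization_simps)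
    qed
  qed
  have SA: "A.socle (c, \<zero>) = ?U \<times> ?S"
  proof
    show "A.socle (c, \<zero>) \<subseteq> ?U \<times> ?S"
    proof
      fix p assume p: "p \<in> A.socle (c, \<zero>)"
      then obtain s y where sy: "p = (s, y)" "s \<in> carrier R" "y \<in> I" unfolding A.socle_def
        by (auto simp: E.idealization_simps)
      have yc: "y \<in> carrier R" using sy E.I_carr by simp
      have k: "t \<otimes> s \<in> PIdl c \<and> t \<otimes> y \<oplus> s \<otimes> z \<in> scale c I" if "t \<in> \<mm>" "z \<in> I" for t z
        using p that unfolding A.socle_def PA sy(1) by (auto simp: E.idealization_simps)
      have "t \<otimes> s \<in> PIdl c \<and> t \<otimes> y \<in> scale c I" if "t \<in> \<mm>" for t
        using k[OF that If(1)] sy that \<mm>_carr yc by simp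
      moreover have "s \<otimes> z \<in> scale c I" if "z \<in> I" for z
        using k[OF ideal_zero[OF \<mm>_ideal] that] sy yc E.I_carr[OF that] by simp
      ultimately show "p \<in> ?U \<times> ?S" using sy by (auto simp: socle_def)
    qed
    show "?U \<times> ?S \<subseteq> A.socle (c, \<zero>)"
    proof
      fix p assume "p \<in> ?U \<times> ?S"
      then obtain s y where sy: "p = (s, y)" "s \<in> ?U" "y \<in> ?S" by auto
      have "q \<otimes>\<^bsub>E.A\<^esub> p \<in> (PIdl c) \<times> scale c I" if q: "q \<in> \<mm> \<times> I" for q
        using q sy ideal_add[OF cI] by (auto simp: E.idealization_simps socle_def)
      then show "p \<in> A.socle (c, \<zero>)" unfolding A.socle_def PA using sy sc by (auto simp: E.idealization_simps)
    qed
  qed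
  have SI: "?S \<subseteq> I" by auto
  have cIsub: "scale c I \<subseteq> I" by (rule scale_subset[OF I cc])
  have i1: "ideal ((PIdl c) \<times> scale c I) E.A" by (rule E.idealization_prod_ideal[OF P cI cIsub PcI])
  have i2: "ideal ((PIdl c) \<times> ?S) E.A" by (rule E.idealization_prod_ideal[OF P S SI]) (use PcI cIS in blast)
  have USv: "v \<otimes> z \<in> ?S" if "v \<in> ?U" "z \<in> I" for v z using that cIS by blast
  have i3: "ideal (?U \<times> ?S) E.A" by (rule E.idealization_prod_ideal[OF U S SI USv])
  have "cm_type E.A = E.A.ilen ((PIdl c) \<times> scale c I) (?U \<times> ?S)"
    using A.cm_type_eq[of "(c, \<zero>)"] E.idealization_krull_dim dim c If(1) E.idealization_nonzerodivisor[OF c(2)] PA SA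
      by simp
  also have "\<dots> = E.A.ilen ((PIdl c) \<times> scale c I) ((PIdl c) \<times> ?S) + E.A.ilen ((PIdl c) \<times> ?S) (?U \<times> ?S)"
    by (rule E.A.ilen_add[OF i1 i2 i3]) (use cIS PU in blast)+
  also have "E.A.ilen ((PIdl c) \<times> scale c I) ((PIdl c) \<times> ?S) = ilen (scale c I) ?S"
    by (rule E.idealization_ilen_snd[OF P cI S SI PcI])
  also have "E.A.ilen ((PIdl c) \<times> ?S) (?U \<times> ?S) = ilen (PIdl c) ?U"
    by (rule E.idealization_ilen_fst[OF P U S SI USv])
  finally show ?thesis .
qed

lemma max_primaryD:
  assumes "I \<in> max_primary_ideals R" shows "ideal I R" "\<exists>u. ipow \<mm> u \<subseteq> I"
proof -
  show I: "ideal I R" using assms by (simp add: max_primary_ideals_def primary_ideal_def)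
  have "ideal_radical R I = \<mm>" using assms max_ideal_eq by (simp add: max_primary_ideals_def)
  then show "\<exists>u. ipow \<mm> u \<subseteq> I"
    by (intro ipow_subset_of_radical[OF \<mm>_ideal I]) (auto simp: ideal_radical_def)
qed

lemma ipow_max_primary: "ipow \<mm> (Suc n) \<in> max_primary_ideals R"
proof -
  let ?I = "ipow \<mm> (Suc n)"
  have I: "ideal ?I R" by (rule ipow_ideal[OF \<mm>_ideal])
  have Im: "?I \<subseteq> \<mm>" using ipow_antimono[OF \<mm>_ideal, of 1 "Suc n"] ipow_1[OF \<mm>_ideal] by simp
  have rad: "ideal_radical R ?I = \<mm>"
  proof
    show "\<mm> \<subseteq> ideal_radical R ?I"
    proof
      fix x assume x: "x \<in> \<mm>"
      then have "x [^] Suc n \<in> ?I" using ipow_pow_closed[OF \<mm>_ideal, of x 1 "Suc n"] ipow_1[OF \<mm>_ideal]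
        by simp
      then show "x \<in> ideal_radical R ?I" unfolding ideal_radical_def using x \<mm>_carr by blast
    qed
    show "ideal_radical R ?I \<subseteq> \<mm>"
    proof
      fix x assume "x \<in> ideal_radical R ?I"
      then obtain k where k: "x \<in> carrier R" "x [^] (k::nat) \<in> ?I" unfolding ideal_radical_def by auto
      show "x \<in> \<mm>"
      proof (rule ccontr)
        assume "x \<notin> \<mm>"
        then have "x [^] k \<in> Units R" using k notin_\<mm>_Units by (simp add: Units_pow_closed)
        then show False using unit_in_ideal[OF \<mm>_ideal, of "x [^] k"] k Im one_notin_\<mm> by blast
      qed
    qed
  qed
  have "a \<in> ?I" if ab: "a \<in> carrier R" "b \<in> carrier R" "a \<otimes> b \<in> ?I" "b \<notin> \<mm>" for a b
  proof -
    have u: "b \<in> Units R" using ab notin_\<mm>_Units by simp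
    have "(a \<otimes> b) \<otimes> inv b \<in> ?I" using ideal_mult'[OF I _ ab(3)] u by simp
    then show ?thesis using ab u by (simp add: m_assoc)
  qed
  moreover have "?I \<noteq> carrier R" using Im one_notin_\<mm> by auto
  ultimately show ?thesis
    unfolding max_primary_ideals_def primary_ideal_def using I rad max_ideal_eq by blast
qed

text \<open>Take \<open>c = x\<close>, the uniformizer, and \<open>I = yR\<close>. As
  \<open>\<mm> I = x I\<close>, the first summand is the length of \<open>I / xI\<close>, which is
  one. The second vanishes because \<open>y\<close> divides a power of \<open>x\<close>, so it is a
  nonzerodivisor and cancels.\<close>

lemma cm_type_idealization_DVR:
  assumes dim: "krull_dim R = 1" and dvr: "discrete_valuation_ring R" and I: "I \<in> max_primary_ideals R"
  shows "cm_type (idealization R (ideal_module R I)) = 1"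
proof -
  obtain x where x: "\<mm> = PIdl x" "nonzerodivisor x" using DVR_uniformizer[OF dvr] .
  interpret pd: principal_domain R using dvr by (simp add: discrete_valuation_ring_def)
  have xc: "x \<in> carrier R" using x nonzerodivisor_carr by simp
  have xm: "x \<in> \<mm>" using x cgenideal_self[OF xc] by simp
  have Ii: "ideal I R" using max_primaryD[OF I] by simp
  obtain u where u: "ipow \<mm> u \<subseteq> I" using max_primaryD[OF I] by blast
  obtain y where y: "y \<in> carrier R" "I = PIdl y" using pd.exists_gen[OF Ii] by blast
  have xu: "x [^] u \<in> I" using ipow_pow_closed[OF \<mm>_ideal, of x 1 u] ipow_1[OF \<mm>_ideal] xm u by auto
  have yn: "nonzerodivisor y"
  proof -
    obtain r where "r \<in> carrier R" "x [^] u = y \<otimes> r" using xu y by (auto simp: mem_PIdl m_comm)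
    then show ?thesis using nonzerodivisor_factor[of y r] nonzerodivisor_pow[OF x(2), of u] y by simp
  qed
  have yI: "y \<in> I" using y cgenideal_self by simp
  have S: "{z \<in> I. \<forall>t\<in>\<mm>. t \<otimes> z \<in> scale x I} = I"
  proof -
    have "t \<otimes> z \<in> scale x I" if "z \<in> I" "t \<in> \<mm>" for t z
      using that unfolding scale_eq_prod[OF xc Ii] x(1) by (intro ideal_prod.prod)
    then show ?thesis by auto
  qed
  have xI: "ideal (scale x I) R" "scale x I \<subseteq> I" using scale_ideal[OF xc Ii] scale_subset[OF Ii xc] .
  have U: "{s \<in> socle x. \<forall>z\<in>I. s \<otimes> z \<in> scale x I} \<subseteq> PIdl x"
  proof
    fix s assume s: "s \<in> {s \<in> socle x. \<forall>z\<in>I. s \<otimes> z \<in> scale x I}"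
    then have sc: "s \<in> carrier R" by (simp add: socle_def)
    have "s \<otimes> y \<in> scale x I" using s yI by simp
    then obtain r where r: "r \<in> carrier R" "s \<otimes> y = x \<otimes> (r \<otimes> y)" unfolding y(2)
      by (auto simp: scale_def mem_PIdl)
    then have "y \<otimes> s = y \<otimes> (r \<otimes> x)" using y sc xc by (simp add: m_ac)
    then have "s = r \<otimes> x" using nonzerodivisor_cancel[OF yn] sc r xc by simp
    then show "s \<in> PIdl x" using r by (auto simp: mem_PIdl)
  qed
  have "ilen (PIdl x) {s \<in> socle x. \<forall>z\<in>I. s \<otimes> z \<in> scale x I} \<le> ilen (PIdl x) (PIdl x)" using U
    by (rule ideals.len_mono[OF order_refl])
  then have 2: "ilen (PIdl x) {s \<in> socle x. \<forall>z\<in>I. s \<otimes> z \<in> scale x I} = 0" using ideals.len_self by simp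
  have "ilen (scale x I) (PIdl y <+> scale x I) \<le> 1"
    by (rule ilen_principal_step[OF xI(1) y(1)]) (use yI x(1) scale_eq_prod[OF xc Ii] in \<open>auto intro: ideal_prod.prod\<close>)
  moreover have "PIdl y <+> scale x I = I"
    using set_add_upper1[of I "scale x I"] set_add_least[OF Ii order_refl xI(2)] Ii xI y by auto
  ultimately have le: "ilen (scale x I) I \<le> 1" by simp
  have "scale x I \<noteq> I"
  proof
    assume "scale x I = I"
    then have "y \<in> scale x I" using yI by simp
    then obtain r where r: "r \<in> carrier R" "y = x \<otimes> (r \<otimes> y)" unfolding y(2) by (auto simp: scale_def mem_PIdl)
    then have "y \<otimes> \<one> = y \<otimes> (x \<otimes> r)" using y xc by (simp add: m_ac)
    then have "\<one> = x \<otimes> r" using nonzerodivisor_cancel[OF yn, of \<one> "x \<otimes> r"] r xc by simp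
    then show False using ideal_mult'[OF \<mm>_ideal r(1) xm] one_notin_\<mm> by simp
  qed
  then have "ilen (scale x I) (scale x I) + 1 \<le> ilen (scale x I) I" using xI Ii by (intro ideals.len_Suc) auto
  then have "ilen (scale x I) I = 1" using le ideals.len_self by simp
  then show ?thesis using cm_type_idealization[OF dim xm x(2) Ii] S 2 by simp
qed

end

section \<open>The upper bound, and ideals that attain it\<close>

context cm_local_one
begin

lemma cm_type_idealization_le:
  assumes dim: "krull_dim R = 1" and I: "I \<in> max_primary_ideals R"
  shows "cm_type (idealization R (ideal_module R I)) \<le> cm_type R + enat mult_e"
proof -
  have Ii: "ideal I R" using max_primaryD[OF I] by simp
  obtain u where u: "mp u \<subseteq> I" using max_primaryD[OF I] by blast
  obtain v where v: "mp v \<subseteq> PIdl b" using b_primary by blast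
  let ?S = "{y \<in> I. \<forall>t\<in>\<mm>. t \<otimes> y \<in> scale b I}"
  have bI: "ideal (scale b I) R" by (rule scale_ideal[OF b_carr Ii])
  have S: "ideal ?S R"
  proof -
    have "?S = I \<inter> {d \<in> carrier R. \<forall>y\<in>\<mm>. y \<otimes> d \<in> scale b I}" using ideal_carr[OF Ii] by auto
    then show ?thesis using ideal_inter[OF Ii colon_ideal[OF bI ideal_sub[OF \<mm>_ideal]]] by simp
  qed
  \<comment> \<open>From \<open>\<mm>^v \<subseteq> bR\<close> and
    \<open>\<mm>^u \<subseteq> I\<close> it follows that \<open>?S\<close>, which contains
    \<open>b I\<close>, contains a power of \<open>\<mm>\<close>. This is what
    \<open>generators_le_mult\<close> asks for.\<close>
  have "mp (v + u) \<subseteq> (PIdl b) \<cdot> I" unfolding mp_add using u v by (intro ideal_prod_mono)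
  also have "(PIdl b) \<cdot> I \<subseteq> ?S"
    using scale_eq_prod[OF b_carr Ii] scale_subset[OF Ii b_carr] ideal_mult[OF bI] \<mm>_carr by auto
  finally have uS: "mp (v + u) \<subseteq> ?S" .
  have "\<mm> \<cdot> ?S \<subseteq> scale b I" by (rule ideal_prod_least[OF bI]) auto
  then have "ilen (scale b I) ?S \<le> ilen (\<mm> \<cdot> ?S) ?S" by (rule ideals.len_mono) simp
  also have "\<dots> \<le> enat mult_e" by (rule generators_le_mult[OF S uS])
  finally have 1: "ilen (scale b I) ?S \<le> enat mult_e" .
  have 2: "ilen (PIdl b) {s \<in> socle b. \<forall>z\<in>I. s \<otimes> z \<in> scale b I} \<le> cm_type R"
    unfolding cm_type_eq[OF dim b_\<mm> b_nzd] by (rule ideals.len_mono) auto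
  show ?thesis unfolding cm_type_idealization[OF dim b_\<mm> b_nzd Ii] using add_mono[OF 1 2]
    by (simp add: add.commute)
qed

lemma cm_type_idealization_attained:
  assumes dim: "krull_dim R = 1" and nd: "\<not> discrete_valuation_ring R"
  shows "\<exists>I\<in>max_primary_ideals R. cm_type R + enat mult_e \<le> cm_type (idealization R (ideal_module R I))"
proof -
  obtain n where n: "hilb n = enat mult_e" using mult_e(1) by blast
  let ?I = "mp (Suc n)"
  have bn: "scale b (mp n) \<subseteq> ?I"
    using ipow_mult_closed[OF \<mm>_ideal, of b 1 _ n] ipow_1[OF \<mm>_ideal] b_\<mm>
      by (auto simp: scale_def ideal_prod_commute \<mm>_ideal mp_ideal)
  \<comment> \<open>Since \<open>\<mm>\<close> times \<open>b \<mm>^n\<close> is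
    \<open>b \<mm>^(n+1)\<close>, the quotient of \<open>b \<mm>^n\<close> by
    \<open>b \<mm>^(n+1)\<close> counts in the first summand. Its length is \<open>hilb n\<close>,
    and \<open>n\<close> is a degree in which this equals \<open>mult_e\<close>.\<close>
  have "scale b (mp n) \<subseteq> {y \<in> ?I. \<forall>t\<in>\<mm>. t \<otimes> y \<in> scale b ?I}"
  proof
    fix y assume y: "y \<in> scale b (mp n)"
    then obtain z where z: "z \<in> mp n" "y = b \<otimes> z" by (auto simp: scale_def)
    have "t \<otimes> y \<in> scale b ?I" if t: "t \<in> \<mm>" for t
    proof -
      have "z \<otimes> t \<in> mp n \<cdot> \<mm>" using z t by (intro ideal_prod.prod)
      moreover have "t \<otimes> y = b \<otimes> (z \<otimes> t)" using z t \<mm>_carr mp_carr b_carr by (simp add: m_ac)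
      ultimately show ?thesis unfolding scale_def ipow_Suc by blast
    qed
    moreover have "y \<in> ?I" using y bn by (rule subsetD[rotated])
    ultimately show "y \<in> {y \<in> ?I. \<forall>t\<in>\<mm>. t \<otimes> y \<in> scale b ?I}" by simp
  qed
  then have "ilen (scale b ?I) (scale b (mp n)) \<le> ilen (scale b ?I) {y \<in> ?I. \<forall>t\<in>\<mm>. t \<otimes> y \<in> scale b ?I}"
    by (rule ideals.len_mono[OF order_refl])
  then have 1: "enat mult_e \<le> ilen (scale b ?I) {y \<in> ?I. \<forall>t\<in>\<mm>. t \<otimes> y \<in> scale b ?I}"
    using ilen_scale[OF b_nzd mp_ideal mp_ideal, of "Suc n" n] n unfolding hilb_def by metis
  \<comment> \<open>From \<open>s \<mm> \<subseteq> b \<mm>\<close>, multiplication by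
    \<open>\<mm>^n\<close> gives \<open>s \<mm>^(n+1) \<subseteq> b \<mm>^(n+1)\<close>. The second
    summand is therefore the full socle, that is, the type of \<open>R\<close>.\<close>
  have "s \<otimes> z \<in> scale b ?I" if s: "s \<in> socle b" and z: "z \<in> ?I" for s z
  proof -
    have sc: "s \<in> carrier R" using s by (simp add: socle_def)
    have bI: "ideal (scale b ?I) R" by (rule scale_ideal[OF b_carr mp_ideal])
    have K: "ideal {d \<in> carrier R. \<forall>y\<in>{s}. y \<otimes> d \<in> scale b ?I} R"
      by (rule colon_ideal[OF bI]) (use sc in auto)
    have "mp n \<cdot> \<mm> \<subseteq> {d \<in> carrier R. \<forall>y\<in>{s}. y \<otimes> d \<in> scale b ?I}"
    proof (rule ideal_prod_least[OF K])
      fix i j assume i: "i \<in> mp n" and j: "j \<in> \<mm>"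
      obtain r where r: "r \<in> \<mm>" "s \<otimes> j = b \<otimes> r" using socle_mult_\<mm>[OF b_\<mm> b_nzd nd s j] by blast
      have c: "i \<in> carrier R" "j \<in> carrier R" "r \<in> carrier R" using i j r mp_carr \<mm>_carr by auto
      have "s \<otimes> (i \<otimes> j) = i \<otimes> (s \<otimes> j)" using c sc by (simp add: m_lcomm)
      also have "\<dots> = b \<otimes> (i \<otimes> r)" unfolding r(2) using c b_carr by (simp add: m_lcomm)
      finally have e: "s \<otimes> (i \<otimes> j) = b \<otimes> (i \<otimes> r)" .
      have "i \<otimes> r \<in> ?I" unfolding ipow_Suc using i r by (intro ideal_prod.prod)
      then have "s \<otimes> (i \<otimes> j) \<in> scale b ?I" unfolding e scale_def by (rule imageI)
      then show "i \<otimes> j \<in> {d \<in> carrier R. \<forall>y\<in>{s}. y \<otimes> d \<in> scale b ?I}" using c by simp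
    qed
    then show ?thesis using z unfolding ipow_Suc by blast
  qed
  then have U: "{s \<in> socle b. \<forall>z\<in>?I. s \<otimes> z \<in> scale b ?I} = socle b" by blast
  have "cm_type R + enat mult_e \<le> cm_type (idealization R (ideal_module R ?I))"
    unfolding cm_type_idealization[OF dim b_\<mm> b_nzd mp_ideal] U cm_type_eq[OF dim b_\<mm> b_nzd]
      add.commute[of "ilen (PIdl b) (socle b)" "enat mult_e"] using 1 by (rule add_right_mono)
  then show ?thesis using ipow_max_primary by blast
qed

end

theorem theorem1p4:
  fixes R :: "('a, 'm) ring_scheme" (structure)
  assumes "cohen_macaulay_local_ring R"
    and "krull_dim R = 1"
  shows "(SUP I \<in> max_primary_ideals R. ereal_of_enat (cm_type (idealization R (ideal_module R I))))
    = (if discrete_valuation_ring R then 1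
       else ereal_of_enat (cm_type R) + hs_multiplicity R)"
proof -
  obtain b where "cm_local_one R (max_ideal R) b" using cohen_macaulay_cm_local_one[OF assms] by blast
  then interpret cm_local_one R "max_ideal R" b .
  show ?thesis
  proof (cases "discrete_valuation_ring R")
    case True
    have "(SUP I \<in> max_primary_ideals R. ereal_of_enat (cm_type (idealization R (ideal_module R I)))) = (SUP I \<in> max_primary_ideals R. 1)"
      using cm_type_idealization_DVR[OF assms(2) True] by (intro SUP_cong) (auto simp: one_enat_def)
    \<comment> \<open>The supremum of a constant requires a nonempty index set, and positive powers
      of \<open>\<mm>\<close> belong to it.\<close>
    also have "\<dots> = 1" using ipow_max_primary by (intro SUP_const) auto
    finally show ?thesis using True by simp
  next
    case False
    have e: "hs_multiplicity R = ereal_of_enat (enat mult_e)" using hs_multiplicity_eq[OF assms(2)] by simp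
    have "(SUP I \<in> max_primary_ideals R. ereal_of_enat (cm_type (idealization R (ideal_module R I))))
      = ereal_of_enat (cm_type R + enat mult_e)"
    proof (rule antisym)
      show "(SUP I \<in> max_primary_ideals R. ereal_of_enat (cm_type (idealization R (ideal_module R I))))
        \<le> ereal_of_enat (cm_type R + enat mult_e)"
        by (rule SUP_least) (simp only: ereal_of_enat_le_iff cm_type_idealization_le[OF assms(2)])
      obtain I where I: "I \<in> max_primary_ideals R" "cm_type R + enat mult_e \<le> cm_type (idealization R (ideal_module R I))"
        using cm_type_idealization_attained[OF assms(2) False] by blast
      show "ereal_of_enat (cm_type R + enat mult_e)
        \<le> (SUP I \<in> max_primary_ideals R. ereal_of_enat (cm_type (idealization R (ideal_module R I))))"
        by (rule SUP_upper2[OF I(1)]) (simp only: ereal_of_enat_le_iff I(2))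
    qed
    also have "\<dots> = ereal_of_enat (cm_type R) + hs_multiplicity R" unfolding e
      by (simp only: ereal_of_enat_add)
    finally show ?thesis using False by simp
  qed
qed


end
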